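(* Assume A1–A5 (stated in the context), put $s=\frac{r}{2-4r}$ and, for $P_0>0$, $$\bar{\mathbb{B}}^s_{2\infty}(P_0)=\Bigl\{f=\sum_{j=1}^\infty\theta_j\phi_j:\ \theta_j\in\mathbb{R},\ \sup_{\lambda>0}\lambda^{2s}\sum_{j>\lambda}\theta_j^2\le P_0\Bigr\}.$$ Let $f_n$ be a sequence of alternatives with $cn^{-r}\le\|f_n\|\le Cn^{-r}$, $0<c<C<\infty$. Then $f_n$ is consistent if and only if there are $P_0>0$, constants $0<c_1<C_1<\infty$ and a sequence $f_{1n}\in\bar{\mathbb{B}}^s_{2\infty}(P_0)$ with $c_1n^{-r}\le\|f_{1n}\|\le C_1n^{-r}$ such that $f_{1n}$ is orthogonal to $f_n-f_{1n}$, that is, $$\|f_n\|^2=\|f_{1n}\|^2+\|f_n-f_{1n}\|^2 .$$ Therefore, for any $P_0>0$, any sequence $f_{1n}\in\bar{\mathbb{B}}^s_{2\infty}(P_0)$ with $c_1n^{-r}\le\|f_{1n}\|\le C_1n^{-r}$ and any sequence $f_{2n}$ with $c_1n^{-r}\le\|f_{2n}\|\le C_1n^{-r}$ and $f_{2n}$ orthogonal to $f_{1n}$, the sequence of simple alternatives $f_n=f_{1n}+f_{2n}$ is consistent.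
   Context: Setting. Fix $0<r<1/2$ and $\sigma>0$. One observes $dY_n(t)=f(t)\,dt+\frac{\sigma}{\sqrt n}\,dw(t)$, $t\in[0,1]$, with unknown signal $f\in L_2(0,1)$ and Gaussian white noise $dw$. Let $(\phi_j)_{j\ge1}$ be an orthonormal basis of $L_2(0,1)$; then $y_j=\int_0^1\phi_j\,dY_n=\theta_j+\frac{\sigma}{\sqrt n}\xi_j$ with $\theta_j=\int_0^1f\phi_j\,dt$ and $\xi_j$ i.i.d. standard Gaussian. The hypothesis is $f=0$; alternatives are $f=f_n$. The test statistics are $$T_n=\sum_{j=1}^\infty\kappa_{nj}^2y_j^2-\sigma^2n^{-1}\rho_n,\qquad \rho_n=\sum_{j=1}^\infty\kappa_{nj}^2 .$$ Assumptions on the coefficients. $[\cdot]$ is the integer part; $a_n\asymp b_n$ means that $a_n/b_n$ is bounded between two positive constants. A1: for each $n$ the sequence $\kappa_{nj}^2$, $j\ge1$, is decreasing. A2: there are positive constants $C_1,C_2$ such that $C_1<A_n=\sigma^{-4}n^2\sum_{j=1}^\infty\kappa_{nj}^4<C_2$ for each $n$. A3: there are positive constants $c_1,c_2$ such that $c_1n^{-2r}\le\rho_n\le c_2n^{-2r}$. Put $k_n=\sup\{k:\sum_{j<k}\kappa_{nj}^2\le\frac12\rho_n\}$ and $\kappa_n^2=\kappa_{nk_n}^2$. A4: there are $C_1$ and $\lambda>1$ such that $\kappa^2_{n,[(1+\delta)k_n]}<C_1(1+\delta)^{-\lambda}\kappa_n^2$ for any $\delta>0$ and each $n$. A5: $\kappa_{n1}^2\asymp\kappa_n^2$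 as $n\to\infty$, and for any $c>1$ there is $C>0$ such that $\kappa_{n,[ck_n]}^2\ge C\kappa_n^2$ for all $n$. Tests. A test $K_n$ generated by $T_n$ rejects the hypothesis when $T_n$ exceeds a threshold; $\alpha(K_n)$ is its type I error probability and $\beta(K_n,f)$ its type II error probability at $f$. A sequence $f_n$ is consistent if for any $\alpha\in(0,1)$, for tests $K_n$ generated by $T_n$ with $\alpha(K_n)=\alpha(1+o(1))$, one has $\limsup_{n\to\infty}\beta(K_n,f_n)<1-\alpha$. *)

theory Defs
  imports "HOL-Probability.Probability" "HOL-Library.Landau_Symbols"
begin

text \<open>Elements of \<open>L\<^sub>2(0,1)\<close> are represented by functions; functions that agree almost
  everywhere on the unit interval are not identified.\<close>

definition L2_01 :: "(real \<Rightarrow> real) set" where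
  "L2_01 = {f. f \<in> borel_measurable (lebesgue_on {0..1}) \<and>
               integrable (lebesgue_on {0..1}) (\<lambda>t. (f t)\<^sup>2)}"

definition l2_inner :: "(real \<Rightarrow> real) \<Rightarrow> (real \<Rightarrow> real) \<Rightarrow> real" where
  "l2_inner f g = (LINT t|lebesgue_on {0..1}. f t * g t)"

definition l2_norm :: "(real \<Rightarrow> real) \<Rightarrow> real" where
  "l2_norm f = sqrt (l2_inner f f)"

definition l2_orthonormal :: "nat set \<Rightarrow> (nat \<Rightarrow> real \<Rightarrow> real) \<Rightarrow> bool" where
  "l2_orthonormal J e \<longleftrightarrow>
     (\<forall>j\<in>J. e j \<in> L2_01) \<and> (\<forall>i\<in>J. \<forall>j\<in>J. l2_inner (e i) (e j) = (if i = j then 1 else 0))"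

text \<open>Sequences are indexed by \<open>j \<ge> 1\<close>; entries with index \<open>0\<close> are never used.\<close>

definition l2_basis :: "(nat \<Rightarrow> real \<Rightarrow> real) \<Rightarrow> bool" where
  "l2_basis \<phi> \<longleftrightarrow> l2_orthonormal {1..} \<phi> \<and>
     (\<forall>f\<in>L2_01. (\<lambda>m. l2_norm (\<lambda>t. f t - (\<Sum>j=1..m. l2_inner f (\<phi> j) * \<phi> j t)))
                   \<longlonglongrightarrow> 0)"

text \<open>Gaussian white noise as a linear random functional on \<open>L\<^sub>2(0,1)\<close>: \<open>W h\<close> is the Wiener
  integral of \<open>h\<close> with respect to \<open>dw\<close>, and the Wiener process is \<open>w(t) = W (indicator {0..t})\<close>.\<close>

definition white_noise :: "'w measure \<Rightarrow> ((real \<Rightarrow> real) \<Rightarrow> 'w \<Rightarrow> real) \<Rightarrow> bool" where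
  "white_noise M W \<longleftrightarrow> prob_space M \<and>
     (\<forall>h\<in>L2_01. W h \<in> borel_measurable M) \<and>
     (\<forall>g\<in>L2_01. \<forall>h\<in>L2_01. \<forall>a b.
        AE \<omega> in M. W (\<lambda>t. a * g t + b * h t) \<omega> = a * W g \<omega> + b * W h \<omega>) \<and>
     (\<forall>J e. l2_orthonormal J e \<longrightarrow>
        (\<forall>j\<in>J. distributed M lborel (W (e j)) std_normal_density) \<and>
        prob_space.indep_vars M (\<lambda>_. borel) (\<lambda>j. W (e j)) J)"

text \<open>\<open>observation \<sigma> W n f h\<close> is the integral of \<open>h\<close> with respect to
  \<open>dY\<^sub>n(t) = f(t) dt + \<sigma> n\<^sup>-\<^sup>1\<^sup>/\<^sup>2 dw(t)\<close>.\<close>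

definition observation ::
  "real \<Rightarrow> ((real \<Rightarrow> real) \<Rightarrow> 'w \<Rightarrow> real) \<Rightarrow> nat \<Rightarrow> (real \<Rightarrow> real) \<Rightarrow> (real \<Rightarrow> real) \<Rightarrow> 'w \<Rightarrow> real" where
  "observation \<sigma> W n f h \<omega> = l2_inner f h + \<sigma> / sqrt (real n) * W h \<omega>"

definition rho :: "(nat \<Rightarrow> nat \<Rightarrow> real) \<Rightarrow> nat \<Rightarrow> real" where
  "rho \<kappa> n = (\<Sum>\<^sub>\<infinity>j\<in>{1..}. (\<kappa> n j)\<^sup>2)"

definition test_stat ::
  "real \<Rightarrow> ((real \<Rightarrow> real) \<Rightarrow> 'w \<Rightarrow> real) \<Rightarrow> (nat \<Rightarrow> real \<Rightarrow> real) \<Rightarrow> (nat \<Rightarrow> nat \<Rightarrow> real) \<Rightarrow>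
   nat \<Rightarrow> (real \<Rightarrow> real) \<Rightarrow> 'w \<Rightarrow> real" where
  "test_stat \<sigma> W \<phi> \<kappa> n f \<omega> =
     (\<Sum>\<^sub>\<infinity>j\<in>{1..}. (\<kappa> n j)\<^sup>2 * (observation \<sigma> W n f (\<phi> j) \<omega>)\<^sup>2) - \<sigma>\<^sup>2 / real n * rho \<kappa> n"

definition k_index :: "(nat \<Rightarrow> nat \<Rightarrow> real) \<Rightarrow> nat \<Rightarrow> nat" where
  "k_index \<kappa> n = Sup {k. (\<Sum>j=1..<k. (\<kappa> n j)\<^sup>2) \<le> rho \<kappa> n / 2}"

definition kappa_sq :: "(nat \<Rightarrow> nat \<Rightarrow> real) \<Rightarrow> nat \<Rightarrow> real" where
  "kappa_sq \<kappa> n = (\<kappa> n (k_index \<kappa> n))\<^sup>2"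

definition A1 :: "(nat \<Rightarrow> nat \<Rightarrow> real) \<Rightarrow> bool" where
  "A1 \<kappa> \<longleftrightarrow> (\<forall>n\<ge>1. \<forall>i\<ge>1. \<forall>j\<ge>i. (\<kappa> n j)\<^sup>2 \<le> (\<kappa> n i)\<^sup>2)"

definition A2 :: "real \<Rightarrow> (nat \<Rightarrow> nat \<Rightarrow> real) \<Rightarrow> bool" where
  "A2 \<sigma> \<kappa> \<longleftrightarrow> (\<exists>C1>0. \<exists>C2>0. \<forall>n\<ge>1.
     C1 < (real n)\<^sup>2 / \<sigma> ^ 4 * (\<Sum>\<^sub>\<infinity>j\<in>{1..}. (\<kappa> n j) ^ 4) \<and>
     (real n)\<^sup>2 / \<sigma> ^ 4 * (\<Sum>\<^sub>\<infinity>j\<in>{1..}. (\<kappa> n j) ^ 4) < C2)"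

text \<open>An infinite sum of a non-summable family is \<open>0\<close> in the library, so finiteness of
  \<open>\<rho>\<^sub>n\<close> is stated explicitly.\<close>

definition A3 :: "real \<Rightarrow> (nat \<Rightarrow> nat \<Rightarrow> real) \<Rightarrow> bool" where
  "A3 r \<kappa> \<longleftrightarrow> (\<forall>n\<ge>1. (\<lambda>j. (\<kappa> n j)\<^sup>2) summable_on {1..}) \<and>
     (\<exists>c1>0. \<exists>c2>0. \<forall>n\<ge>1.
        c1 * real n powr (- 2 * r) \<le> rho \<kappa> n \<and> rho \<kappa> n \<le> c2 * real n powr (- 2 * r))"

definition A4 :: "(nat \<Rightarrow> nat \<Rightarrow> real) \<Rightarrow> bool" where
  "A4 \<kappa> \<longleftrightarrow> (\<exists>C1. \<exists>l>1. \<forall>\<delta>>0. \<forall>n\<ge>1.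
     (\<kappa> n (nat \<lfloor>(1 + \<delta>) * real (k_index \<kappa> n)\<rfloor>))\<^sup>2 < C1 * (1 + \<delta>) powr (- l) * kappa_sq \<kappa> n)"

definition A5 :: "(nat \<Rightarrow> nat \<Rightarrow> real) \<Rightarrow> bool" where
  "A5 \<kappa> \<longleftrightarrow>
     (\<exists>a>0. \<exists>b>0. \<forall>\<^sub>F n in sequentially.
        a \<le> (\<kappa> n 1)\<^sup>2 / kappa_sq \<kappa> n \<and> (\<kappa> n 1)\<^sup>2 / kappa_sq \<kappa> n \<le> b) \<and>
     (\<forall>c>1. \<exists>C>0. \<forall>n\<ge>1.
        (\<kappa> n (nat \<lfloor>c * real (k_index \<kappa> n)\<rfloor>))\<^sup>2 \<ge> C * kappa_sq \<kappa> n)"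

definition type1_error ::
  "'w measure \<Rightarrow> ((real \<Rightarrow> real) \<Rightarrow> 'w \<Rightarrow> real) \<Rightarrow> real \<Rightarrow> (nat \<Rightarrow> real \<Rightarrow> real) \<Rightarrow>
   (nat \<Rightarrow> nat \<Rightarrow> real) \<Rightarrow> nat \<Rightarrow> real \<Rightarrow> real" where
  "type1_error M W \<sigma> \<phi> \<kappa> n x =
     measure M {\<omega>\<in>space M. test_stat \<sigma> W \<phi> \<kappa> n (\<lambda>_. 0) \<omega> > x}"

definition type2_error ::
  "'w measure \<Rightarrow> ((real \<Rightarrow> real) \<Rightarrow> 'w \<Rightarrow> real) \<Rightarrow> real \<Rightarrow> (nat \<Rightarrow> real \<Rightarrow> real) \<Rightarrow>
   (nat \<Rightarrow> nat \<Rightarrow> real) \<Rightarrow> nat \<Rightarrow> real \<Rightarrow> (real \<Rightarrow> real) \<Rightarrow> real" where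
  "type2_error M W \<sigma> \<phi> \<kappa> n x f =
     measure M {\<omega>\<in>space M. \<not> test_stat \<sigma> W \<phi> \<kappa> n f \<omega> > x}"

text \<open>The tests generated by \<open>T\<^sub>n\<close> correspond to the threshold sequences \<open>x\<close>; asymptotic
  equivalence of the level to the constant \<open>\<alpha>\<close> is \<open>\<alpha>(K\<^sub>n) = \<alpha> (1 + o(1))\<close>.\<close>

definition consistent ::
  "'w measure \<Rightarrow> ((real \<Rightarrow> real) \<Rightarrow> 'w \<Rightarrow> real) \<Rightarrow> real \<Rightarrow> (nat \<Rightarrow> real \<Rightarrow> real) \<Rightarrow>
   (nat \<Rightarrow> nat \<Rightarrow> real) \<Rightarrow> (nat \<Rightarrow> real \<Rightarrow> real) \<Rightarrow> bool" where
  "consistent M W \<sigma> \<phi> \<kappa> f \<longleftrightarrow>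
     (\<forall>\<alpha>\<in>{0<..<1}. \<forall>x :: nat \<Rightarrow> real.
        (\<lambda>n. type1_error M W \<sigma> \<phi> \<kappa> n (x n)) \<sim>[sequentially] (\<lambda>_. \<alpha>) \<longrightarrow>
        limsup (\<lambda>n. ereal (type2_error M W \<sigma> \<phi> \<kappa> n (x n) (f n))) < ereal (1 - \<alpha>))"

text \<open>In \<open>besov_ball\<close>, \<open>\<theta>\<^sub>j = l2_inner f (\<phi> j)\<close>; these are square summable because \<open>f\<close> is in
  \<open>L\<^sub>2(0,1)\<close>. The condition \<open>j > l > 0\<close> already forces \<open>j \<ge> 1\<close>.\<close>

definition besov_ball ::
  "(nat \<Rightarrow> real \<Rightarrow> real) \<Rightarrow> real \<Rightarrow> real \<Rightarrow> (real \<Rightarrow> real) set" where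
  "besov_ball \<phi> s P0 = {f \<in> L2_01.
     (SUP l\<in>{0<..}. ereal (l powr (2 * s) * (\<Sum>\<^sub>\<infinity>j\<in>{j. l < real j}. (l2_inner f (\<phi> j))\<^sup>2)))
       \<le> ereal P0}"

definition norm_rate :: "real \<Rightarrow> real \<Rightarrow> real \<Rightarrow> (nat \<Rightarrow> real \<Rightarrow> real) \<Rightarrow> bool" where
  "norm_rate r c C f \<longleftrightarrow> (\<forall>n\<ge>1. f n \<in> L2_01 \<and>
     c * real n powr (- r) \<le> l2_norm (f n) \<and> l2_norm (f n) \<le> C * real n powr (- r))"

end

theory Submission
  imports Defs
begin

text \<open>Fix \<open>n\<close>, put \<open>a\<^sub>j = \<kappa>\<^sub>n\<^sub>j\<^sup>2\<close>, \<open>e = \<sigma> / sqrt n\<close> and let \<open>\<theta>\<^sub>j\<close> be the coefficients of the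
  signal. Almost surely the test statistic is the sum of three terms: the weighted energy
  \<open>\<Sum>a\<^sub>j \<theta>\<^sub>j\<^sup>2\<close> of the signal, the Gaussian cross term \<open>2 e \<Sum>a\<^sub>j \<theta>\<^sub>j \<xi>\<^sub>j\<close>, and the null statistic
  \<open>e\<^sup>2 \<Sum>a\<^sub>j (\<xi>\<^sub>j\<^sup>2 - 1)\<close>, whose standard deviation \<open>v = e\<^sup>2 sqrt (2 \<Sum>a\<^sub>j\<^sup>2)\<close> is of order \<open>n\<^sup>-\<^sup>2\<close>.
  By assumption \<open>a\<^sub>1 / sqrt (2 \<Sum>a\<^sub>j\<^sup>2)\<close> is of order \<open>n\<^sup>2\<^sup>r\<^sup>-\<^sup>1\<close> and so tends to \<open>0\<close>
  (\<open>max_weight_ratio_tendsto_0\<close>). This one limit has two consequences. No summand dominates, so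
  the null statistic divided by \<open>v\<close> is asymptotically standard normal
  (\<open>clt_quadratic_forms\<close>). And the variance of the cross term, in units of \<open>v\<^sup>2\<close>, is \<open>o(1)\<close> times the
  shift \<open>\<Sum>a\<^sub>j \<theta>\<^sub>j\<^sup>2 / v\<close> (\<open>energy_stat_cross_term_tail\<close>), so the cross term is negligible both when the
  shift is small and when it is large. Only the shift matters: the alternatives are consistent
  iff \<open>n\<^sup>2 \<Sum>a\<^sub>j \<theta>\<^sub>j\<^sup>2\<close> is eventually bounded away from \<open>0\<close> (\<open>consistent_iff_signal_energy\<close>).

  What remains is deterministic. The assumptions force \<open>\<kappa>\<^sub>n\<^sup>2\<close> to be of order \<open>n\<^sup>2\<^sup>r\<^sup>-\<^sup>2\<close> and
  \<open>k\<^sub>n\<close> to be of order \<open>n\<^sup>2\<^sup>-\<^sup>4\<^sup>r\<close> (\<open>kappa_asymptotics\<close>). For signals with \<open>\<parallel>f\<parallel>\<^sup>2\<close> of order \<open>n\<^sup>-\<^sup>2\<^sup>r\<close>, the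
  quantity \<open>n\<^sup>2 \<kappa>\<^sub>n\<^sup>2 \<parallel>f\<parallel>\<^sup>2\<close> is therefore of constant order, and the weights decay beyond multiples of
  \<open>k\<^sub>n\<close>. So consistency says that a fixed proportion of the energy of \<open>f\<^sub>n\<close> sits in the first
  \<open>L k\<^sub>n\<close> coordinates, for some constant \<open>L\<close>. The exponent \<open>s\<close> is such that \<open>k\<^sub>n\<^sup>2\<^sup>s\<close> is of order
  \<open>n\<^sup>2\<^sup>r\<close>, and hence an expansion of length \<open>L k\<^sub>n\<close> with squared norm of order \<open>n\<^sup>-\<^sup>2\<^sup>r\<close> lies in a fixed
  Besov ball: cutting off \<open>f\<^sub>n\<close> at \<open>L k\<^sub>n\<close> gives the required \<open>f\<^sub>1\<^sub>n\<close>.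

  Conversely, an element \<open>f\<^sub>1\<^sub>n\<close> of a Besov ball has little energy beyond \<open>L k\<^sub>n\<close> for large \<open>L\<close>. Its
  low frequencies could still be cancelled by \<open>f\<^sub>n - f\<^sub>1\<^sub>n\<close>, because orthogonality of functions is not
  orthogonality coordinate by coordinate. But orthogonality gives
  \<open>\<langle>f\<^sub>1\<^sub>n, f\<^sub>n\<rangle> = \<parallel>f\<^sub>1\<^sub>n\<parallel>\<^sup>2\<close>, and the high frequencies can contribute only a small part of this inner
  product as long as \<open>\<parallel>f\<^sub>n\<parallel>\<close> is of order \<open>n\<^sup>-\<^sup>r\<close>. So \<open>f\<^sub>n\<close> itself has low-frequency energy of order
  \<open>n\<^sup>-\<^sup>2\<^sup>r\<close> (\<open>low_frequency_mass\<close>). The same argument covers the second claim.\<close>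

section \<open>Series indexed from one\<close>

lemma has_sum_from_1_LIMSEQ:
  fixes f :: "nat \<Rightarrow> 'b :: {comm_monoid_add, topological_space}"
  assumes "(f has_sum s) {1..}"
  shows "(\<lambda>m. \<Sum>j=1..m. f j) \<longlonglongrightarrow> s"
proof -
  have "filterlim (\<lambda>m. {1..m}) (finite_subsets_at_top {1..}) (sequentially :: nat filter)"
    unfolding filterlim_finite_subsets_at_top
  proof (intro allI impI)
    fix X :: "nat set"
    assume X: "finite X \<and> X \<subseteq> {1..}"
    then obtain N where "\<forall>x\<in>X. x \<le> N"
      using finite_nat_set_iff_bounded_le by blast
    then show "\<forall>\<^sub>F m in sequentially. finite {1..m} \<and> X \<subseteq> {1..m} \<and> {1..m} \<subseteq> {1..}"
      using X by (intro eventually_sequentiallyI[of N]) fastforce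
  qed
  from filterlim_compose[OF assms[unfolded has_sum_def] this] show ?thesis by simp
qed

lemma has_sum_from_1_nonneg:
  fixes f :: "nat \<Rightarrow> real"
  assumes nn: "\<And>j. j \<ge> 1 \<Longrightarrow> 0 \<le> f j" and lim: "(\<lambda>m. \<Sum>j=1..m. f j) \<longlonglongrightarrow> s"
  shows "(f has_sum s) {1..}"
proof -
  have bd: "(\<Sum>j=1..m. f j) \<le> s" for m
  proof (rule incseq_le[OF _ lim])
    show "incseq (\<lambda>m. \<Sum>j=1..m. f j)"
      using nn by (intro incseq_SucI) auto
  qed
  have "f summable_on {1..}"
  proof (rule nonneg_bdd_above_summable_on)
    show "bdd_above (sum f ` {F. F \<subseteq> {1..} \<and> finite F})"
    proof (rule bdd_aboveI2)
      fix F :: "nat set"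
      assume "F \<in> {F. F \<subseteq> {1..} \<and> finite F}"
      then obtain N where "F \<subseteq> {1..N}"
        using finite_nat_set_iff_bounded_le[of F] by fastforce
      then have "sum f F \<le> sum f {1..N}"
        by (intro sum_mono2) (auto intro: nn)
      then show "sum f F \<le> s" using bd[of N] by linarith
    qed
  qed (use nn in auto)
  then have "(f has_sum infsum f {1..}) {1..}" by simp
  with has_sum_from_1_LIMSEQ[OF this] lim show ?thesis
    using LIMSEQ_unique by blast
qed

text \<open>The identity holds for divergent series too: both sides are then \<open>0\<close>, the right one because
  \<open>enn2real \<infinity> = 0\<close>. It makes the infinite sums in the test statistic measurable on the whole sample
  space, and it reduces their almost sure convergence to finiteness of an expectation.\<close>
lemma infsum_from_1_eq_enn2real:
  fixes f :: "nat \<Rightarrow> real"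
  assumes nn: "\<And>j. j \<ge> 1 \<Longrightarrow> 0 \<le> f j"
  shows "infsum f {1..} = enn2real (\<Sum>i. ennreal (f (Suc i)))"
    and "(\<Sum>i. ennreal (f (Suc i))) < \<infinity> \<Longrightarrow> f summable_on {1..}"
proof -
  have nn': "0 \<le> f (Suc i)" for i by (rule nn) simp
  have reind: "(\<Sum>j=1..m. f j) = (\<Sum>i<m. f (Suc i))" for m
    by (simp add: sum.atLeast1_atMost_eq)
  have S: "f summable_on {1..}" if "(\<Sum>i. ennreal (f (Suc i))) < \<infinity>"
  proof -
    have "summable (\<lambda>i. f (Suc i))"
      using that nn' summable_suminf_not_top[of "\<lambda>i. f (Suc i)"] by auto
    then have "(\<lambda>m. \<Sum>j=1..m. f j) \<longlonglongrightarrow> (\<Sum>i. f (Suc i))"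
      unfolding reind by (rule summable_LIMSEQ)
    then show ?thesis
      using has_sum_from_1_nonneg[OF nn] by (auto simp: has_sum_iff)
  qed
  then show "(\<Sum>i. ennreal (f (Suc i))) < \<infinity> \<Longrightarrow> f summable_on {1..}" .
  show "infsum f {1..} = enn2real (\<Sum>i. ennreal (f (Suc i)))"
  proof (cases "f summable_on {1..}")
    case True
    then have "(f has_sum infsum f {1..}) {1..}" by simp
    from has_sum_from_1_LIMSEQ[OF this]
    have "(\<lambda>i. f (Suc i)) sums infsum f {1..}" unfolding reind sums_def .
    then have "(\<Sum>i. ennreal (f (Suc i))) = ennreal (infsum f {1..})"
      by (intro suminf_ennreal_eq nn')
    then show ?thesis using infsum_nonneg[of "{1..}" f] nn by simp
  next
    case False
    then have "(\<Sum>i. ennreal (f (Suc i))) = \<infinity>" using S by (auto simp: less_top[symmetric])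
    then show ?thesis using False by (simp add: infsum_not_exists)
  qed
qed

section \<open>Linear and quadratic forms in independent Gaussian variables\<close>

lemma exp_minus_taylor_bound:
  fixes x :: real
  assumes "0 \<le> x"
  shows "\<bar>exp (- x) - (1 - x)\<bar> \<le> x\<^sup>2 / 2"
proof -
  have "exp (-x) \<ge> 1 - x" using exp_ge_add_one_self[of "-x"] by simp
  moreover have "exp (-x) \<le> 1 - x + x\<^sup>2 / 2"
  proof -
    have *: "\<exists>z. z > 0 \<and> z < x \<and> (x\<^sup>2 / 2 + 1 - x - exp (-x)) - (0\<^sup>2 / 2 + 1 - 0 - exp (-0)) = (x - 0) * (z - 1 + exp (-z))" if "x > 0"
      by (rule MVT2[OF that]) (auto intro!: derivative_eq_intros)
    have "x\<^sup>2 / 2 + 1 - x - exp (-x) \<ge> 0"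
    proof (cases "x = 0")
      case False
      then obtain z where z: "z > 0" "x\<^sup>2 / 2 + 1 - x - exp (-x) = x * (z - 1 + exp (-z))"
        using * assms by auto
      have "z - 1 + exp (-z) \<ge> 0" using exp_ge_add_one_self[of "-z"] by simp
      then show ?thesis using z assms by simp
    qed simp
    then show ?thesis by simp
  qed
  ultimately show ?thesis by (simp add: abs_le_iff)
qed

locale gaussian_sequence = prob_space M for M :: "'w measure" +
  fixes \<xi> :: "nat \<Rightarrow> 'w \<Rightarrow> real"
  assumes normal: "\<And>j. j \<ge> 1 \<Longrightarrow> distributed M lborel (\<xi> j) std_normal_density"
    and indep: "indep_vars (\<lambda>_. borel) \<xi> {1..}"
begin

lemma measurable_xi [measurable]: "Suc 0 \<le> j \<Longrightarrow> \<xi> j \<in> borel_measurable M"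
  using indep unfolding indep_vars_def2 by auto

lemma integrable_xi_power: "j \<ge> 1 \<Longrightarrow> integrable M (\<lambda>\<omega>. \<xi> j \<omega> ^ k)"
  using distributed_integrable[OF normal, of j "\<lambda>x. x ^ k"] integrable_std_normal_moment[of k]
  by simp

lemma expectation_xi_even:
  "j \<ge> 1 \<Longrightarrow> expectation (\<lambda>\<omega>. \<xi> j \<omega> ^ (2 * k)) = fact (2 * k) / (2 ^ k * fact k)"
  using distributed_integral[OF normal, of j "\<lambda>x. x ^ (2 * k)"]
  by (simp add: integral_std_normal_moment_even)

lemma expectation_xi: "j \<ge> 1 \<Longrightarrow> expectation (\<xi> j) = 0"
  using distributed_integral[OF normal, of j "\<lambda>x. x"] integral_std_normal_moment_odd[of 0]
  by simp

lemma expectation_xi_prod: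
  assumes "i \<ge> 1" "j \<ge> 1"
  shows "integrable M (\<lambda>\<omega>. \<xi> i \<omega> * \<xi> j \<omega>)"
    and "expectation (\<lambda>\<omega>. \<xi> i \<omega> * \<xi> j \<omega>) = (if i = j then 1 else 0)"
proof -
  have 1: "integrable M (\<xi> k)" if "k \<ge> 1" for k using integrable_xi_power[OF that, of 1] by simp
  have "integrable M (\<lambda>\<omega>. \<xi> i \<omega> * \<xi> j \<omega>) \<and>
      expectation (\<lambda>\<omega>. \<xi> i \<omega> * \<xi> j \<omega>) = (if i = j then 1 else 0)"
  proof (cases "i = j")
    case True
    then show ?thesis
      using integrable_xi_power[of i 2] expectation_xi_even[of i 1] assms
      by (simp add: power2_eq_square)
  next
    case False
    have ind: "indep_vars (\<lambda>_. borel) \<xi> {i, j}"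
      using assms by (intro indep_vars_subset[OF indep]) auto
    show ?thesis
      using indep_vars_lebesgue_integral[OF _ ind] indep_vars_integrable[OF _ ind] 1 assms False
      by (auto simp: expectation_xi)
  qed
  then show "integrable M (\<lambda>\<omega>. \<xi> i \<omega> * \<xi> j \<omega>)"
    and "expectation (\<lambda>\<omega>. \<xi> i \<omega> * \<xi> j \<omega>) = (if i = j then 1 else 0)" by auto
qed

lemma linear_form_second_moment:
  shows "integrable M (\<lambda>\<omega>. (\<Sum>j=1..m. b j * \<xi> j \<omega>)\<^sup>2)"
    and "expectation (\<lambda>\<omega>. (\<Sum>j=1..m. b j * \<xi> j \<omega>)\<^sup>2) = (\<Sum>j=1..m. (b j)\<^sup>2)"
proof -
  have eq: "(\<Sum>j=1..m. b j * \<xi> j \<omega>)\<^sup>2 = (\<Sum>i=1..m. \<Sum>j=1..m. b i * b j * (\<xi> i \<omega> * \<xi> j \<omega>))" for \<omega>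
    by (simp add: power2_eq_square sum_product ac_simps)
  show "integrable M (\<lambda>\<omega>. (\<Sum>j=1..m. b j * \<xi> j \<omega>)\<^sup>2)"
    unfolding eq by (intro Bochner_Integration.integrable_sum integrable_mult_right expectation_xi_prod) auto
  have "expectation (\<lambda>\<omega>. (\<Sum>j=1..m. b j * \<xi> j \<omega>)\<^sup>2)
      = (\<Sum>i=1..m. \<Sum>j=1..m. b i * b j * expectation (\<lambda>\<omega>. \<xi> i \<omega> * \<xi> j \<omega>))"
    unfolding eq
    by (subst Bochner_Integration.integral_sum,
        intro Bochner_Integration.integrable_sum integrable_mult_right expectation_xi_prod, simp, simp,
        rule sum.cong, simp, subst Bochner_Integration.integral_sum,
        intro integrable_mult_right expectation_xi_prod, simp, simp, rule sum.cong, simp, simp)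
  also have "\<dots> = (\<Sum>i=1..m. \<Sum>j=1..m. if i = j then b i * b j else 0)"
    by (intro sum.cong refl) (auto simp: expectation_xi_prod)
  also have "\<dots> = (\<Sum>j=1..m. (b j)\<^sup>2)"
    by (simp add: power2_eq_square)
  finally show "expectation (\<lambda>\<omega>. (\<Sum>j=1..m. b j * \<xi> j \<omega>)\<^sup>2) = (\<Sum>j=1..m. (b j)\<^sup>2)" .
qed

text \<open>Chebyshev's inequality for an infinite linear form. Fatou's lemma carries the second moment
  over from the partial sums, so that almost sure convergence suffices.\<close>
lemma linear_form_tail_bound:
  assumes [measurable]: "Y \<in> borel_measurable M"
    and lim: "AE \<omega> in M. (\<lambda>m. \<Sum>j=1..m. b j * \<xi> j \<omega>) \<longlonglongrightarrow> Y \<omega>"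
    and V: "\<And>m. (\<Sum>j=1..m. (b j)\<^sup>2) \<le> V" and "\<epsilon> > 0"
  shows "prob {\<omega>\<in>space M. \<bar>Y \<omega>\<bar> \<ge> \<epsilon>} \<le> V / \<epsilon>\<^sup>2"
proof -
  let ?S = "\<lambda>m \<omega>. \<Sum>j=1..m. b j * \<xi> j \<omega>"
  have [measurable]: "?S m \<in> borel_measurable M" for m by (intro borel_measurable_sum) auto
  have V0: "0 \<le> V" using V[of 0] by simp
  have "(\<integral>\<^sup>+\<omega>. ennreal ((Y \<omega>)\<^sup>2) \<partial>M) = (\<integral>\<^sup>+\<omega>. liminf (\<lambda>m. ennreal ((?S m \<omega>)\<^sup>2)) \<partial>M)"
  proof (rule nn_integral_cong_AE, use lim in eventually_elim)
    case (elim \<omega>)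
    then have "(\<lambda>m. ennreal ((?S m \<omega>)\<^sup>2)) \<longlonglongrightarrow> ennreal ((Y \<omega>)\<^sup>2)"
      by (intro tendsto_ennrealI tendsto_power)
    then show ?case by (intro lim_imp_Liminf[symmetric]) auto
  qed
  also have "\<dots> \<le> liminf (\<lambda>m. \<integral>\<^sup>+\<omega>. ennreal ((?S m \<omega>)\<^sup>2) \<partial>M)"
    by (rule nn_integral_liminf) measurable
  also have "\<dots> \<le> liminf (\<lambda>m::nat. ennreal V)"
  proof (intro Liminf_mono always_eventually allI)
    fix m
    have "(\<integral>\<^sup>+\<omega>. ennreal ((?S m \<omega>)\<^sup>2) \<partial>M) = ennreal (\<Sum>j=1..m. (b j)\<^sup>2)"
      using linear_form_second_moment[of b m] by (subst nn_integral_eq_integral) auto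
    then show "(\<integral>\<^sup>+\<omega>. ennreal ((?S m \<omega>)\<^sup>2) \<partial>M) \<le> ennreal V" using V by (simp add: ennreal_leI)
  qed
  also have "\<dots> = ennreal V" by (simp add: Liminf_const)
  finally have I: "(\<integral>\<^sup>+\<omega>. ennreal ((Y \<omega>)\<^sup>2) \<partial>M) \<le> ennreal V" .
  have "emeasure M {\<omega>\<in>space M. \<bar>Y \<omega>\<bar> \<ge> \<epsilon>} \<le> emeasure M {\<omega>\<in>space M. 1 \<le> ennreal (1 / \<epsilon>\<^sup>2) * ennreal ((Y \<omega>)\<^sup>2)}"
  proof (rule emeasure_mono)
    show "{\<omega>\<in>space M. \<bar>Y \<omega>\<bar> \<ge> \<epsilon>} \<subseteq> {\<omega>\<in>space M. 1 \<le> ennreal (1 / \<epsilon>\<^sup>2) * ennreal ((Y \<omega>)\<^sup>2)}"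
    proof safe
      fix \<omega> assume "\<bar>Y \<omega>\<bar> \<ge> \<epsilon>"
      then have "(Y \<omega>)\<^sup>2 \<ge> \<epsilon>\<^sup>2" using assms(4) by (metis abs_le_square_iff abs_of_pos)
      then have "1 \<le> 1 / \<epsilon>\<^sup>2 * (Y \<omega>)\<^sup>2" using assms(4) by (simp add: field_simps)
      then show "1 \<le> ennreal (1 / \<epsilon>\<^sup>2) * ennreal ((Y \<omega>)\<^sup>2)"
        by (simp add: ennreal_mult'[symmetric] ennreal_1[symmetric] ennreal_leI del: ennreal_1)
    qed
  qed measurable
  also have "\<dots> \<le> ennreal (1 / \<epsilon>\<^sup>2) * (\<integral>\<^sup>+\<omega>. ennreal ((Y \<omega>)\<^sup>2) * indicator (space M) \<omega> \<partial>M)"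
    by (rule nn_integral_Markov_inequality) auto
  also have "(\<integral>\<^sup>+\<omega>. ennreal ((Y \<omega>)\<^sup>2) * indicator (space M) \<omega> \<partial>M) = (\<integral>\<^sup>+\<omega>. ennreal ((Y \<omega>)\<^sup>2) \<partial>M)"
    by (intro nn_integral_cong) auto
  also have "ennreal (1 / \<epsilon>\<^sup>2) * (\<integral>\<^sup>+\<omega>. ennreal ((Y \<omega>)\<^sup>2) \<partial>M) \<le> ennreal (1 / \<epsilon>\<^sup>2) * ennreal V"
    by (intro mult_left_mono I) auto
  also have "\<dots> = ennreal (V / \<epsilon>\<^sup>2)" using V0 by (simp add: ennreal_mult'[symmetric])
  finally show ?thesis using V0 by (simp add: emeasure_eq_measure)
qed

text \<open>The expectation of the series is \<open>\<Sum>a\<^sub>j (\<theta>\<^sub>j\<^sup>2 + e\<^sup>2) < \<infinity>\<close>.\<close>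
lemma AE_summable_weighted_squares:
  assumes "\<And>j. j \<ge> 1 \<Longrightarrow> 0 \<le> a j" and a: "a summable_on {1..}"
    and at: "(\<lambda>j. a j * (\<theta> j)\<^sup>2) summable_on {1..}"
  shows "AE \<omega> in M. (\<lambda>j. a j * (\<theta> j + e * \<xi> j \<omega>)\<^sup>2) summable_on {1..}"
proof -
  let ?g = "\<lambda>j. a j * (\<theta> j)\<^sup>2 + a j * e\<^sup>2"
  have a0: "0 \<le> a (Suc i)" for i using assms(1) by simp
  have gs: "?g summable_on {1..}"
    using at a by (intro summable_on_add summable_on_cmult_left)
  have E: "(\<integral>\<^sup>+\<omega>. ennreal (a (Suc i) * (\<theta> (Suc i) + e * \<xi> (Suc i) \<omega>)\<^sup>2) \<partial>M) = ennreal (?g (Suc i))" for i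
  proof -
    let ?x = "\<xi> (Suc i)"
    have i1: "integrable M ?x" and i2: "integrable M (\<lambda>\<omega>. (?x \<omega>)\<^sup>2)"
      using integrable_xi_power[of "Suc i" 1] integrable_xi_power[of "Suc i" 2] by auto
    have eq: "a (Suc i) * (\<theta> (Suc i) + e * ?x \<omega>)\<^sup>2 = a (Suc i) * (\<theta> (Suc i))\<^sup>2
      + (2 * a (Suc i) * \<theta> (Suc i) * e) * ?x \<omega> + (a (Suc i) * e\<^sup>2) * (?x \<omega>)\<^sup>2" for \<omega>
      by (simp add: power2_eq_square algebra_simps)
    have "integrable M (\<lambda>\<omega>. a (Suc i) * (\<theta> (Suc i) + e * ?x \<omega>)\<^sup>2)"
      unfolding eq using i1 i2 by auto
    moreover have "expectation (\<lambda>\<omega>. a (Suc i) * (\<theta> (Suc i) + e * ?x \<omega>)\<^sup>2) = ?g (Suc i)"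
      unfolding eq using i1 i2 expectation_xi[of "Suc i"] expectation_xi_even[of "Suc i" 1]
      by (simp add: prob_space)
    ultimately show ?thesis using a0 by (subst nn_integral_eq_integral) auto
  qed
  have m: "(\<lambda>\<omega>. ennreal (a (Suc i) * (\<theta> (Suc i) + e * \<xi> (Suc i) \<omega>)\<^sup>2)) \<in> borel_measurable M" for i
    by measurable
  have "(\<integral>\<^sup>+\<omega>. (\<Sum>i. ennreal (a (Suc i) * (\<theta> (Suc i) + e * \<xi> (Suc i) \<omega>)\<^sup>2)) \<partial>M) = (\<Sum>i. ennreal (?g (Suc i)))"
    using m by (subst nn_integral_suminf) (auto simp: E)
  also have "\<dots> \<noteq> \<infinity>"
  proof -
    have "summable (\<lambda>i. ?g (Suc i))"
    proof -
      have "(?g has_sum infsum ?g {1..}) {1..}" using gs by simp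
      from has_sum_from_1_LIMSEQ[OF this] show ?thesis
        by (auto simp: sums_def summable_def sum.atLeast1_atMost_eq)
    qed
    then show ?thesis using a0 by (subst suminf_ennreal2) auto
  qed
  finally have "AE \<omega> in M. (\<Sum>i. ennreal (a (Suc i) * (\<theta> (Suc i) + e * \<xi> (Suc i) \<omega>)\<^sup>2)) \<noteq> \<infinity>"
    using m by (intro nn_integral_PInf_AE) auto
  then show ?thesis
  proof eventually_elim
    case (elim \<omega>)
    then show ?case
      by (intro infsum_from_1_eq_enn2real(2)) (auto simp: assms(1) less_top[symmetric])
  qed
qed

definition centred_square :: "nat \<Rightarrow> 'w \<Rightarrow> real" where
  "centred_square j \<omega> = (\<xi> j \<omega>)\<^sup>2 - 1"

definition cube_moment :: real where
  "cube_moment = (\<integral>x. \<bar>x\<^sup>2 - 1\<bar> ^ 3 \<partial>std_normal_distribution)"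

lemma cube_moment_nonneg: "0 \<le> cube_moment"
  unfolding cube_moment_def by (intro integral_nonneg_AE) auto

lemma measurable_centred_square [measurable]:
  "Suc 0 \<le> j \<Longrightarrow> centred_square j \<in> borel_measurable M"
  unfolding centred_square_def by measurable

text \<open>A centred square has mean \<open>0\<close> and variance \<open>2\<close>, so its characteristic function is
  \<open>1 - u\<^sup>2 + O(|u|\<^sup>3)\<close>, and \<open>exp (- u\<^sup>2)\<close> is \<open>1 - u\<^sup>2 + O(u\<^sup>4)\<close>. Agreement beyond the second order is
  what a central limit theorem of Lyapunov type needs.\<close>
lemma char_centred_square:
  assumes j: "j \<ge> 1"
  shows "cmod (char (distr M borel (centred_square j)) u - exp (- u\<^sup>2)) \<le> cube_moment * \<bar>u\<bar> ^ 3 + u ^ 4"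
proof -
  let ?N = std_normal_distribution
  interpret N: real_distribution ?N by (rule real_dist_normal_dist)
  have distr_xi: "distr M borel (\<xi> j) = ?N"
    using distributed_distr_eq_density[OF normal[OF j]] by (simp cong: distr_cong)
  have distr_eq: "distr M borel (centred_square j) = distr ?N borel (\<lambda>x. x\<^sup>2 - 1)"
    unfolding distr_xi[symmetric] using j
    by (subst distr_distr) (auto simp: centred_square_def[abs_def] o_def)
  have i2: "integrable ?N (\<lambda>x. x\<^sup>2)" and i4: "integrable ?N (\<lambda>x. x ^ 4)" and i6: "integrable ?N (\<lambda>x. x ^ 6)"
    by (rule integrable_std_normal_distribution_moment)+
  have e2: "N.expectation (\<lambda>x. x\<^sup>2) = 1" and e4: "N.expectation (\<lambda>x. x ^ 4) = 3"
    using std_normal_distribution_even_moments(1)[of 1] std_normal_distribution_even_moments(1)[of 2]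
    by (auto simp: fact_numeral)
  have sq: "((x::real)\<^sup>2 - 1)\<^sup>2 = x ^ 4 - 2 * x\<^sup>2 + 1" for x by algebra
  have int1: "integrable ?N (\<lambda>x. x\<^sup>2 - 1)" using i2 by auto
  have int2: "integrable ?N (\<lambda>x. (x\<^sup>2 - 1)\<^sup>2)" unfolding sq using i2 i4 by auto
  have mean: "N.expectation (\<lambda>x. x\<^sup>2 - 1) = 0" using i2 e2 N.prob_space by simp
  have var: "N.variance (\<lambda>x. x\<^sup>2 - 1) = 2"
    unfolding mean by (simp add: sq i2 i4 e2 e4 N.prob_space[simplified])
  have int3: "integrable ?N (\<lambda>x. \<bar>x\<^sup>2 - 1\<bar> ^ 3)"
  proof (rule Bochner_Integration.integrable_bound)
    show "integrable ?N (\<lambda>x. x ^ 6 + 3 * x ^ 4 + 3 * x\<^sup>2 + 1)" using i2 i4 i6 by auto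
    have "\<bar>x\<^sup>2 - 1\<bar> ^ 3 \<le> x ^ 6 + 3 * x ^ 4 + 3 * x\<^sup>2 + 1" for x :: real
    proof -
      have "\<bar>x\<^sup>2 - 1\<bar> ^ 3 \<le> (x\<^sup>2 + 1) ^ 3" by (intro power_mono) (auto simp: abs_le_iff)
      also have "\<dots> = x ^ 6 + 3 * x ^ 4 + 3 * x\<^sup>2 + 1" by algebra
      finally show ?thesis .
    qed
    then show "AE x in ?N. norm (\<bar>x\<^sup>2 - 1\<bar> ^ 3) \<le> norm (x ^ 6 + 3 * x ^ 4 + 3 * x\<^sup>2 + 1)"
      by (intro AE_I2) (smt (verit) real_norm_def zero_le_power abs_ge_zero)
  qed auto
  have "cmod (char (distr ?N borel (\<lambda>x. x\<^sup>2 - 1)) u - (1 - u\<^sup>2 * 2 / 2))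
      \<le> u\<^sup>2 / 6 * N.expectation (\<lambda>x. min (6 * (x\<^sup>2 - 1)\<^sup>2) (\<bar>u\<bar> * \<bar>x\<^sup>2 - 1\<bar> ^ 3))"
    by (rule N.char_approx3') (use int1 int2 mean var in auto)
  also have "\<dots> \<le> u\<^sup>2 / 6 * N.expectation (\<lambda>x. \<bar>u\<bar> * \<bar>x\<^sup>2 - 1\<bar> ^ 3)"
  proof (intro mult_left_mono integral_mono)
    show "integrable ?N (\<lambda>x. min (6 * (x\<^sup>2 - 1)\<^sup>2) (\<bar>u\<bar> * \<bar>x\<^sup>2 - 1\<bar> ^ 3))"
      by (rule Bochner_Integration.integrable_bound[OF integrable_mult_right[OF int3, of "\<bar>u\<bar>"]]) auto
  qed (use int3 in auto)
  also have "\<dots> = u\<^sup>2 / 6 * (\<bar>u\<bar> * cube_moment)" unfolding cube_moment_def by simp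
  also have "\<dots> \<le> cube_moment * \<bar>u\<bar> ^ 3"
  proof -
    have "u\<^sup>2 / 6 * (\<bar>u\<bar> * cube_moment) = \<bar>u\<bar>\<^sup>2 * \<bar>u\<bar> * cube_moment / 6" by simp
    also have "\<dots> = cube_moment * \<bar>u\<bar> ^ 3 / 6"
      by (simp add: power3_eq_cube power2_eq_square del: abs_mult_self_eq)
    also have "\<dots> \<le> cube_moment * \<bar>u\<bar> ^ 3" using cube_moment_nonneg by simp
    finally show ?thesis .
  qed
  finally have 1: "cmod (char (distr M borel (centred_square j)) u - (1 - u\<^sup>2)) \<le> cube_moment * \<bar>u\<bar> ^ 3"
    unfolding distr_eq by simp
  have "cmod (complex_of_real (1 - u\<^sup>2) - exp (- u\<^sup>2)) = \<bar>exp (- u\<^sup>2) - (1 - u\<^sup>2)\<bar>"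
    unfolding of_real_diff[symmetric] norm_of_real by simp
  also have "\<dots> \<le> (u\<^sup>2)\<^sup>2 / 2" by (rule exp_minus_taylor_bound) simp
  also have "\<dots> \<le> u ^ 4" by (simp add: power_mult[symmetric])
  finally have 2: "cmod (complex_of_real (1 - u\<^sup>2) - exp (- u\<^sup>2)) \<le> u ^ 4" .
  show ?thesis
    using norm_triangle_le[OF add_mono[OF 1 2]] by simp
qed

text \<open>A product of numbers in the unit disc changes by at most the sum of the changes of its factors.
  Each factor contributes an error of third order in \<open>t a\<^sub>j\<close>, and the bound \<open>|a\<^sub>j| \<le> h\<close> turns the excess
  over second order into a small constant in front of \<open>t\<^sup>2 \<Sum>a\<^sub>j\<^sup>2\<close>. The bound does not depend on the
  number of summands, which permits the passage to infinite forms.\<close>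
lemma char_quadratic_form_partial:
  assumes a: "\<And>j. j \<ge> 1 \<Longrightarrow> \<bar>a j\<bar> \<le> h"
  shows "cmod (char (distr M borel (\<lambda>\<omega>. \<Sum>j=1..m. a j * centred_square j \<omega>)) t
      - exp (- t\<^sup>2 * (\<Sum>j=1..m. (a j)\<^sup>2)))
    \<le> (cube_moment * \<bar>t\<bar> * h + t\<^sup>2 * h\<^sup>2) * (t\<^sup>2 * (\<Sum>j=1..m. (a j)\<^sup>2))"
proof -
  let ?\<psi> = "\<lambda>j. char (distr M borel (centred_square j))"
  have h0: "0 \<le> h" using a[of 1] by simp
  have ind: "indep_vars (\<lambda>_. borel) (\<lambda>j \<omega>. a j * centred_square j \<omega>) {1..m}"
    unfolding centred_square_def
    by (rule indep_vars_compose2[OF indep_vars_subset[OF indep]]) auto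
  have scal: "char (distr M borel (\<lambda>\<omega>. a j * centred_square j \<omega>)) t = ?\<psi> j (t * a j)" if "j \<in> {1..m}" for j
    using that unfolding char_def by (simp add: integral_distr mult_ac)
  have bd: "cmod (?\<psi> j u) \<le> 1" if "j \<in> {1..m}" for j u
    using that by (intro real_distribution.cmod_char_le_1 real_distribution_distr) auto
  have factor: "cmod (?\<psi> j (t * a j) - exp (- (t * a j)\<^sup>2))
      \<le> (cube_moment * \<bar>t\<bar> * h + t\<^sup>2 * h\<^sup>2) * (t\<^sup>2 * (a j)\<^sup>2)" if j: "j \<in> {1..m}" for j
  proof -
    have aj: "\<bar>a j\<bar> \<le> h" using a j by simp
    have "cmod (?\<psi> j (t * a j) - exp (- (t * a j)\<^sup>2)) \<le> cube_moment * \<bar>t * a j\<bar> ^ 3 + (t * a j) ^ 4"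
      using char_centred_square[of j "t * a j"] j by simp
    also have "\<dots> = cube_moment * \<bar>t\<bar> * \<bar>a j\<bar> * (t\<^sup>2 * (a j)\<^sup>2) + t\<^sup>2 * \<bar>a j\<bar>\<^sup>2 * (t\<^sup>2 * (a j)\<^sup>2)"
    proof -
      have "\<bar>t * a j\<bar> ^ 3 = \<bar>t\<bar> * \<bar>a j\<bar> * (\<bar>t\<bar>\<^sup>2 * \<bar>a j\<bar>\<^sup>2)"
        unfolding abs_mult by algebra
      moreover have "(t * a j) ^ 4 = t\<^sup>2 * (a j)\<^sup>2 * (t\<^sup>2 * (a j)\<^sup>2)" by algebra
      ultimately show ?thesis by (simp add: mult_ac)
    qed
    also have "\<dots> \<le> cube_moment * \<bar>t\<bar> * h * (t\<^sup>2 * (a j)\<^sup>2) + t\<^sup>2 * h\<^sup>2 * (t\<^sup>2 * (a j)\<^sup>2)"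
      using aj cube_moment_nonneg h0
      by (intro add_mono mult_right_mono mult_left_mono power_mono) auto
    finally show ?thesis by (simp add: algebra_simps)
  qed
  have "char (distr M borel (\<lambda>\<omega>. \<Sum>j=1..m. a j * centred_square j \<omega>)) t = (\<Prod>j=1..m. ?\<psi> j (t * a j))"
    by (subst char_distr_sum[OF ind]) (simp add: scal)
  moreover have "complex_of_real (exp (- t\<^sup>2 * (\<Sum>j=1..m. (a j)\<^sup>2))) = (\<Prod>j=1..m. complex_of_real (exp (- (t * a j)\<^sup>2)))"
    by (simp only: of_real_prod[symmetric] exp_sum[symmetric] finite_atLeastAtMost sum_distrib_left)
      (simp add: power_mult_distrib)
  ultimately have "cmod (char (distr M borel (\<lambda>\<omega>. \<Sum>j=1..m. a j * centred_square j \<omega>)) t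
      - exp (- t\<^sup>2 * (\<Sum>j=1..m. (a j)\<^sup>2)))
    \<le> (\<Sum>j=1..m. cmod (?\<psi> j (t * a j) - complex_of_real (exp (- (t * a j)\<^sup>2))))"
    using bd by (simp only:) (intro norm_prod_diff, auto)
  also have "\<dots> \<le> (\<Sum>j=1..m. (cube_moment * \<bar>t\<bar> * h + t\<^sup>2 * h\<^sup>2) * (t\<^sup>2 * (a j)\<^sup>2))"
    by (intro sum_mono factor)
  also have "\<dots> = (cube_moment * \<bar>t\<bar> * h + t\<^sup>2 * h\<^sup>2) * (t\<^sup>2 * (\<Sum>j=1..m. (a j)\<^sup>2))"
    by (simp add: sum_distrib_left)
  finally show ?thesis .
qed

lemma char_quadratic_form:
  assumes a: "\<And>j. j \<ge> 1 \<Longrightarrow> \<bar>a j\<bar> \<le> h"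
    and var: "((\<lambda>j. (a j)\<^sup>2) has_sum 1 / 2) {1..}"
    and [measurable]: "X \<in> borel_measurable M"
    and lim: "AE \<omega> in M. (\<lambda>m. \<Sum>j=1..m. a j * centred_square j \<omega>) \<longlonglongrightarrow> X \<omega>"
  shows "cmod (char (distr M borel X) t - exp (- t\<^sup>2 / 2)) \<le> (cube_moment * \<bar>t\<bar> * h + t\<^sup>2 * h\<^sup>2) * (t\<^sup>2 / 2)"
proof -
  let ?S = "\<lambda>m \<omega>. \<Sum>j=1..m. a j * centred_square j \<omega>"
  have [measurable]: "?S m \<in> borel_measurable M" for m by (intro borel_measurable_sum) auto
  have v: "(\<lambda>m. \<Sum>j=1..m. (a j)\<^sup>2) \<longlonglongrightarrow> 1 / 2" by (rule has_sum_from_1_LIMSEQ[OF var])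
  have "(\<lambda>m. char (distr M borel (?S m)) t) \<longlonglongrightarrow> char (distr M borel X) t"
  proof -
    have "(\<lambda>m. CLINT \<omega>|M. iexp (t * ?S m \<omega>)) \<longlonglongrightarrow> (CLINT \<omega>|M. iexp (t * X \<omega>))"
    proof (rule integral_dominated_convergence[where w = "\<lambda>_. 1"])
      show "AE \<omega> in M. (\<lambda>m. iexp (t * ?S m \<omega>)) \<longlonglongrightarrow> iexp (t * X \<omega>)"
        using lim by eventually_elim (intro tendsto_intros)
    qed auto
    then show ?thesis unfolding char_def by (simp add: integral_distr)
  qed
  moreover have "(\<lambda>m. complex_of_real (exp (- t\<^sup>2 * (\<Sum>j=1..m. (a j)\<^sup>2)))) \<longlonglongrightarrow> complex_of_real (exp (- t\<^sup>2 * (1 / 2)))"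
    by (intro tendsto_intros v)
  ultimately have 1: "(\<lambda>m. cmod (char (distr M borel (?S m)) t - exp (- t\<^sup>2 * (\<Sum>j=1..m. (a j)\<^sup>2))))
      \<longlonglongrightarrow> cmod (char (distr M borel X) t - exp (- t\<^sup>2 * (1 / 2)))"
    by (intro tendsto_norm tendsto_diff)
  have 2: "(\<lambda>m. (cube_moment * \<bar>t\<bar> * h + t\<^sup>2 * h\<^sup>2) * (t\<^sup>2 * (\<Sum>j=1..m. (a j)\<^sup>2)))
      \<longlonglongrightarrow> (cube_moment * \<bar>t\<bar> * h + t\<^sup>2 * h\<^sup>2) * (t\<^sup>2 * (1 / 2))"
    by (intro tendsto_intros v)
  have "cmod (char (distr M borel X) t - exp (- t\<^sup>2 * (1 / 2))) \<le> (cube_moment * \<bar>t\<bar> * h + t\<^sup>2 * h\<^sup>2) * (t\<^sup>2 * (1 / 2))"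
    by (rule LIMSEQ_le[OF 1 2]) (use char_quadratic_form_partial[OF a] in auto)
  then show ?thesis by simp
qed

text \<open>The variance of the form is \<open>2 \<Sum>a\<^sub>n\<^sub>j\<^sup>2\<close>, which is why the squares of the weights are normalised
  to sum up to \<open>1/2\<close>.\<close>
theorem clt_quadratic_forms:
  fixes a :: "nat \<Rightarrow> nat \<Rightarrow> real"
  assumes a: "\<And>n j. j \<ge> 1 \<Longrightarrow> \<bar>a n j\<bar> \<le> h n"
    and var: "\<And>n. ((\<lambda>j. (a n j)\<^sup>2) has_sum 1 / 2) {1..}"
    and h: "h \<longlonglongrightarrow> 0"
    and [measurable]: "\<And>n. X n \<in> borel_measurable M"
    and lim: "\<And>n. AE \<omega> in M. (\<lambda>m. \<Sum>j=1..m. a n j * centred_square j \<omega>) \<longlonglongrightarrow> X n \<omega>"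
  shows "weak_conv_m (\<lambda>n. distr M borel (X n)) std_normal_distribution"
proof (rule levy_continuity)
  fix t
  have "(\<lambda>n. (cube_moment * \<bar>t\<bar> * h n + t\<^sup>2 * (h n)\<^sup>2) * (t\<^sup>2 / 2)) \<longlonglongrightarrow>
      (cube_moment * \<bar>t\<bar> * 0 + t\<^sup>2 * 0\<^sup>2) * (t\<^sup>2 / 2)"
    by (intro tendsto_intros h)
  then have z: "(\<lambda>n. (cube_moment * \<bar>t\<bar> * h n + t\<^sup>2 * (h n)\<^sup>2) * (t\<^sup>2 / 2)) \<longlonglongrightarrow> 0" by simp
  have "(\<lambda>n. char (distr M borel (X n)) t - exp (- t\<^sup>2 / 2)) \<longlonglongrightarrow> 0"
    by (rule Lim_null_comparison[OF always_eventually z])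
      (use char_quadratic_form[OF a var _ lim] in auto)
  then show "(\<lambda>n. char (distr M borel (X n)) t) \<longlonglongrightarrow> char std_normal_distribution t"
    unfolding char_std_normal_distribution by (rule LIM_zero_cancel)
qed (auto simp: real_dist_normal_dist)

end

section \<open>Power of a test under an asymptotically normal null distribution\<close>

abbreviation \<Phi> :: "real \<Rightarrow> real" where
  "\<Phi> \<equiv> cdf std_normal_distribution"

lemma isCont_std_normal_cdf: "isCont \<Phi> x"
proof -
  interpret real_distribution std_normal_distribution by (rule real_dist_normal_dist)
  have "emeasure std_normal_distribution {x} = 0"
    by (subst emeasure_density) (auto intro!: nn_integral_null_set)
  then show ?thesis by (simp add: isCont_cdf measure_def)
qed

lemma std_normal_cdf_strict_mono:
  assumes "x < y" shows "\<Phi> x < \<Phi> y"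
proof -
  interpret real_distribution std_normal_distribution by (rule real_dist_normal_dist)
  have "emeasure std_normal_distribution {x<..y} \<noteq> 0"
  proof
    assume "emeasure std_normal_distribution {x<..y} = 0"
    then have "AE z in lborel. z \<in> {x<..y} \<longrightarrow> ennreal (std_normal_density z) = 0"
      by (subst (asm) emeasure_density) (auto simp: nn_integral_0_iff_AE indicator_def)
    then have "AE z in lborel. z \<notin> {x<..y}"
      by eventually_elim (metis ennreal_eq_0_iff normal_density_pos not_le zero_less_one)
    then have "emeasure lborel {x<..y} = 0"
      by (subst (asm) AE_iff_measurable[where N = "{x<..y}"]) auto
    then show False using assms by simp
  qed
  then have "measure std_normal_distribution {x<..y} > 0"
    by (simp add: emeasure_eq_measure zero_less_measure_iff)
  then show ?thesis using cdf_diff_eq[OF assms] by simp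
qed

lemma std_normal_quantile:
  assumes "0 < p" "p < 1"
  obtains x where "\<Phi> x = p"
proof -
  interpret real_distribution std_normal_distribution by (rule real_dist_normal_dist)
  obtain a where a: "\<Phi> a < p"
    using order_tendstoD(2)[OF cdf_lim_at_bot assms(1)] eventually_happens[of _ at_bot] by fastforce
  obtain b where b: "p < \<Phi> b"
    using order_tendstoD(1)[OF cdf_lim_at_top_prob assms(2)] eventually_happens[of _ at_top] by fastforce
  have "a \<le> b" using a b std_normal_cdf_strict_mono[of b a] by force
  then obtain x where "\<Phi> x = p"
    using IVT[of \<Phi> a p b] a b isCont_std_normal_cdf by auto
  then show ?thesis by (rule that)
qed

context prob_space begin

text \<open>In this lemma and the next one \<open>X\<close> is the normalised null statistic, \<open>D\<close> the normalised statistic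
  under the alternative and \<open>d\<close> the deterministic shift; the remainder \<open>D - X - d\<close> obeys
  Chebyshev's inequality for the variance \<open>h d\<close> with \<open>h \<rightarrow> 0\<close>.

  The level forces the thresholds to be asymptotically at most the \<open>(1 - \<alpha>)\<close>-quantile \<open>x\<^sub>0\<close>. The
  shift gains at least \<open>\<delta>\<close>; half of it pays for the remainder, which exceeds \<open>d/2\<close> with probability at most
  \<open>4h/d \<le> 4h/\<delta>\<close>, so that large shifts do no harm, and a further quarter of \<open>\<delta>\<close> pays for the
  error in the thresholds. So the type II error is asymptotically at most \<open>\<Phi> (x\<^sub>0 - \<delta>/4)\<close>.\<close>
lemma limsup_type2_error_less:
  fixes X D :: "nat \<Rightarrow> 'a \<Rightarrow> real"
  assumes [measurable]: "\<And>n. n \<ge> 1 \<Longrightarrow> X n \<in> borel_measurable M" "\<And>n. n \<ge> 1 \<Longrightarrow> D n \<in> borel_measurable M"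
    and X: "\<And>x. (\<lambda>n. prob {\<omega>\<in>space M. X n \<omega> \<le> x}) \<longlonglongrightarrow> \<Phi> x"
    and L: "\<And>n \<epsilon>. n \<ge> 1 \<Longrightarrow> 0 < \<epsilon> \<Longrightarrow>
      prob {\<omega>\<in>space M. \<bar>D n \<omega> - X n \<omega> - d n\<bar> \<ge> \<epsilon>} \<le> h n * d n / \<epsilon>\<^sup>2"
    and h: "h \<longlonglongrightarrow> 0" "\<And>n. n \<ge> 1 \<Longrightarrow> 0 \<le> h n"
    and d: "0 < \<delta>" "\<forall>\<^sub>F n in sequentially. \<delta> \<le> d n"
    and \<alpha>: "0 < \<alpha>" "\<alpha> < 1"
    and lev: "(\<lambda>n. prob {\<omega>\<in>space M. X n \<omega> > x n}) \<longlonglongrightarrow> \<alpha>"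
  shows "limsup (\<lambda>n. ereal (prob {\<omega>\<in>space M. \<not> D n \<omega> > x n})) < ereal (1 - \<alpha>)"
proof -
  obtain x0 where x0: "\<Phi> x0 = 1 - \<alpha>" using std_normal_quantile[of "1 - \<alpha>"] \<alpha> by auto
  have "1 - \<alpha> < \<Phi> (x0 + \<delta> / 4)" using std_normal_cdf_strict_mono[of x0 "x0 + \<delta> / 4"] d(1) x0 by simp
  then obtain q where q: "1 - \<alpha> < q" "q < \<Phi> (x0 + \<delta> / 4)" using dense by blast
  have "(\<lambda>n. 1 - prob {\<omega>\<in>space M. X n \<omega> > x n}) \<longlonglongrightarrow> 1 - \<alpha>" by (intro tendsto_intros lev)
  note e1 = order_tendstoD(2)[OF this q(1)]
  note e2 = order_tendstoD(1)[OF X q(2)]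
  have bound: "\<forall>\<^sub>F n in sequentially. prob {\<omega>\<in>space M. \<not> D n \<omega> > x n}
      \<le> prob {\<omega>\<in>space M. X n \<omega> \<le> x0 - \<delta> / 4} + 4 * h n / \<delta>"
    using e1 e2 d(2) eventually_ge_at_top[of 1]
  proof eventually_elim
    case (elim n)
    note n = elim(4)
    have [measurable]: "X n \<in> borel_measurable M" "D n \<in> borel_measurable M" using n assms by auto
    have dn: "0 < d n" using elim d by simp
    have c: "prob {\<omega>\<in>space M. X n \<omega> \<le> x n} = 1 - prob {\<omega>\<in>space M. X n \<omega> > x n}"
      by (subst prob_compl[symmetric]) (auto intro!: arg_cong[where f = prob])
    have xn: "x n < x0 + \<delta> / 4"
    proof (rule ccontr)
      assume "\<not> ?thesis"
      then have "prob {\<omega>\<in>space M. X n \<omega> \<le> x0 + \<delta> / 4} \<le> prob {\<omega>\<in>space M. X n \<omega> \<le> x n}"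
        by (intro finite_measure_mono) auto
      then show False using elim c by linarith
    qed
    have "prob {\<omega>\<in>space M. \<not> D n \<omega> > x n} \<le> prob ({\<omega>\<in>space M. X n \<omega> \<le> x0 - \<delta> / 4} \<union>
        {\<omega>\<in>space M. \<bar>D n \<omega> - X n \<omega> - d n\<bar> \<ge> d n / 2})"
    proof (rule finite_measure_mono)
      show "{\<omega>\<in>space M. \<not> D n \<omega> > x n} \<subseteq> {\<omega>\<in>space M. X n \<omega> \<le> x0 - \<delta> / 4} \<union>
        {\<omega>\<in>space M. \<bar>D n \<omega> - X n \<omega> - d n\<bar> \<ge> d n / 2}"
        using xn elim(3) by (auto simp: abs_le_iff not_le abs_if split: if_splits)
    qed measurable
    also have "\<dots> \<le> prob {\<omega>\<in>space M. X n \<omega> \<le> x0 - \<delta> / 4} +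
        prob {\<omega>\<in>space M. \<bar>D n \<omega> - X n \<omega> - d n\<bar> \<ge> d n / 2}"
      by (rule measure_Un_le) measurable
    also have "prob {\<omega>\<in>space M. \<bar>D n \<omega> - X n \<omega> - d n\<bar> \<ge> d n / 2} \<le> h n * d n / (d n / 2)\<^sup>2"
      using n dn by (intro L) auto
    also have "\<dots> = 4 * h n / d n" using dn by (simp add: power2_eq_square field_simps)
    also have "\<dots> \<le> 4 * h n / \<delta>" using dn elim(3) d(1) h(2)[OF n] by (intro divide_left_mono) auto
    finally show ?case by simp
  qed
  have lim: "(\<lambda>n. prob {\<omega>\<in>space M. X n \<omega> \<le> x0 - \<delta> / 4} + 4 * h n / \<delta>) \<longlonglongrightarrow> \<Phi> (x0 - \<delta> / 4) + 4 * 0 / \<delta>"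
    using d(1) by (intro tendsto_intros X h) auto
  have "limsup (\<lambda>n. ereal (prob {\<omega>\<in>space M. \<not> D n \<omega> > x n}))
      \<le> limsup (\<lambda>n. ereal (prob {\<omega>\<in>space M. X n \<omega> \<le> x0 - \<delta> / 4} + 4 * h n / \<delta>))"
    by (intro Limsup_mono) (use bound in simp)
  also have "\<dots> = ereal (\<Phi> (x0 - \<delta> / 4) + 4 * 0 / \<delta>)"
    by (intro lim_imp_Limsup) (use lim in auto)
  also have "\<dots> < ereal (1 - \<alpha>)"
    using std_normal_cdf_strict_mono[of "x0 - \<delta> / 4" x0] x0 d(1) by simp
  finally show ?thesis .
qed

text \<open>Along indices with \<open>d < \<epsilon>\<close> the statistic exceeds its null version by less than \<open>2\<epsilon>\<close> with
  probability tending to \<open>1\<close>, and the type II error is asymptotically at least \<open>\<Phi> (x\<^sub>0 - 2\<epsilon>)\<close>. As \<open>\<Phi>\<close> is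
  continuous, small \<open>\<epsilon>\<close> would contradict a limit superior strictly below \<open>\<Phi> x\<^sub>0\<close>.\<close>
lemma shift_bounded_below_if_power:
  fixes X D :: "nat \<Rightarrow> 'a \<Rightarrow> real"
  assumes [measurable]: "\<And>n. n \<ge> 1 \<Longrightarrow> X n \<in> borel_measurable M" "\<And>n. n \<ge> 1 \<Longrightarrow> D n \<in> borel_measurable M"
    and X: "\<And>x. (\<lambda>n. prob {\<omega>\<in>space M. X n \<omega> \<le> x}) \<longlonglongrightarrow> \<Phi> x"
    and L: "\<And>n \<epsilon>. n \<ge> 1 \<Longrightarrow> 0 < \<epsilon> \<Longrightarrow>
      prob {\<omega>\<in>space M. \<bar>D n \<omega> - X n \<omega> - d n\<bar> \<ge> \<epsilon>} \<le> h n * d n / \<epsilon>\<^sup>2"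
    and h: "h \<longlonglongrightarrow> 0" "\<And>n. n \<ge> 1 \<Longrightarrow> 0 \<le> h n"
    and pow: "limsup (\<lambda>n. ereal (prob {\<omega>\<in>space M. \<not> D n \<omega> > x0})) < ereal (\<Phi> x0)"
  shows "\<exists>\<delta>>0. \<forall>\<^sub>F n in sequentially. \<delta> \<le> d n"
proof (rule ccontr)
  assume neg: "\<not> ?thesis"
  obtain z where z: "limsup (\<lambda>n. ereal (prob {\<omega>\<in>space M. \<not> D n \<omega> > x0})) < z" "z < ereal (\<Phi> x0)"
    using dense[OF pow] by blast
  obtain c where c: "limsup (\<lambda>n. ereal (prob {\<omega>\<in>space M. \<not> D n \<omega> > x0})) < ereal c" "c < \<Phi> x0"
  proof (cases z)
    case (real c)
    then show ?thesis using z that by simp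
  next
    case MInf
    then show ?thesis using z(1) by simp
  qed (use z in auto)
  have D: "\<forall>\<^sub>F n in sequentially. prob {\<omega>\<in>space M. \<not> D n \<omega> > x0} < c"
    using Limsup_lessD[OF c(1)] by simp
  have "((\<lambda>e. \<Phi> (x0 - 2 * e)) \<longlongrightarrow> \<Phi> (x0 - 2 * 0)) (at_right 0)"
    by (intro isCont_tendsto_compose[OF isCont_std_normal_cdf] tendsto_intros)
  then have "((\<lambda>e. \<Phi> (x0 - 2 * e)) \<longlongrightarrow> \<Phi> x0) (at_right 0)" by simp
  from order_tendstoD(1)[OF this c(2)] have "\<forall>\<^sub>F e in at_right 0. c < \<Phi> (x0 - 2 * e) \<and> 0 < e"
    by (intro eventually_conj) (auto simp: eventually_at_right_less)
  then obtain \<epsilon> where \<epsilon>: "c < \<Phi> (x0 - 2 * \<epsilon>)" "0 < \<epsilon>"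
    using eventually_happens[of _ "at_right (0::real)"] by fastforce
  have "(\<lambda>n. prob {\<omega>\<in>space M. X n \<omega> \<le> x0 - 2 * \<epsilon>} - h n / \<epsilon>) \<longlonglongrightarrow> \<Phi> (x0 - 2 * \<epsilon>) - 0 / \<epsilon>"
    using \<epsilon> by (intro tendsto_intros X h) auto
  then have lim: "(\<lambda>n. prob {\<omega>\<in>space M. X n \<omega> \<le> x0 - 2 * \<epsilon>} - h n / \<epsilon>) \<longlonglongrightarrow> \<Phi> (x0 - 2 * \<epsilon>)"
    by simp
  have "\<forall>\<^sub>F n in sequentially. \<epsilon> \<le> d n"
    using D order_tendstoD(1)[OF lim \<epsilon>(1)] eventually_ge_at_top[of 1]
  proof eventually_elim
    case (elim n)
    note n = elim(3)
    have [measurable]: "X n \<in> borel_measurable M" "D n \<in> borel_measurable M" using n assms by auto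
    show ?case
    proof (rule ccontr)
      assume dn: "\<not> \<epsilon> \<le> d n"
      have "prob {\<omega>\<in>space M. X n \<omega> \<le> x0 - 2 * \<epsilon>} \<le> prob ({\<omega>\<in>space M. \<not> D n \<omega> > x0} \<union>
          {\<omega>\<in>space M. \<bar>D n \<omega> - X n \<omega> - d n\<bar> \<ge> \<epsilon>})"
      proof (rule finite_measure_mono)
        show "{\<omega>\<in>space M. X n \<omega> \<le> x0 - 2 * \<epsilon>} \<subseteq> {\<omega>\<in>space M. \<not> D n \<omega> > x0} \<union>
          {\<omega>\<in>space M. \<bar>D n \<omega> - X n \<omega> - d n\<bar> \<ge> \<epsilon>}"
          using dn by (auto simp: not_le abs_if split: if_splits)
      qed measurable
      also have "\<dots> \<le> prob {\<omega>\<in>space M. \<not> D n \<omega> > x0} + prob {\<omega>\<in>space M. \<bar>D n \<omega> - X n \<omega> - d n\<bar> \<ge> \<epsilon>}"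
        by (rule measure_Un_le) measurable
      also have "prob {\<omega>\<in>space M. \<bar>D n \<omega> - X n \<omega> - d n\<bar> \<ge> \<epsilon>} \<le> h n * d n / \<epsilon>\<^sup>2"
        by (rule L[OF n \<epsilon>(2)])
      also have "\<dots> \<le> h n * \<epsilon> / \<epsilon>\<^sup>2"
        using dn h(2)[OF n] by (intro divide_right_mono mult_left_mono) auto
      also have "\<dots> = h n / \<epsilon>" using \<epsilon>(2) by (simp add: power2_eq_square)
      finally show False using elim by linarith
    qed
  qed
  then show False using neg \<epsilon>(2) by blast
qed

end

context gaussian_sequence begin

definition energy_stat :: "(nat \<Rightarrow> real) \<Rightarrow> (nat \<Rightarrow> real) \<Rightarrow> real \<Rightarrow> 'w \<Rightarrow> real" where
  "energy_stat a \<theta> e \<omega> = (\<Sum>\<^sub>\<infinity>j\<in>{1..}. a j * (\<theta> j + e * \<xi> j \<omega>)\<^sup>2) - e\<^sup>2 * (\<Sum>\<^sub>\<infinity>j\<in>{1..}. a j)"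

definition null_sd :: "(nat \<Rightarrow> real) \<Rightarrow> real \<Rightarrow> real" where
  "null_sd a e = e\<^sup>2 * sqrt (2 * (\<Sum>\<^sub>\<infinity>j\<in>{1..}. (a j)\<^sup>2))"

lemma measurable_energy_stat:
  assumes "\<And>j. j \<ge> 1 \<Longrightarrow> 0 \<le> a j"
  shows "energy_stat a \<theta> e \<in> borel_measurable M"
proof -
  have eq: "energy_stat a \<theta> e = (\<lambda>\<omega>. enn2real (\<Sum>i. ennreal (a (Suc i) * (\<theta> (Suc i) + e * \<xi> (Suc i) \<omega>)\<^sup>2))
      - e\<^sup>2 * (\<Sum>\<^sub>\<infinity>j\<in>{1..}. a j))"
    unfolding energy_stat_def[abs_def]
    by (subst infsum_from_1_eq_enn2real(1)) (auto simp: assms)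
  have "\<xi> (Suc i) \<in> borel_measurable M" for i by measurable
  then show ?thesis unfolding eq by measurable
qed

lemma square_summable_if_bounded:
  fixes a :: "nat \<Rightarrow> real"
  assumes "\<And>j. j \<ge> 1 \<Longrightarrow> 0 \<le> a j" "\<And>j. j \<ge> 1 \<Longrightarrow> a j \<le> B" "(\<lambda>j. a j * b j) summable_on {1..}" "\<And>j. j \<ge> 1 \<Longrightarrow> 0 \<le> b j"
  shows "(\<lambda>j. (a j)\<^sup>2 * b j) summable_on {1..}"
    and "(\<Sum>\<^sub>\<infinity>j\<in>{1..}. (a j)\<^sup>2 * b j) \<le> B * (\<Sum>\<^sub>\<infinity>j\<in>{1..}. a j * b j)"
proof -
  have le: "(a j)\<^sup>2 * b j \<le> B * (a j * b j)" if "j \<in> {1..}" for j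
    using assms(1,2,4)[of j] that mult_right_mono[of "a j" B "a j * b j"] by (simp add: power2_eq_square mult_ac)
  show s: "(\<lambda>j. (a j)\<^sup>2 * b j) summable_on {1..}"
    by (rule summable_on_comparison_test[OF summable_on_cmult_right[OF assms(3), of B]])
      (use le assms(4) in auto)
  show "(\<Sum>\<^sub>\<infinity>j\<in>{1..}. (a j)\<^sup>2 * b j) \<le> B * (\<Sum>\<^sub>\<infinity>j\<in>{1..}. a j * b j)"
    unfolding infsum_cmult_right'[symmetric]
    by (rule infsum_mono[OF s summable_on_cmult_right[OF assms(3)] le])
qed

lemma energy_stat_null_series:
  assumes "\<And>j. j \<ge> 1 \<Longrightarrow> 0 \<le> a j" and a: "a summable_on {1..}"
  shows "AE \<omega> in M. (\<lambda>m. \<Sum>j=1..m. (e\<^sup>2 * a j / v) * centred_square j \<omega>) \<longlonglongrightarrow> energy_stat a (\<lambda>_. 0) e \<omega> / v"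
proof -
  have "AE \<omega> in M. (\<lambda>j. a j * (0 + e * \<xi> j \<omega>)\<^sup>2) summable_on {1..}"
    by (rule AE_summable_weighted_squares[where \<theta> = "\<lambda>_. 0"]) (use assms in auto)
  then show ?thesis
  proof eventually_elim
    case (elim \<omega>)
    have "((\<lambda>j. a j * (0 + e * \<xi> j \<omega>)\<^sup>2) has_sum (\<Sum>\<^sub>\<infinity>j\<in>{1..}. a j * (0 + e * \<xi> j \<omega>)\<^sup>2)) {1..}" using elim by simp
    from has_sum_from_1_LIMSEQ[OF this] have 1: "(\<lambda>m. \<Sum>j=1..m. a j * (0 + e * \<xi> j \<omega>)\<^sup>2) \<longlonglongrightarrow> (\<Sum>\<^sub>\<infinity>j\<in>{1..}. a j * (0 + e * \<xi> j \<omega>)\<^sup>2)" .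
    have "(a has_sum infsum a {1..}) {1..}" using a by simp
    from has_sum_from_1_LIMSEQ[OF this] have 2: "(\<lambda>m. \<Sum>j=1..m. a j) \<longlonglongrightarrow> (\<Sum>\<^sub>\<infinity>j\<in>{1..}. a j)" .
    have "(\<Sum>j=1..m. (e\<^sup>2 * a j / v) * centred_square j \<omega>) =
        ((\<Sum>j=1..m. a j * (0 + e * \<xi> j \<omega>)\<^sup>2) - e\<^sup>2 * (\<Sum>j=1..m. a j)) * (1 / v)" for m
      by (simp add: sum_distrib_left sum_distrib_right sum_subtractf[symmetric] centred_square_def
          power_mult_distrib algebra_simps diff_divide_distrib del: sum_subtractf)
    moreover have "(\<lambda>m. ((\<Sum>j=1..m. a j * (0 + e * \<xi> j \<omega>)\<^sup>2) - e\<^sup>2 * (\<Sum>j=1..m. a j)) * (1 / v)) \<longlonglongrightarrow>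
       ((\<Sum>\<^sub>\<infinity>j\<in>{1..}. a j * (0 + e * \<xi> j \<omega>)\<^sup>2) - e\<^sup>2 * (\<Sum>\<^sub>\<infinity>j\<in>{1..}. a j)) * (1 / v)"
      by (intro tendsto_intros 1 2)
    ultimately show ?case by (simp add: energy_stat_def)
  qed
qed

lemma energy_stat_cross_term_series:
  assumes "\<And>j. j \<ge> 1 \<Longrightarrow> 0 \<le> a j" and a: "a summable_on {1..}"
    and at: "(\<lambda>j. a j * (\<theta> j)\<^sup>2) summable_on {1..}"
  shows "AE \<omega> in M. (\<lambda>m. \<Sum>j=1..m. (2 * e * a j * \<theta> j / v) * \<xi> j \<omega>) \<longlonglongrightarrow>
     energy_stat a \<theta> e \<omega> / v - energy_stat a (\<lambda>_. 0) e \<omega> / v - (\<Sum>\<^sub>\<infinity>j\<in>{1..}. a j * (\<theta> j)\<^sup>2) / v"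
proof -
  have "AE \<omega> in M. (\<lambda>j. a j * (0 + e * \<xi> j \<omega>)\<^sup>2) summable_on {1..}"
    by (rule AE_summable_weighted_squares[where \<theta> = "\<lambda>_. 0"]) (use assms in auto)
  moreover have "AE \<omega> in M. (\<lambda>j. a j * (\<theta> j + e * \<xi> j \<omega>)\<^sup>2) summable_on {1..}"
    by (rule AE_summable_weighted_squares) (use assms in auto)
  ultimately show ?thesis
  proof eventually_elim
    case (elim \<omega>)
    let ?P = "\<lambda>\<theta> j. a j * (\<theta> j + e * \<xi> j \<omega>)\<^sup>2"
    have 1: "(\<lambda>m. \<Sum>j=1..m. ?P (\<lambda>_. 0) j) \<longlonglongrightarrow> infsum (?P (\<lambda>_. 0)) {1..}"
      using elim(1) by (intro has_sum_from_1_LIMSEQ) simp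
    have 2: "(\<lambda>m. \<Sum>j=1..m. ?P \<theta> j) \<longlonglongrightarrow> infsum (?P \<theta>) {1..}"
      using elim(2) by (intro has_sum_from_1_LIMSEQ) simp
    have 3: "(\<lambda>m. \<Sum>j=1..m. a j * (\<theta> j)\<^sup>2) \<longlonglongrightarrow> (\<Sum>\<^sub>\<infinity>j\<in>{1..}. a j * (\<theta> j)\<^sup>2)"
      using at by (intro has_sum_from_1_LIMSEQ) simp
    have "(\<Sum>j=1..m. (2 * e * a j * \<theta> j / v) * \<xi> j \<omega>) =
        ((\<Sum>j=1..m. ?P \<theta> j) - (\<Sum>j=1..m. ?P (\<lambda>_. 0) j) - (\<Sum>j=1..m. a j * (\<theta> j)\<^sup>2)) * (1 / v)" for m
      unfolding sum_subtractf[symmetric] sum_distrib_right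
      by (intro sum.cong refl) (simp add: power2_eq_square algebra_simps add_divide_distrib)
    moreover have "(\<lambda>m. ((\<Sum>j=1..m. ?P \<theta> j) - (\<Sum>j=1..m. ?P (\<lambda>_. 0) j) - (\<Sum>j=1..m. a j * (\<theta> j)\<^sup>2)) * (1 / v))
      \<longlonglongrightarrow> (infsum (?P \<theta>) {1..} - infsum (?P (\<lambda>_. 0)) {1..} - (\<Sum>\<^sub>\<infinity>j\<in>{1..}. a j * (\<theta> j)\<^sup>2)) * (1 / v)"
      by (intro tendsto_intros 1 2 3)
    ultimately show ?case by (simp add: energy_stat_def diff_divide_distrib)
  qed
qed

text \<open>The cross term has variance \<open>4 e\<^sup>2 \<Sum>a\<^sub>j\<^sup>2 \<theta>\<^sub>j\<^sup>2\<close>. Taking out one factor \<open>a\<^sub>j \<le> B\<close> leaves the shift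
  itself, so the bound is the shift times a factor that does not depend on the signal.\<close>
lemma energy_stat_cross_term_tail:
  assumes nn: "\<And>j. j \<ge> 1 \<Longrightarrow> 0 \<le> a j" and a: "a summable_on {1..}"
    and at: "(\<lambda>j. a j * (\<theta> j)\<^sup>2) summable_on {1..}"
    and B: "\<And>j. j \<ge> 1 \<Longrightarrow> a j \<le> B" and "0 < v" "0 < \<epsilon>"
  shows "prob {\<omega>\<in>space M. \<bar>energy_stat a \<theta> e \<omega> / v - energy_stat a (\<lambda>_. 0) e \<omega> / v - (\<Sum>\<^sub>\<infinity>j\<in>{1..}. a j * (\<theta> j)\<^sup>2) / v\<bar> \<ge> \<epsilon>}
      \<le> (4 * e\<^sup>2 * B / v) * ((\<Sum>\<^sub>\<infinity>j\<in>{1..}. a j * (\<theta> j)\<^sup>2) / v) / \<epsilon>\<^sup>2"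
proof (rule linear_form_tail_bound[where b = "\<lambda>j. 2 * e * a j * \<theta> j / v"])
  have [measurable]: "energy_stat a \<theta> e \<in> borel_measurable M" for \<theta>
    by (intro measurable_energy_stat nn)
  show "(\<lambda>\<omega>. energy_stat a \<theta> e \<omega> / v - energy_stat a (\<lambda>_. 0) e \<omega> / v - (\<Sum>\<^sub>\<infinity>j\<in>{1..}. a j * (\<theta> j)\<^sup>2) / v) \<in> borel_measurable M"
    by measurable
  show "AE \<omega> in M. (\<lambda>m. \<Sum>j=1..m. (2 * e * a j * \<theta> j / v) * \<xi> j \<omega>) \<longlonglongrightarrow>
     energy_stat a \<theta> e \<omega> / v - energy_stat a (\<lambda>_. 0) e \<omega> / v - (\<Sum>\<^sub>\<infinity>j\<in>{1..}. a j * (\<theta> j)\<^sup>2) / v"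
    using energy_stat_cross_term_series[OF nn a at] .
  show "(\<Sum>j=1..m. (2 * e * a j * \<theta> j / v)\<^sup>2) \<le> (4 * e\<^sup>2 * B / v) * ((\<Sum>\<^sub>\<infinity>j\<in>{1..}. a j * (\<theta> j)\<^sup>2) / v)" for m
  proof -
    have "(\<Sum>j=1..m. (2 * e * a j * \<theta> j / v)\<^sup>2) = 4 * e\<^sup>2 / v\<^sup>2 * (\<Sum>j=1..m. (a j)\<^sup>2 * (\<theta> j)\<^sup>2)" (is "_ = ?K * _")
      by (simp add: sum_distrib_left power_mult_distrib power_divide field_simps)
    also have "\<dots> \<le> ?K * (B * (\<Sum>\<^sub>\<infinity>j\<in>{1..}. a j * (\<theta> j)\<^sup>2))"
    proof (rule mult_left_mono)
      have "(\<Sum>j=1..m. (a j)\<^sup>2 * (\<theta> j)\<^sup>2) \<le> (\<Sum>\<^sub>\<infinity>j\<in>{1..}. (a j)\<^sup>2 * (\<theta> j)\<^sup>2)"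
        by (intro finite_sum_le_infsum square_summable_if_bounded(1)[OF nn B at]) auto
      also have "\<dots> \<le> B * (\<Sum>\<^sub>\<infinity>j\<in>{1..}. a j * (\<theta> j)\<^sup>2)"
        by (intro square_summable_if_bounded(2)[OF nn B at]) auto
      finally show "(\<Sum>j=1..m. (a j)\<^sup>2 * (\<theta> j)\<^sup>2) \<le> B * (\<Sum>\<^sub>\<infinity>j\<in>{1..}. a j * (\<theta> j)\<^sup>2)" .
    qed simp
    finally show ?thesis by (simp add: power2_eq_square mult_ac)
  qed
qed (use assms in auto)

text \<open>The hypotheses concern \<open>n \<ge> 1\<close> only, whereas \<open>clt_quadratic_forms\<close> speaks of all indices; the
  proof replaces the index \<open>n\<close> by \<open>max 1 n\<close>.\<close>
lemma energy_stat_null_clt: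
  fixes a :: "nat \<Rightarrow> nat \<Rightarrow> real"
  assumes nn: "\<And>n j. n \<ge> 1 \<Longrightarrow> j \<ge> 1 \<Longrightarrow> 0 \<le> a n j" and a: "\<And>n. n \<ge> 1 \<Longrightarrow> a n summable_on {1..}"
    and B: "\<And>n j. n \<ge> 1 \<Longrightarrow> j \<ge> 1 \<Longrightarrow> a n j \<le> B n"
    and e: "\<And>n. n \<ge> 1 \<Longrightarrow> 0 < e n"
    and pos: "\<And>n. n \<ge> 1 \<Longrightarrow> 0 < (\<Sum>\<^sub>\<infinity>j\<in>{1..}. (a n j)\<^sup>2)"
    and h: "(\<lambda>n. (e n)\<^sup>2 * B n / null_sd (a n) (e n)) \<longlonglongrightarrow> 0"
  shows "(\<lambda>n. prob {\<omega>\<in>space M. energy_stat (a n) (\<lambda>_. 0) (e n) \<omega> / null_sd (a n) (e n) \<le> x}) \<longlonglongrightarrow> \<Phi> x"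
proof -
  let ?c = "\<lambda>n. max 1 n"
  let ?v = "\<lambda>n. null_sd (a n) (e n)"
  let ?X = "\<lambda>n \<omega>. energy_stat (a (?c n)) (\<lambda>_. 0) (e (?c n)) \<omega> / ?v (?c n)"
  have vpos: "0 < ?v n" if "n \<ge> 1" for n
    using e[OF that] pos[OF that] by (simp add: null_sd_def)
  have m: "?X n \<in> borel_measurable M" for n
    by (intro borel_measurable_divide measurable_energy_stat nn) auto
  have "weak_conv_m (\<lambda>n. distr M borel (?X n)) std_normal_distribution"
  proof (rule clt_quadratic_forms[where a = "\<lambda>n j. (e (?c n))\<^sup>2 * a (?c n) j / ?v (?c n)"])
    show "\<bar>(e (?c n))\<^sup>2 * a (?c n) j / ?v (?c n)\<bar> \<le> (e (?c n))\<^sup>2 * B (?c n) / ?v (?c n)" if "j \<ge> 1" for n j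
      using that nn[of "?c n" j] B[of "?c n" j] vpos[of "?c n"]
      by (auto intro!: divide_right_mono mult_left_mono)
    show "((\<lambda>j. ((e (?c n))\<^sup>2 * a (?c n) j / ?v (?c n))\<^sup>2) has_sum 1 / 2) {1..}" for n
    proof -
      let ?n = "?c n"
      let ?S = "\<Sum>\<^sub>\<infinity>j\<in>{1..}. (a ?n j)\<^sup>2"
      have n: "?n \<ge> 1" by simp
      have "(\<lambda>j. (a ?n j)\<^sup>2) summable_on {1..}"
        using square_summable_if_bounded(1)[of "a ?n" "B ?n" "\<lambda>_. 1"] nn B a n by simp
      then have "((\<lambda>j. (a ?n j)\<^sup>2) has_sum ?S) {1..}" by simp
      then have "((\<lambda>j. ((e ?n)\<^sup>2 / ?v ?n)\<^sup>2 * (a ?n j)\<^sup>2) has_sum ((e ?n)\<^sup>2 / ?v ?n)\<^sup>2 * ?S) {1..}"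
        by (rule has_sum_cmult_right)
      moreover have "((e ?n)\<^sup>2 / ?v ?n)\<^sup>2 * ?S = 1 / 2"
        using e[OF n] pos[OF n] by (simp add: null_sd_def power_divide power_mult_distrib)
      moreover have "((e ?n)\<^sup>2 / ?v ?n)\<^sup>2 * (a ?n j)\<^sup>2 = ((e ?n)\<^sup>2 * a ?n j / ?v ?n)\<^sup>2" for j
        by (simp add: power_divide power_mult_distrib)
      ultimately show ?thesis by (simp only:)
    qed
    show "(\<lambda>n. (e (?c n))\<^sup>2 * B (?c n) / ?v (?c n)) \<longlonglongrightarrow> 0"
      by (rule Lim_transform_eventually[OF h eventually_sequentiallyI[of 1]]) (simp add: max_def)
    show "AE \<omega> in M. (\<lambda>m. \<Sum>j=1..m. ((e (?c n))\<^sup>2 * a (?c n) j / ?v (?c n)) * centred_square j \<omega>) \<longlonglongrightarrow> ?X n \<omega>" for n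
      by (intro energy_stat_null_series nn a) auto
  qed (rule m)
  then have "(\<lambda>n. cdf (distr M borel (?X n)) x) \<longlonglongrightarrow> \<Phi> x"
    using isCont_std_normal_cdf by (auto simp: weak_conv_m_def weak_conv_def)
  moreover have "\<forall>\<^sub>F n in sequentially. cdf (distr M borel (?X n)) x =
      prob {\<omega>\<in>space M. energy_stat (a n) (\<lambda>_. 0) (e n) \<omega> / ?v n \<le> x}"
  proof (rule eventually_sequentiallyI[of 1])
    fix n :: nat assume n: "1 \<le> n"
    have "cdf (distr M borel (?X n)) x = prob (?X n -` {..x} \<inter> space M)"
      unfolding cdf_def by (rule measure_distr[OF m]) simp
    also have "?X n -` {..x} \<inter> space M = {\<omega>\<in>space M. energy_stat (a n) (\<lambda>_. 0) (e n) \<omega> / ?v n \<le> x}"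
      using n by (auto simp: max_def)
    finally show "cdf (distr M borel (?X n)) x = prob {\<omega>\<in>space M. energy_stat (a n) (\<lambda>_. 0) (e n) \<omega> / ?v n \<le> x}" .
  qed
  ultimately show ?thesis by (rule Lim_transform_eventually)
qed

end

section \<open>Orthonormal expansions in the space of square-integrable functions\<close>

lemma L2_01_prod_integrable:
  assumes "f \<in> L2_01" "g \<in> L2_01"
  shows "integrable (lebesgue_on {0..1}) (\<lambda>t. f t * g t)"
proof (rule Bochner_Integration.integrable_bound)
  show "integrable (lebesgue_on {0..1}) (\<lambda>t. (f t)\<^sup>2 + (g t)\<^sup>2)"
    using assms by (auto simp: L2_01_def)
  show "(\<lambda>t. f t * g t) \<in> borel_measurable (lebesgue_on {0..1})"
    using assms by (auto simp: L2_01_def)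
  have "\<bar>f t * g t\<bar> \<le> (f t)\<^sup>2 + (g t)\<^sup>2" for t
  proof -
    have "2 * (\<bar>f t\<bar> * \<bar>g t\<bar>) \<le> (f t)\<^sup>2 + (g t)\<^sup>2"
      using sum_squares_bound[of "\<bar>f t\<bar>" "\<bar>g t\<bar>"] by simp
    moreover have "0 \<le> \<bar>f t\<bar> * \<bar>g t\<bar>" by simp
    ultimately show ?thesis unfolding abs_mult by linarith
  qed
  then show "AE t in lebesgue_on {0..1}. norm (f t * g t) \<le> norm ((f t)\<^sup>2 + (g t)\<^sup>2)"
    by (intro AE_I2) (smt (verit) real_norm_def)
qed

lemma L2_01_scale:
  assumes "f \<in> L2_01" shows "(\<lambda>t. c * f t) \<in> L2_01"
  using assms by (auto simp: L2_01_def power_mult_distrib)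

lemma L2_01_add:
  assumes "f \<in> L2_01" "g \<in> L2_01" shows "(\<lambda>t. f t + g t) \<in> L2_01"
proof -
  have "(f t + g t)\<^sup>2 = (f t)\<^sup>2 + (g t)\<^sup>2 + 2 * (f t * g t)" for t by (simp add: power2_sum)
  then show ?thesis
    using assms L2_01_prod_integrable[OF assms] by (auto simp: L2_01_def)
qed

lemma L2_01_diff:
  assumes "f \<in> L2_01" "g \<in> L2_01" shows "(\<lambda>t. f t - g t) \<in> L2_01"
  using L2_01_add[OF assms(1) L2_01_scale[OF assms(2), of "-1"]] by simp

lemma L2_01_zero: "(\<lambda>t. 0) \<in> L2_01" by (auto simp: L2_01_def)

lemma L2_01_sum:
  assumes "\<And>i. i \<in> I \<Longrightarrow> f i \<in> L2_01" shows "(\<lambda>t. \<Sum>i\<in>I. f i t) \<in> L2_01"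
  using assms
  by (induction I rule: infinite_finite_induct) (auto intro: L2_01_add simp: L2_01_zero)

lemma l2_inner_commute: "l2_inner f g = l2_inner g f"
  by (simp add: l2_inner_def mult.commute)

lemma l2_inner_add:
  assumes "f \<in> L2_01" "g \<in> L2_01" "h \<in> L2_01"
  shows "l2_inner (\<lambda>t. f t + g t) h = l2_inner f h + l2_inner g h"
  using L2_01_prod_integrable[OF assms(1,3)] L2_01_prod_integrable[OF assms(2,3)]
  by (simp add: l2_inner_def ring_distribs)

lemma l2_inner_diff:
  assumes "f \<in> L2_01" "g \<in> L2_01" "h \<in> L2_01"
  shows "l2_inner (\<lambda>t. f t - g t) h = l2_inner f h - l2_inner g h"
  using L2_01_prod_integrable[OF assms(1,3)] L2_01_prod_integrable[OF assms(2,3)]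
  by (simp add: l2_inner_def left_diff_distrib)

lemma l2_inner_scale: "l2_inner (\<lambda>t. c * f t) h = c * l2_inner f h"
  by (simp add: l2_inner_def mult.assoc)

lemma l2_inner_sum:
  assumes "\<And>i. i \<in> I \<Longrightarrow> f i \<in> L2_01" "h \<in> L2_01"
  shows "l2_inner (\<lambda>t. \<Sum>i\<in>I. f i t) h = (\<Sum>i\<in>I. l2_inner (f i) h)"
  unfolding l2_inner_def sum_distrib_right
  by (intro Bochner_Integration.integral_sum L2_01_prod_integrable assms)

lemma l2_norm_power2: "(l2_norm f)\<^sup>2 = l2_inner f f"
  unfolding l2_norm_def l2_inner_def by (intro real_sqrt_pow2 integral_nonneg_AE) auto

lemma l2_norm_nonneg: "0 \<le> l2_norm f"
  unfolding l2_norm_def l2_inner_def by (intro real_sqrt_ge_zero integral_nonneg_AE) auto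

definition partial_expansion :: "(nat \<Rightarrow> real \<Rightarrow> real) \<Rightarrow> nat \<Rightarrow> (real \<Rightarrow> real) \<Rightarrow> real \<Rightarrow> real" where
  "partial_expansion \<phi> m f = (\<lambda>t. \<Sum>j=1..m. l2_inner f (\<phi> j) * \<phi> j t)"

locale orthonormal_basis =
  fixes \<phi> :: "nat \<Rightarrow> real \<Rightarrow> real"
  assumes basis: "l2_basis \<phi>"
begin

lemma basis_L2: "Suc 0 \<le> j \<Longrightarrow> \<phi> j \<in> L2_01"
  using basis by (simp add: l2_basis_def l2_orthonormal_def)

lemma basis_inner: "Suc 0 \<le> i \<Longrightarrow> Suc 0 \<le> j \<Longrightarrow> l2_inner (\<phi> i) (\<phi> j) = (if i = j then 1 else 0)"
  using basis by (simp add: l2_basis_def l2_orthonormal_def)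

lemma partial_expansion_L2: "partial_expansion \<phi> m f \<in> L2_01"
  unfolding partial_expansion_def by (intro L2_01_sum L2_01_scale basis_L2) auto

lemma inner_partial_expansion:
  assumes "g \<in> L2_01"
  shows "l2_inner (partial_expansion \<phi> m f) g = (\<Sum>j=1..m. l2_inner f (\<phi> j) * l2_inner g (\<phi> j))"
  unfolding partial_expansion_def
  by (subst l2_inner_sum) (auto intro!: L2_01_scale basis_L2 assms simp: l2_inner_scale l2_inner_commute[of g])

lemma coeff_partial_expansion:
  assumes "j \<ge> 1"
  shows "l2_inner (partial_expansion \<phi> m f) (\<phi> j) = (if j \<le> m then l2_inner f (\<phi> j) else 0)"
proof -
  have "l2_inner (partial_expansion \<phi> m f) (\<phi> j) = (\<Sum>i=1..m. if i = j then l2_inner f (\<phi> i) else 0)"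
    using assms by (subst inner_partial_expansion)
      (auto intro!: sum.cong simp: basis_L2 basis_inner l2_inner_commute[of "\<phi> j"] simp del: sum.delta sum.delta')
  then show ?thesis using assms by simp
qed

lemma norm_partial_expansion:
  "(l2_norm (partial_expansion \<phi> m f))\<^sup>2 = (\<Sum>j=1..m. (l2_inner f (\<phi> j))\<^sup>2)"
  unfolding l2_norm_power2
  by (subst inner_partial_expansion[OF partial_expansion_L2], rule sum.cong)
    (auto simp: coeff_partial_expansion power2_eq_square)

lemma partial_expansion_orthogonal:
  assumes "f \<in> L2_01"
  shows "l2_inner (partial_expansion \<phi> m f) (\<lambda>t. f t - partial_expansion \<phi> m f t) = 0"
proof -
  have "l2_inner (partial_expansion \<phi> m f) (\<lambda>t. f t - partial_expansion \<phi> m f t)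
    = l2_inner f (partial_expansion \<phi> m f) - l2_inner (partial_expansion \<phi> m f) (partial_expansion \<phi> m f)"
    by (subst l2_inner_commute) (intro l2_inner_diff assms partial_expansion_L2)
  also have "l2_inner f (partial_expansion \<phi> m f) = (\<Sum>j=1..m. (l2_inner f (\<phi> j))\<^sup>2)"
    using inner_partial_expansion[OF assms, of m f] by (simp add: l2_inner_commute power2_eq_square)
  finally show ?thesis using norm_partial_expansion[of m f] by (simp add: l2_norm_power2)
qed

end

lemma l2_pythagoras:
  assumes "f \<in> L2_01" "g \<in> L2_01" "l2_inner g (\<lambda>t. f t - g t) = 0"
  shows "l2_inner f f = l2_inner g g + l2_inner (\<lambda>t. f t - g t) (\<lambda>t. f t - g t)"
proof -
  note L = assms(1,2) L2_01_diff[OF assms(1,2)]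
  have "l2_inner (\<lambda>t. f t - g t) (\<lambda>t. f t - g t) = l2_inner f (\<lambda>t. f t - g t) - l2_inner g (\<lambda>t. f t - g t)"
    by (rule l2_inner_diff[OF L])
  also have "l2_inner f (\<lambda>t. f t - g t) = l2_inner f f - l2_inner g f"
    by (subst l2_inner_commute) (rule l2_inner_diff[OF L(1,2,1)])
  finally have 1: "l2_inner (\<lambda>t. f t - g t) (\<lambda>t. f t - g t) = l2_inner f f - l2_inner g f" using assms by simp
  have "0 = l2_inner f g - l2_inner g g"
    using assms(3) l2_inner_diff[OF L(1,2,2)] by (simp add: l2_inner_commute[of g "\<lambda>t. f t - g t"])
  then show ?thesis using 1 by (simp add: l2_inner_commute)
qed

context orthonormal_basis begin

text \<open>Completeness of the basis says that \<open>\<parallel>f - P\<^sub>m f\<parallel>\<^sup>2 \<longlonglongrightarrow> 0\<close> for the partial expansions \<open>P\<^sub>m f\<close>, and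
  this squared norm is \<open>\<parallel>f\<parallel>\<^sup>2\<close> minus the sum of the first \<open>m\<close> squared coefficients.\<close>
theorem parseval:
  assumes "f \<in> L2_01"
  shows "((\<lambda>j. (l2_inner f (\<phi> j))\<^sup>2) has_sum l2_inner f f) {1..}"
proof (rule has_sum_from_1_nonneg)
  let ?P = "\<lambda>m. partial_expansion \<phi> m f"
  have "(\<lambda>m. (l2_norm (\<lambda>t. f t - ?P m t))\<^sup>2) \<longlonglongrightarrow> 0\<^sup>2"
    using basis assms by (intro tendsto_power) (simp add: l2_basis_def partial_expansion_def)
  moreover have "(l2_norm (\<lambda>t. f t - ?P m t))\<^sup>2 = l2_inner f f - (\<Sum>j=1..m. (l2_inner f (\<phi> j))\<^sup>2)" for m
    using l2_pythagoras[OF assms partial_expansion_L2 partial_expansion_orthogonal[OF assms], of m]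
      norm_partial_expansion[of m f] by (simp add: l2_norm_power2)
  ultimately have "(\<lambda>m. l2_inner f f - (l2_inner f f - (\<Sum>j=1..m. (l2_inner f (\<phi> j))\<^sup>2))) \<longlonglongrightarrow> l2_inner f f - 0"
    by (intro tendsto_diff) auto
  then show "(\<lambda>m. \<Sum>j=1..m. (l2_inner f (\<phi> j))\<^sup>2) \<longlonglongrightarrow> l2_inner f f" by simp
qed auto

text \<open>Polarisation of Parseval's identity.\<close>
lemma parseval_inner:
  assumes "f \<in> L2_01" "g \<in> L2_01"
  shows "((\<lambda>j. l2_inner f (\<phi> j) * l2_inner g (\<phi> j)) has_sum l2_inner f g) {1..}"
proof -
  let ?h = "\<lambda>t. f t + g t"
  have h: "?h \<in> L2_01" by (rule L2_01_add[OF assms])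
  have 1: "((\<lambda>j. 1 / 2 * ((l2_inner ?h (\<phi> j))\<^sup>2 + - ((l2_inner f (\<phi> j))\<^sup>2 + (l2_inner g (\<phi> j))\<^sup>2))) has_sum
      1 / 2 * (l2_inner ?h ?h + - (l2_inner f f + l2_inner g g))) {1..}"
    by (intro has_sum_cmult_right has_sum_add has_sum_uminusI parseval assms h)
  have 2: "1 / 2 * (l2_inner ?h ?h + - (l2_inner f f + l2_inner g g)) = l2_inner f g"
    using l2_inner_add[OF assms h] l2_inner_add[OF assms assms(1)] l2_inner_add[OF assms assms(2)]
    by (simp add: l2_inner_commute)
  have 3: "1 / 2 * ((l2_inner ?h (\<phi> j))\<^sup>2 + - ((l2_inner f (\<phi> j))\<^sup>2 + (l2_inner g (\<phi> j))\<^sup>2))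
      = l2_inner f (\<phi> j) * l2_inner g (\<phi> j)" if "j \<in> {1..}" for j
    using l2_inner_add[OF assms basis_L2, of j] that by (simp add: power2_eq_square algebra_simps)
  show ?thesis by (rule has_sum_cong[THEN iffD1, OF 3 1[unfolded 2]])
qed

text \<open>Here \<open>g\<close> is the smooth part of \<open>f\<close> and \<open>u\<close> the common order of the squared norms. Young's
  inequality splits \<open>\<langle>g, f\<rangle>\<close> with two different parameters. On the high frequencies the small tail of
  \<open>g\<close> absorbs the large parameter \<open>p\<close>, which makes \<open>\<parallel>f\<parallel>\<^sup>2 / (2 p)\<close> small; on the low frequencies a
  small parameter \<open>q\<close> makes the contribution of \<open>g\<close> small. The constants are such that these two
  contributions amount to \<open>c\<^sup>2 u / 4\<close> each, which leaves at least half of \<open>\<langle>g, f\<rangle> \<ge> c\<^sup>2 u\<close> to the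
  low frequencies of \<open>f\<close>.\<close>
lemma low_frequency_mass:
  assumes f: "f \<in> L2_01" and g: "g \<in> L2_01" and "0 < c" "0 < C" "0 < C1" "0 \<le> u"
    and inner: "c\<^sup>2 * u \<le> l2_inner g f"
    and nf: "l2_inner f f \<le> C\<^sup>2 * u" and ng: "l2_inner g g \<le> C1\<^sup>2 * u"
    and tail: "(\<Sum>\<^sub>\<infinity>j\<in>{m<..}. (l2_inner g (\<phi> j))\<^sup>2) \<le> c ^ 4 / (16 * C\<^sup>2) * u"
  shows "c ^ 4 / (2 * C1\<^sup>2) * u \<le> (\<Sum>j=1..m. (l2_inner f (\<phi> j))\<^sup>2)"
proof -
  let ?f = "\<lambda>j. l2_inner f (\<phi> j)" and ?g = "\<lambda>j. l2_inner g (\<phi> j)"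
  define p where "p = 4 * C\<^sup>2 / c\<^sup>2"
  define q where "q = c\<^sup>2 / (2 * C1\<^sup>2)"
  have pq: "0 < p" "0 < q" using assms by (auto simp: p_def q_def)
  have young: "x * y \<le> w / 2 * x\<^sup>2 + 1 / (2 * w) * y\<^sup>2" if "0 < w" for x y w :: real
  proof -
    have "0 \<le> (w * x - y)\<^sup>2 / (2 * w)" using that by simp
    also have "\<dots> = w / 2 * x\<^sup>2 + 1 / (2 * w) * y\<^sup>2 - x * y"
      using that by (simp add: power2_eq_square field_simps)
    finally show ?thesis by simp
  qed
  have split: "{1..} = {1..m} \<union> {m<..}" and disj: "{1..m} \<inter> {m<..} = {}" by auto
  have ff: "((\<lambda>j. (?f j)\<^sup>2) has_sum l2_inner f f) {1..}" and gg: "((\<lambda>j. (?g j)\<^sup>2) has_sum l2_inner g g) {1..}"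
    and gf: "((\<lambda>j. ?g j * ?f j) has_sum l2_inner g f) {1..}"
    by (intro parseval parseval_inner f g)+
  have sf: "(\<lambda>j. (?f j)\<^sup>2) summable_on {m<..}"
    by (rule summable_on_subset[OF has_sum_imp_summable[OF ff]]) auto
  have sg: "(\<lambda>j. (?g j)\<^sup>2) summable_on {m<..}"
    by (rule summable_on_subset[OF has_sum_imp_summable[OF gg]]) auto
  have sgf: "(\<lambda>j. ?g j * ?f j) summable_on {m<..}"
    by (rule summable_on_subset[OF has_sum_imp_summable[OF gf]]) auto
  have "(\<Sum>\<^sub>\<infinity>j\<in>{m<..}. (?f j)\<^sup>2) \<le> infsum (\<lambda>j. (?f j)\<^sup>2) {1..}"
    by (rule infsum_mono2[OF sf has_sum_imp_summable[OF ff]]) auto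
  then have tf: "(\<Sum>\<^sub>\<infinity>j\<in>{m<..}. (?f j)\<^sup>2) \<le> C\<^sup>2 * u" using ff nf by (simp add: has_sum_iff)
  have "(\<Sum>j=1..m. (?g j)\<^sup>2) \<le> infsum (\<lambda>j. (?g j)\<^sup>2) {1..}"
    by (rule finite_sum_le_infsum[OF has_sum_imp_summable[OF gg]]) auto
  then have lg: "(\<Sum>j=1..m. (?g j)\<^sup>2) \<le> C1\<^sup>2 * u" using gg ng by (simp add: has_sum_iff)
  have "l2_inner g f = (\<Sum>j=1..m. ?g j * ?f j) + (\<Sum>\<^sub>\<infinity>j\<in>{m<..}. ?g j * ?f j)"
    using infsum_Un_disjoint[OF _ sgf, of "{1..m}"] infsumI[OF gf, unfolded split] disj by auto
  also have "(\<Sum>j=1..m. ?g j * ?f j) \<le> (\<Sum>j=1..m. q / 2 * (?g j)\<^sup>2 + 1 / (2 * q) * (?f j)\<^sup>2)"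
    by (intro sum_mono young pq)
  also have "\<dots> = q / 2 * (\<Sum>j=1..m. (?g j)\<^sup>2) + 1 / (2 * q) * (\<Sum>j=1..m. (?f j)\<^sup>2)"
    by (simp add: sum.distrib sum_distrib_left)
  also have "q / 2 * (\<Sum>j=1..m. (?g j)\<^sup>2) \<le> q / 2 * (C1\<^sup>2 * u)"
    by (rule mult_left_mono[OF lg]) (use pq in simp)
  also have "\<dots> = c\<^sup>2 * u / 4" using assms by (simp add: q_def)
  also have "(\<Sum>\<^sub>\<infinity>j\<in>{m<..}. ?g j * ?f j) \<le> (\<Sum>\<^sub>\<infinity>j\<in>{m<..}. p / 2 * (?g j)\<^sup>2 + 1 / (2 * p) * (?f j)\<^sup>2)"
    by (intro infsum_mono sgf summable_on_add summable_on_cmult_right sf sg young pq)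
  also have "\<dots> = p / 2 * (\<Sum>\<^sub>\<infinity>j\<in>{m<..}. (?g j)\<^sup>2) + 1 / (2 * p) * (\<Sum>\<^sub>\<infinity>j\<in>{m<..}. (?f j)\<^sup>2)"
    by (subst infsum_add) (intro summable_on_cmult_right sf sg, intro summable_on_cmult_right sf sg,
        simp only: infsum_cmult_right')
  also have "\<dots> \<le> p / 2 * (c ^ 4 / (16 * C\<^sup>2) * u) + 1 / (2 * p) * (C\<^sup>2 * u)"
    using pq by (intro add_mono mult_left_mono tail tf) auto
  also have "\<dots> = c\<^sup>2 * u / 4" using assms
    by (simp add: p_def power2_eq_square power4_eq_xxxx field_simps)
  finally have "c\<^sup>2 * u \<le> c\<^sup>2 * u / 4 + 1 / (2 * q) * (\<Sum>j=1..m. (?f j)\<^sup>2) + c\<^sup>2 * u / 4"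
    using inner by simp
  then have "c\<^sup>2 * u / 2 \<le> 1 / (2 * q) * (\<Sum>j=1..m. (?f j)\<^sup>2)" by linarith
  then have "q * (c\<^sup>2 * u / 2) \<le> q * (1 / (2 * q) * (\<Sum>j=1..m. (?f j)\<^sup>2))"
    using pq by (intro mult_left_mono) auto
  then have "q * (c\<^sup>2 * u) \<le> (\<Sum>j=1..m. (?f j)\<^sup>2)" using pq by simp
  then show ?thesis by (simp add: q_def power2_eq_square power4_eq_xxxx mult_ac)
qed

end

section \<open>Growth of the weights and of the frequency cut-off\<close>

text \<open>The supremum in the definition of \<open>k\<^sub>n\<close> ranges over a finite set, because the partial sums
  converge to \<open>\<rho>\<^sub>n > \<rho>\<^sub>n / 2\<close>; so it is attained.\<close>
lemma k_index_properties:
  assumes A3: "A3 r \<kappa>" and n: "n \<ge> 1"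
  shows "1 \<le> k_index \<kappa> n"
    and "(\<Sum>j=1..<k_index \<kappa> n. (\<kappa> n j)\<^sup>2) \<le> rho \<kappa> n / 2"
    and "rho \<kappa> n / 2 < (\<Sum>j=1..k_index \<kappa> n. (\<kappa> n j)\<^sup>2)"
proof -
  let ?K = "{k. (\<Sum>j=1..<k. (\<kappa> n j)\<^sup>2) \<le> rho \<kappa> n / 2}"
  have S: "(\<lambda>j. (\<kappa> n j)\<^sup>2) summable_on {1..}" using A3 n by (simp add: A3_def)
  obtain c1 where "c1 > 0" "c1 * real n powr (- 2 * r) \<le> rho \<kappa> n" using A3 n unfolding A3_def by blast
  moreover have "0 < real n powr (- 2 * r)" using n by simp
  ultimately have rho: "0 < rho \<kappa> n" by (smt (verit) mult_pos_pos)
  have "(\<lambda>m. \<Sum>j=1..m. (\<kappa> n j)\<^sup>2) \<longlonglongrightarrow> rho \<kappa> n"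
    unfolding rho_def by (rule has_sum_from_1_LIMSEQ) (use S in simp)
  from order_tendstoD(1)[OF this, of "rho \<kappa> n / 2"] rho
  obtain N where N: "rho \<kappa> n / 2 < (\<Sum>j=1..N. (\<kappa> n j)\<^sup>2)" by (auto simp: eventually_sequentially)
  have "?K \<subseteq> {..N}"
  proof
    fix k assume k: "k \<in> ?K"
    show "k \<in> {..N}"
    proof (rule ccontr)
      assume "k \<notin> {..N}"
      then have "(\<Sum>j=1..N. (\<kappa> n j)\<^sup>2) \<le> (\<Sum>j=1..<k. (\<kappa> n j)\<^sup>2)" by (intro sum_mono2) auto
      then show False using N k by simp
    qed
  qed
  then have fin: "finite ?K" by (rule finite_subset) simp
  have one: "1 \<in> ?K" using rho by simp
  have k: "k_index \<kappa> n = Max ?K" unfolding k_index_def Sup_nat_def by (rule if_not_P) (use one in blast)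
  show "1 \<le> k_index \<kappa> n" unfolding k by (rule Max_ge[OF fin one])
  have "k_index \<kappa> n \<in> ?K" unfolding k by (rule Max_in[OF fin]) (use one in blast)
  then show "(\<Sum>j=1..<k_index \<kappa> n. (\<kappa> n j)\<^sup>2) \<le> rho \<kappa> n / 2" by simp
  have "Suc (k_index \<kappa> n) \<notin> ?K" using Max_ge[OF fin, of "Suc (k_index \<kappa> n)"] k by auto
  then show "rho \<kappa> n / 2 < (\<Sum>j=1..k_index \<kappa> n. (\<kappa> n j)\<^sup>2)"
    by (simp add: atLeastLessThanSuc_atLeastAtMost not_le)
qed

text \<open>Up to \<open>k\<^sub>n\<close> the weights lie between \<open>\<kappa>\<^sub>n\<^sup>2\<close> and \<open>\<kappa>\<^sub>n\<^sub>1\<^sup>2\<close>, and they carry at least half of the sum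
  \<open>\<rho>\<^sub>n\<close>. Once \<open>\<kappa>\<^sub>n\<^sub>1\<^sup>2\<close> is comparable with \<open>\<kappa>\<^sub>n\<^sup>2\<close>, these inequalities say that \<open>\<rho>\<^sub>n\<close> is of order
  \<open>k\<^sub>n \<kappa>\<^sub>n\<^sup>2\<close> and that the sum of the squared weights is of order \<open>k\<^sub>n \<kappa>\<^sub>n\<^sup>4\<close>.\<close>
lemma kappa_bounds:
  assumes A1: "A1 \<kappa>" and A3: "A3 r \<kappa>" and n: "n \<ge> 1"
  defines "k \<equiv> real (k_index \<kappa> n)" and "K \<equiv> kappa_sq \<kappa> n"
    and "S \<equiv> (\<Sum>\<^sub>\<infinity>j\<in>{1..}. (\<kappa> n j) ^ 4)"
  shows "0 < K" "k * K \<le> rho \<kappa> n" "rho \<kappa> n \<le> 2 * k * (\<kappa> n 1)\<^sup>2" "k * K\<^sup>2 \<le> S" "S \<le> (\<kappa> n 1)\<^sup>2 * rho \<kappa> n"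
proof -
  let ?k = "k_index \<kappa> n"
  note kp = k_index_properties[OF A3 n]
  have mono: "(\<kappa> n j)\<^sup>2 \<le> (\<kappa> n i)\<^sup>2" if "1 \<le> i" "i \<le> j" for i j using A1 n that by (auto simp: A1_def)
  have S1: "(\<lambda>j. (\<kappa> n j)\<^sup>2) summable_on {1..}" using A3 n by (simp add: A3_def)
  have le4: "(\<kappa> n j) ^ 4 \<le> (\<kappa> n 1)\<^sup>2 * (\<kappa> n j)\<^sup>2" if "j \<in> {1..}" for j
    using mult_right_mono[OF mono[of 1 j], of "(\<kappa> n j)\<^sup>2"] that by (simp add: power_add[symmetric])
  have S2: "(\<lambda>j. (\<kappa> n j) ^ 4) summable_on {1..}"
    by (rule summable_on_comparison_test[OF summable_on_cmult_right[OF S1] le4]) auto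
  have Kle: "K \<le> (\<kappa> n j)\<^sup>2" if "j \<in> {1..?k}" for j
    unfolding K_def kappa_sq_def using that by (intro mono) auto
  have K0: "0 \<le> K" by (simp add: K_def kappa_sq_def)
  have "(\<Sum>j=1..?k. (\<kappa> n j)\<^sup>2) = (\<Sum>j=1..<?k. (\<kappa> n j)\<^sup>2) + K"
    using kp(1) unfolding K_def kappa_sq_def
    by (metis add.commute atLeastLessThanSuc_atLeastAtMost sum.atLeastLessThan_Suc)
  then show "0 < K" using kp by linarith
  have "k * K \<le> (\<Sum>j=1..?k. (\<kappa> n j)\<^sup>2)"
    using sum_bounded_below[of "{1..?k}" K "\<lambda>j. (\<kappa> n j)\<^sup>2"] Kle by (simp add: k_def)
  also have "\<dots> \<le> rho \<kappa> n" unfolding rho_def by (rule finite_sum_le_infsum[OF S1]) auto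
  finally show "k * K \<le> rho \<kappa> n" .
  have "(\<Sum>j=1..?k. (\<kappa> n j)\<^sup>2) \<le> k * (\<kappa> n 1)\<^sup>2"
    using sum_bounded_above[of "{1..?k}" "\<lambda>j. (\<kappa> n j)\<^sup>2" "(\<kappa> n 1)\<^sup>2"] mono[of 1] by (simp add: k_def)
  then show "rho \<kappa> n \<le> 2 * k * (\<kappa> n 1)\<^sup>2" using kp(3) by simp
  have "K\<^sup>2 \<le> (\<kappa> n j) ^ 4" if "j \<in> {1..?k}" for j
    using power_mono[OF Kle[OF that] K0, of 2] by simp
  then have "k * K\<^sup>2 \<le> (\<Sum>j=1..?k. (\<kappa> n j) ^ 4)"
    using sum_bounded_below[of "{1..?k}" "K\<^sup>2" "\<lambda>j. (\<kappa> n j) ^ 4"] by (simp add: k_def)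
  also have "\<dots> \<le> S" unfolding S_def by (rule finite_sum_le_infsum[OF S2]) auto
  finally show "k * K\<^sup>2 \<le> S" .
  have "S \<le> (\<Sum>\<^sub>\<infinity>j\<in>{1..}. (\<kappa> n 1)\<^sup>2 * (\<kappa> n j)\<^sup>2)"
    unfolding S_def by (rule infsum_mono[OF S2 summable_on_cmult_right[OF S1] le4])
  then show "S \<le> (\<kappa> n 1)\<^sup>2 * rho \<kappa> n" by (simp add: infsum_cmult_right' rho_def)
qed

lemma A2_bounds:
  assumes "A2 \<sigma> \<kappa>" "0 < \<sigma>"
  obtains t1 t2 where "0 < t1" "0 < t2"
    "\<And>n. n \<ge> 1 \<Longrightarrow> t1 / (real n)\<^sup>2 \<le> (\<Sum>\<^sub>\<infinity>j\<in>{1..}. (\<kappa> n j) ^ 4)"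
    "\<And>n. n \<ge> 1 \<Longrightarrow> (\<Sum>\<^sub>\<infinity>j\<in>{1..}. (\<kappa> n j) ^ 4) \<le> t2 / (real n)\<^sup>2"
proof -
  obtain s1 s2 where s: "0 < s1" "0 < s2"
    "\<And>n. n \<ge> 1 \<Longrightarrow> s1 < (real n)\<^sup>2 / \<sigma> ^ 4 * (\<Sum>\<^sub>\<infinity>j\<in>{1..}. (\<kappa> n j) ^ 4)"
    "\<And>n. n \<ge> 1 \<Longrightarrow> (real n)\<^sup>2 / \<sigma> ^ 4 * (\<Sum>\<^sub>\<infinity>j\<in>{1..}. (\<kappa> n j) ^ 4) < s2"
    using assms unfolding A2_def by blast
  have s4: "0 < \<sigma> ^ 4" using \<open>0 < \<sigma>\<close> by simp
  show ?thesis
  proof (rule that[of "s1 * \<sigma> ^ 4" "s2 * \<sigma> ^ 4"])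
    fix n :: nat assume n: "n \<ge> 1"
    have n2: "0 < (real n)\<^sup>2" using n by simp
    show "s1 * \<sigma> ^ 4 / (real n)\<^sup>2 \<le> (\<Sum>\<^sub>\<infinity>j\<in>{1..}. (\<kappa> n j) ^ 4)"
      using s(3)[OF n] n2 s4 by (simp add: field_simps)
    show "(\<Sum>\<^sub>\<infinity>j\<in>{1..}. (\<kappa> n j) ^ 4) \<le> s2 * \<sigma> ^ 4 / (real n)\<^sup>2"
      using s(4)[OF n] n2 s4 by (simp add: field_simps)
  qed (use s s4 in auto)
qed

text \<open>Two equations for two unknowns: \<open>k\<^sub>n \<kappa>\<^sub>n\<^sup>2\<close> is of order \<open>n\<^sup>-\<^sup>2\<^sup>r\<close> and \<open>k\<^sub>n \<kappa>\<^sub>n\<^sup>4\<close> is of order \<open>n\<^sup>-\<^sup>2\<close>.\<close>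
lemma kappa_asymptotics:
  assumes A1: "A1 \<kappa>" and A2: "A2 \<sigma> \<kappa>" and A3: "A3 r \<kappa>" and A5: "A5 \<kappa>" and "0 < \<sigma>"
  obtains b b1 b2 k1 k2 where "0 < b" "0 < b1" "0 < b2" "0 < k1" "0 < k2"
    "\<forall>\<^sub>F n in sequentially. n \<ge> 1 \<and> (\<kappa> n 1)\<^sup>2 \<le> b * kappa_sq \<kappa> n
      \<and> b1 * real n powr (2 * r - 2) \<le> kappa_sq \<kappa> n \<and> kappa_sq \<kappa> n \<le> b2 * real n powr (2 * r - 2)
      \<and> k1 * real n powr (2 - 4 * r) \<le> real (k_index \<kappa> n) \<and> real (k_index \<kappa> n) \<le> k2 * real n powr (2 - 4 * r)"
proof -
  obtain b where b: "\<forall>\<^sub>F n in sequentially. (\<kappa> n 1)\<^sup>2 / kappa_sq \<kappa> n \<le> b"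
    using A5 unfolding A5_def by (blast intro: eventually_mono)
  obtain t1 t2 where t: "0 < t1" "0 < t2"
    "\<And>n. n \<ge> 1 \<Longrightarrow> t1 / (real n)\<^sup>2 \<le> (\<Sum>\<^sub>\<infinity>j\<in>{1..}. (\<kappa> n j) ^ 4)"
    "\<And>n. n \<ge> 1 \<Longrightarrow> (\<Sum>\<^sub>\<infinity>j\<in>{1..}. (\<kappa> n j) ^ 4) \<le> t2 / (real n)\<^sup>2"
    by (rule A2_bounds[OF A2 \<open>0 < \<sigma>\<close>]) blast
  obtain c1 c2 where c: "0 < c1" "0 < c2" "\<And>n. n \<ge> 1 \<Longrightarrow> c1 * real n powr (- 2 * r) \<le> rho \<kappa> n"
    "\<And>n. n \<ge> 1 \<Longrightarrow> rho \<kappa> n \<le> c2 * real n powr (- 2 * r)"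
    using A3 unfolding A3_def by blast
  define B where "B = max 1 b"
  have pos: "0 < B" "0 < t1" "0 < t2" using t by (auto simp: B_def)
  let ?b1 = "t1 / (B * c2)" and ?b2 = "2 * B * t2 / c1"
  have main: "n \<ge> 1 \<and> (\<kappa> n 1)\<^sup>2 \<le> B * kappa_sq \<kappa> n
      \<and> ?b1 * real n powr (2 * r - 2) \<le> kappa_sq \<kappa> n \<and> kappa_sq \<kappa> n \<le> ?b2 * real n powr (2 * r - 2)
      \<and> (c1 / (2 * B * ?b2)) * real n powr (2 - 4 * r) \<le> real (k_index \<kappa> n)
      \<and> real (k_index \<kappa> n) \<le> (c2 / ?b1) * real n powr (2 - 4 * r)"
    if n: "n \<ge> 1" and bn: "(\<kappa> n 1)\<^sup>2 / kappa_sq \<kappa> n \<le> b" for n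
  proof -
    \<comment> \<open>In terms of \<open>p = n\<^sup>-\<^sup>2\<^sup>r\<close> and \<open>q = n\<^sup>-\<^sup>2\<close> all orders are rational: \<open>q / p\<close> for \<open>\<kappa>\<^sub>n\<^sup>2\<close> and
      \<open>p\<^sup>2 / q\<close> for \<open>k\<^sub>n\<close>.\<close>
    let ?k = "real (k_index \<kappa> n)" and ?K = "kappa_sq \<kappa> n" and ?S = "\<Sum>\<^sub>\<infinity>j\<in>{1..}. (\<kappa> n j) ^ 4"
    define p where "p = real n powr (- 2 * r)"
    define q where "q = real n powr (- 2)"
    have n0: "0 < real n" using n by simp
    have pq: "0 < p" "0 < q" using n0 by (auto simp: p_def q_def)
    have e1: "real n powr (2 * r - 2) = q / p" unfolding p_def q_def by (simp add: powr_diff[symmetric])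
    have e2: "real n powr (2 - 4 * r) = p\<^sup>2 / q"
      unfolding p_def q_def power2_eq_square by (simp add: powr_diff[symmetric] powr_add[symmetric])
    have qn: "q = 1 / (real n)\<^sup>2" unfolding q_def using n0 by (simp add: powr_minus_divide powr_numeral)
    note kb = kappa_bounds[OF A1 A3 n]
    have k1: "1 \<le> ?k" using k_index_properties(1)[OF A3 n] by simp
    have S1: "t1 * q \<le> ?S" and S2: "?S \<le> t2 * q" using t(3,4)[OF n] by (simp_all add: qn)
    have r1: "c1 * p \<le> rho \<kappa> n" and r2: "rho \<kappa> n \<le> c2 * p" using c n by (auto simp: p_def)
    have rho0: "0 < rho \<kappa> n" using r1 c pq by (smt (verit) mult_pos_pos)
    have kB: "(\<kappa> n 1)\<^sup>2 \<le> B * ?K"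
      using bn kb(1) by (simp add: divide_le_eq B_def) (smt (verit) mult_right_mono max.cobounded2)
    have "t1 * q \<le> (B * ?K) * (c2 * p)"
      using S1 kb(5) mult_mono[OF kB r2] pos kb(1) rho0 by simp
    then have Klow: "?b1 * (q / p) \<le> ?K" using pos c pq by (simp add: field_simps)
    have rhoK: "rho \<kappa> n \<le> 2 * B * (?k * ?K)"
      using kb(3) mult_left_mono[OF kB, of "2 * ?k"] by (simp add: mult_ac)
    have "?K * (c1 * p) \<le> ?K * (2 * B * (?k * ?K))"
      using rhoK r1 kb(1) by (intro mult_left_mono) auto
    also have "\<dots> = 2 * B * (?k * ?K\<^sup>2)" by (simp add: power2_eq_square)
    also have "\<dots> \<le> 2 * B * (t2 * q)" using kb(4) S2 pos by (intro mult_left_mono) auto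
    finally have Kup: "?K \<le> ?b2 * (q / p)" using pos c pq by (simp add: field_simps)
    have "?k * (?b1 * (q / p)) \<le> ?k * ?K" using Klow by (intro mult_left_mono) auto
    also have "\<dots> \<le> c2 * p" using kb(2) r2 by simp
    finally have kup: "?k \<le> (c2 / ?b1) * (p\<^sup>2 / q)"
      using pos c pq by (simp add: field_simps power2_eq_square)
    have "c1 * p \<le> 2 * B * (?k * ?K)" using rhoK r1 by simp
    also have "\<dots> \<le> 2 * B * (?k * (?b2 * (q / p)))"
      using Kup pos by (intro mult_left_mono) auto
    finally have klow: "(c1 / (2 * B * ?b2)) * (p\<^sup>2 / q) \<le> ?k"
      using pos c pq by (simp add: field_simps power2_eq_square)
    show ?thesis unfolding e1 e2 using n kB Klow Kup klow kup by blast
  qed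
  show ?thesis
  proof (rule that)
    show "\<forall>\<^sub>F n in sequentially. n \<ge> 1 \<and> (\<kappa> n 1)\<^sup>2 \<le> B * kappa_sq \<kappa> n
      \<and> ?b1 * real n powr (2 * r - 2) \<le> kappa_sq \<kappa> n \<and> kappa_sq \<kappa> n \<le> ?b2 * real n powr (2 * r - 2)
      \<and> (c1 / (2 * B * ?b2)) * real n powr (2 - 4 * r) \<le> real (k_index \<kappa> n)
      \<and> real (k_index \<kappa> n) \<le> (c2 / ?b1) * real n powr (2 - 4 * r)"
      using b eventually_ge_at_top[of 1] by eventually_elim (rule main)
  qed (use pos c in auto)
qed

section \<open>Consistency in terms of the weighted signal energy\<close>

definition signal_energy :: "(nat \<Rightarrow> nat \<Rightarrow> real) \<Rightarrow> (nat \<Rightarrow> real \<Rightarrow> real) \<Rightarrow> nat \<Rightarrow> (real \<Rightarrow> real) \<Rightarrow> real" where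
  "signal_energy \<kappa> \<phi> n f = (\<Sum>\<^sub>\<infinity>j\<in>{1..}. (\<kappa> n j)\<^sup>2 * (l2_inner f (\<phi> j))\<^sup>2)"

lemma (in orthonormal_basis) signal_energy_summable:
  assumes "A1 \<kappa>" "n \<ge> 1" "f \<in> L2_01"
  shows "(\<lambda>j. (\<kappa> n j)\<^sup>2 * (l2_inner f (\<phi> j))\<^sup>2) summable_on {1..}"
proof (rule summable_on_comparison_test)
  show "(\<lambda>j. (\<kappa> n 1)\<^sup>2 * (l2_inner f (\<phi> j))\<^sup>2) summable_on {1..}"
    by (intro summable_on_cmult_right has_sum_imp_summable[OF parseval] assms)
  show "(\<kappa> n j)\<^sup>2 * (l2_inner f (\<phi> j))\<^sup>2 \<le> (\<kappa> n 1)\<^sup>2 * (l2_inner f (\<phi> j))\<^sup>2" if "j \<in> {1..}" for j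
    using assms that by (intro mult_right_mono) (auto simp: A1_def)
qed auto

text \<open>The ratio is of order \<open>n\<^sup>2\<^sup>r\<^sup>-\<^sup>2 / n\<^sup>-\<^sup>1\<close>.\<close>
lemma max_weight_ratio_tendsto_0:
  assumes "A1 \<kappa>" "A2 \<sigma> \<kappa>" "A3 r \<kappa>" "A5 \<kappa>" "0 < \<sigma>" "r < 1 / 2"
  shows "(\<lambda>n. (\<kappa> n 1)\<^sup>2 / sqrt (2 * (\<Sum>\<^sub>\<infinity>j\<in>{1..}. (\<kappa> n j) ^ 4))) \<longlonglongrightarrow> 0"
proof -
  obtain b b1 b2 k1 k2 where b: "0 < b" "0 < b1" "0 < b2" "0 < k1" "0 < k2"
    and ev: "\<forall>\<^sub>F n in sequentially. n \<ge> 1 \<and> (\<kappa> n 1)\<^sup>2 \<le> b * kappa_sq \<kappa> n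
      \<and> b1 * real n powr (2 * r - 2) \<le> kappa_sq \<kappa> n \<and> kappa_sq \<kappa> n \<le> b2 * real n powr (2 * r - 2)
      \<and> k1 * real n powr (2 - 4 * r) \<le> real (k_index \<kappa> n) \<and> real (k_index \<kappa> n) \<le> k2 * real n powr (2 - 4 * r)"
    by (rule kappa_asymptotics[OF assms(1-5)])
  obtain t1 t2 where t: "0 < t1" "\<And>n. n \<ge> 1 \<Longrightarrow> t1 / (real n)\<^sup>2 \<le> (\<Sum>\<^sub>\<infinity>j\<in>{1..}. (\<kappa> n j) ^ 4)"
    by (rule A2_bounds[OF assms(2,5)]) blast
  have "(\<lambda>n. real n powr (2 * r - 1)) \<longlonglongrightarrow> 0"
    using assms(6) by (intro tendsto_neg_powr filterlim_real_sequentially) auto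
  then have z: "(\<lambda>n. (b * b2 / sqrt (2 * t1)) * real n powr (2 * r - 1)) \<longlonglongrightarrow> 0"
    by (rule tendsto_mult_right_zero)
  show ?thesis
  proof (rule Lim_null_comparison[OF _ z], use ev in eventually_elim)
    case (elim n)
    then have n: "n \<ge> 1" "0 < real n" by auto
    have S: "sqrt (2 * t1) / real n \<le> sqrt (2 * (\<Sum>\<^sub>\<infinity>j\<in>{1..}. (\<kappa> n j) ^ 4))"
      using real_sqrt_le_mono[of "2 * (t1 / (real n)\<^sup>2)" "2 * (\<Sum>\<^sub>\<infinity>j\<in>{1..}. (\<kappa> n j) ^ 4)"] t(2)[OF n(1)] n
      by (simp add: real_sqrt_divide)
    have S0: "0 \<le> sqrt (2 * (\<Sum>\<^sub>\<infinity>j\<in>{1..}. (\<kappa> n j) ^ 4))"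
      by (rule order_trans[OF _ S]) (use t(1) in simp)
    have "(\<kappa> n 1)\<^sup>2 \<le> b * (b2 * real n powr (2 * r - 2))"
      using elim b by (meson mult_left_mono order_trans less_imp_le)
    then have "(\<kappa> n 1)\<^sup>2 / sqrt (2 * (\<Sum>\<^sub>\<infinity>j\<in>{1..}. (\<kappa> n j) ^ 4))
        \<le> b * (b2 * real n powr (2 * r - 2)) / (sqrt (2 * t1) / real n)"
      using S t(1) n b by (intro frac_le) auto
    also have "\<dots> = (b * b2 / sqrt (2 * t1)) * (real n powr (2 * r - 2) * real n powr 1)"
      using n by simp
    also have "real n powr (2 * r - 2) * real n powr 1 = real n powr (2 * r - 1)"
      by (simp only: powr_add[symmetric]) (simp add: algebra_simps)
    finally show ?case using S0 by simp
  qed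
qed

text \<open>Dividing the statistic by its standard deviation \<open>v n\<close> under the hypothesis turns a threshold
  \<open>x n\<close> into \<open>x n / v n\<close> and leads to the situation of \<open>limsup_type2_error_less\<close> and
  \<open>shift_bounded_below_if_power\<close> with the shift \<open>d n\<close>. As \<open>v n\<close> lies between two positive multiples
  of \<open>n\<^sup>-\<^sup>2\<close>, the shift may be replaced by \<open>n\<^sup>2\<close> times the weighted energy.\<close>
theorem consistent_iff_signal_energy:
  assumes WN: "white_noise M W" and basis: "l2_basis \<phi>" and s: "0 < \<sigma>" and r: "r < 1 / 2"
    and A: "A1 \<kappa>" "A2 \<sigma> \<kappa>" "A3 r \<kappa>" "A5 \<kappa>"
    and f: "\<And>n. n \<ge> 1 \<Longrightarrow> f n \<in> L2_01"
  shows "consistent M W \<sigma> \<phi> \<kappa> f \<longleftrightarrow>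
    (\<exists>\<delta>>0. \<forall>\<^sub>F n in sequentially. \<delta> \<le> (real n)\<^sup>2 * signal_energy \<kappa> \<phi> n (f n))"
proof -
  interpret orthonormal_basis \<phi> by unfold_locales (rule basis)
  have on: "l2_orthonormal {1..} \<phi>" using basis by (simp add: l2_basis_def)
  interpret prob_space M using WN by (simp add: white_noise_def)
  interpret gaussian_sequence M "\<lambda>j. W (\<phi> j)"
    by unfold_locales (use WN on in \<open>auto simp: white_noise_def\<close>)
  define a where "a n j = (\<kappa> n j)\<^sup>2" for n j
  define e where "e n = \<sigma> / sqrt (real n)" for n
  define \<theta> where "\<theta> n j = l2_inner (f n) (\<phi> j)" for n j
  define v where "v n = null_sd (a n) (e n)" for n
  define d where "d n = signal_energy \<kappa> \<phi> n (f n) / v n" for n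
  define h where "h n = 4 * (e n)\<^sup>2 * a n 1 / v n" for n
  let ?S = "\<lambda>n. \<Sum>\<^sub>\<infinity>j\<in>{1..}. (\<kappa> n j) ^ 4"
  define X where "X n \<omega> = energy_stat (a n) (\<lambda>_. 0) (e n) \<omega> / v n" for n \<omega>
  define D where "D n \<omega> = energy_stat (a n) (\<theta> n) (e n) \<omega> / v n" for n \<omega>
  obtain t1 t2 where t: "0 < t1" "0 < t2" "\<And>n. n \<ge> 1 \<Longrightarrow> t1 / (real n)\<^sup>2 \<le> ?S n"
    "\<And>n. n \<ge> 1 \<Longrightarrow> ?S n \<le> t2 / (real n)\<^sup>2"
    by (rule A2_bounds[OF A(2) s]) blast
  have S_eq: "(\<Sum>\<^sub>\<infinity>j\<in>{1..}. (a n j)\<^sup>2) = ?S n" for n by (simp add: a_def)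
  have e2: "(e n)\<^sup>2 = \<sigma>\<^sup>2 / real n" for n by (simp add: e_def power_divide)
  have Spos: "0 < ?S n" if "n \<ge> 1" for n
    using t(1) t(3)[OF that] that by (smt (verit) divide_pos_pos of_nat_0_less_iff zero_less_power less_eq_Suc_le One_nat_def)
  have v_eq: "v n = \<sigma>\<^sup>2 / real n * sqrt (2 * ?S n)" for n by (simp only: v_def null_sd_def e2 S_eq)
  have vpos: "0 < v n" if "n \<ge> 1" for n using Spos[OF that] that s by (simp add: v_eq)
  have v_low: "\<sigma>\<^sup>2 * sqrt (2 * t1) / (real n)\<^sup>2 \<le> v n" and v_up: "v n \<le> \<sigma>\<^sup>2 * sqrt (2 * t2) / (real n)\<^sup>2" if n: "n \<ge> 1" for n
  proof -
    have "sqrt (2 * (t1 / (real n)\<^sup>2)) \<le> sqrt (2 * ?S n)" "sqrt (2 * ?S n) \<le> sqrt (2 * (t2 / (real n)\<^sup>2))"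
      using t(3,4)[OF n] by (auto intro: real_sqrt_le_mono)
    then have q: "sqrt (2 * t1) / real n \<le> sqrt (2 * ?S n)" "sqrt (2 * ?S n) \<le> sqrt (2 * t2) / real n"
      by (auto simp: real_sqrt_divide)
    show "\<sigma>\<^sup>2 * sqrt (2 * t1) / (real n)\<^sup>2 \<le> v n"
      using mult_left_mono[OF q(1), of "\<sigma>\<^sup>2 / real n"] by (simp add: v_eq power2_eq_square mult_ac)
    show "v n \<le> \<sigma>\<^sup>2 * sqrt (2 * t2) / (real n)\<^sup>2"
      using mult_left_mono[OF q(2), of "\<sigma>\<^sup>2 / real n"] by (simp add: v_eq power2_eq_square mult_ac)
  qed
  have a0: "0 \<le> a n j" for n j by (simp add: a_def)
  have aS: "a n summable_on {1..}" if "n \<ge> 1" for n using A(3) that by (simp add: A3_def a_def[abs_def])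
  have a1: "a n j \<le> a n 1" if "n \<ge> 1" "j \<ge> 1" for n j using A(1) that by (simp add: A1_def a_def)
  have at: "(\<lambda>j. a n j * (\<theta> n j)\<^sup>2) summable_on {1..}" if "n \<ge> 1" for n
    unfolding a_def \<theta>_def by (rule signal_energy_summable[OF A(1) that f[OF that]])
  have h_eq: "h n = 4 * ((\<kappa> n 1)\<^sup>2 / sqrt (2 * ?S n))" if "n \<ge> 1" for n
    using that s by (simp add: h_def e2 v_eq a_def)
  have h_lim: "h \<longlonglongrightarrow> 0"
  proof (rule Lim_transform_eventually)
    show "(\<lambda>n. 4 * ((\<kappa> n 1)\<^sup>2 / sqrt (2 * ?S n))) \<longlonglongrightarrow> 0"
      by (rule tendsto_mult_right_zero[OF max_weight_ratio_tendsto_0[OF A s r]])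
    show "\<forall>\<^sub>F n in sequentially. 4 * ((\<kappa> n 1)\<^sup>2 / sqrt (2 * ?S n)) = h n"
      using eventually_ge_at_top[of 1] by eventually_elim (simp only: h_eq)
  qed
  have h0: "0 \<le> h n" if "n \<ge> 1" for n using vpos[OF that] a0 by (simp add: h_def)
  have mX: "X n \<in> borel_measurable M" and mD: "D n \<in> borel_measurable M" for n
    unfolding X_def[abs_def] D_def[abs_def]
    by (intro borel_measurable_divide measurable_energy_stat a0 borel_measurable_const)+
  have X_clt: "(\<lambda>n. prob {\<omega>\<in>space M. X n \<omega> \<le> x}) \<longlonglongrightarrow> \<Phi> x" for x
    unfolding X_def v_def
  proof (rule energy_stat_null_clt[where B = "\<lambda>n. a n 1"])
    show "(\<lambda>n. (e n)\<^sup>2 * a n 1 / null_sd (a n) (e n)) \<longlonglongrightarrow> 0"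
      using tendsto_mult_right_zero[OF h_lim, of "1 / 4"] by (simp add: h_def v_def)
    show "0 < e n" if "n \<ge> 1" for n using that s by (simp add: e_def)
  qed (use a0 aS a1 Spos S_eq in auto)
  have tail: "prob {\<omega>\<in>space M. \<bar>D n \<omega> - X n \<omega> - d n\<bar> \<ge> \<epsilon>} \<le> h n * d n / \<epsilon>\<^sup>2" if "n \<ge> 1" "0 < \<epsilon>" for n \<epsilon>
    using energy_stat_cross_term_tail[where a = "a n" and \<theta> = "\<theta> n" and B = "a n 1" and v = "v n" and e = "e n",
        OF a0 aS[OF that(1)] at[OF that(1)] a1[OF that(1)] vpos[OF that(1)] that(2)]
    by (simp add: D_def X_def d_def h_def signal_energy_def a_def \<theta>_def)
  have type1: "type1_error M W \<sigma> \<phi> \<kappa> n x = prob {\<omega>\<in>space M. X n \<omega> > x / v n}" if "n \<ge> 1" for n x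
  proof -
    have "test_stat \<sigma> W \<phi> \<kappa> n (\<lambda>_. 0) \<omega> = X n \<omega> * v n" for \<omega>
      using vpos[OF that]
      by (simp add: X_def energy_stat_def test_stat_def observation_def l2_inner_def rho_def a_def[abs_def] e2 e_def[symmetric])
    then show ?thesis using vpos[OF that] by (simp add: type1_error_def divide_less_eq)
  qed
  have type2: "type2_error M W \<sigma> \<phi> \<kappa> n x (f n) = prob {\<omega>\<in>space M. \<not> D n \<omega> > x / v n}" if "n \<ge> 1" for n x
  proof -
    have "test_stat \<sigma> W \<phi> \<kappa> n (f n) \<omega> = D n \<omega> * v n" for \<omega>
      using vpos[OF that]
      by (simp add: D_def energy_stat_def test_stat_def observation_def rho_def \<theta>_def a_def[abs_def] e2 e_def[symmetric])
    then show ?thesis using vpos[OF that] by (simp add: type2_error_def divide_less_eq)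
  qed
  have "consistent M W \<sigma> \<phi> \<kappa> f \<longleftrightarrow> (\<exists>\<delta>>0. \<forall>\<^sub>F n in sequentially. \<delta> \<le> d n)"
  proof
    assume C: "consistent M W \<sigma> \<phi> \<kappa> f"
    \<comment> \<open>Only one level is tested; any other level and its quantile would do as well.\<close>
    obtain x0 where x0: "\<Phi> x0 = 1 / 2" using std_normal_quantile[of "1 / 2"] by auto
    have "(\<lambda>n. 1 - prob {\<omega>\<in>space M. X n \<omega> \<le> x0}) \<longlonglongrightarrow> 1 - \<Phi> x0" by (intro tendsto_intros X_clt)
    then have "(\<lambda>n. 1 - prob {\<omega>\<in>space M. X n \<omega> \<le> x0}) \<longlonglongrightarrow> 1 / 2" by (simp add: x0)
    then have "(\<lambda>n. type1_error M W \<sigma> \<phi> \<kappa> n (x0 * v n)) \<longlonglongrightarrow> 1 / 2"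
    proof (rule Lim_transform_eventually)
      show "\<forall>\<^sub>F n in sequentially. 1 - prob {\<omega>\<in>space M. X n \<omega> \<le> x0} = type1_error M W \<sigma> \<phi> \<kappa> n (x0 * v n)"
        using eventually_ge_at_top[of 1]
      proof eventually_elim
        case (elim n)
        have [measurable]: "X n \<in> borel_measurable M" by (rule mX)
        have "1 - prob {\<omega>\<in>space M. X n \<omega> \<le> x0} = prob (space M - {\<omega>\<in>space M. X n \<omega> \<le> x0})"
          by (rule prob_compl[symmetric]) measurable
        also have "space M - {\<omega>\<in>space M. X n \<omega> \<le> x0} = {\<omega>\<in>space M. X n \<omega> > x0}" by auto
        finally show ?case using vpos[OF elim] by (simp add: type1[OF elim])
      qed
    qed
    then have "(\<lambda>n. type1_error M W \<sigma> \<phi> \<kappa> n (x0 * v n)) \<sim>[sequentially] (\<lambda>_. 1 / 2)"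
      by (rule tendsto_imp_asymp_equiv_const) simp
    then have "limsup (\<lambda>n. ereal (type2_error M W \<sigma> \<phi> \<kappa> n (x0 * v n) (f n))) < ereal (1 - 1 / 2)"
      using C by (auto simp: consistent_def dest!: bspec[of _ _ "1 / 2"])
    also have "limsup (\<lambda>n. ereal (type2_error M W \<sigma> \<phi> \<kappa> n (x0 * v n) (f n)))
        = limsup (\<lambda>n. ereal (prob {\<omega>\<in>space M. \<not> D n \<omega> > x0}))"
    proof (rule Limsup_eq)
      show "\<forall>\<^sub>F n in sequentially. ereal (type2_error M W \<sigma> \<phi> \<kappa> n (x0 * v n) (f n)) =
          ereal (prob {\<omega>\<in>space M. \<not> D n \<omega> > x0})"
        using eventually_ge_at_top[of 1]
        by eventually_elim (use type2 vpos in \<open>force simp: less_le\<close>)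
    qed
    finally have "limsup (\<lambda>n. ereal (prob {\<omega>\<in>space M. \<not> D n \<omega> > x0})) < ereal (\<Phi> x0)"
      by (simp add: x0)
    then show "\<exists>\<delta>>0. \<forall>\<^sub>F n in sequentially. \<delta> \<le> d n"
      by (intro shift_bounded_below_if_power[OF mX mD X_clt tail h_lim h0])
  next
    assume "\<exists>\<delta>>0. \<forall>\<^sub>F n in sequentially. \<delta> \<le> d n"
    then obtain \<delta> where \<delta>: "0 < \<delta>" "\<forall>\<^sub>F n in sequentially. \<delta> \<le> d n" by blast
    show "consistent M W \<sigma> \<phi> \<kappa> f"
      unfolding consistent_def
    proof (intro ballI allI impI)
      fix \<alpha> :: real and x :: "nat \<Rightarrow> real"
      assume \<alpha>: "\<alpha> \<in> {0<..<1}" and eq: "(\<lambda>n. type1_error M W \<sigma> \<phi> \<kappa> n (x n)) \<sim>[sequentially] (\<lambda>_. \<alpha>)"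
      have lev: "(\<lambda>n. prob {\<omega>\<in>space M. X n \<omega> > x n / v n}) \<longlonglongrightarrow> \<alpha>"
      proof (rule Lim_transform_eventually[OF asymp_equivD_const[OF eq]])
        show "\<forall>\<^sub>F n in sequentially. type1_error M W \<sigma> \<phi> \<kappa> n (x n) = prob {\<omega>\<in>space M. X n \<omega> > x n / v n}"
          using eventually_ge_at_top[of 1] by eventually_elim (rule type1)
      qed
      have "limsup (\<lambda>n. ereal (type2_error M W \<sigma> \<phi> \<kappa> n (x n) (f n)))
        = limsup (\<lambda>n. ereal (prob {\<omega>\<in>space M. \<not> D n \<omega> > x n / v n}))"
      proof (rule Limsup_eq)
        show "\<forall>\<^sub>F n in sequentially. ereal (type2_error M W \<sigma> \<phi> \<kappa> n (x n) (f n)) =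
            ereal (prob {\<omega>\<in>space M. \<not> D n \<omega> > x n / v n})"
          using eventually_ge_at_top[of 1] by eventually_elim (simp only: type2)
      qed
      also have "\<dots> < ereal (1 - \<alpha>)"
        using \<alpha> by (intro limsup_type2_error_less[OF mX mD X_clt tail h_lim h0 \<delta> _ _ lev]) auto
      finally show "limsup (\<lambda>n. ereal (type2_error M W \<sigma> \<phi> \<kappa> n (x n) (f n))) < ereal (1 - \<alpha>)" .
    qed
  qed
  also have "\<dots> \<longleftrightarrow> (\<exists>\<delta>>0. \<forall>\<^sub>F n in sequentially. \<delta> \<le> (real n)\<^sup>2 * signal_energy \<kappa> \<phi> n (f n))"
  proof
    let ?v1 = "\<sigma>\<^sup>2 * sqrt (2 * t1)"
    assume "\<exists>\<delta>>0. \<forall>\<^sub>F n in sequentially. \<delta> \<le> d n"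
    then obtain \<delta> where \<delta>: "0 < \<delta>" "\<forall>\<^sub>F n in sequentially. \<delta> \<le> d n" by blast
    have "\<forall>\<^sub>F n in sequentially. \<delta> * ?v1 \<le> (real n)\<^sup>2 * signal_energy \<kappa> \<phi> n (f n)"
      using \<delta>(2) eventually_ge_at_top[of 1]
    proof eventually_elim
      case (elim n)
      have "\<delta> * (?v1 / (real n)\<^sup>2) \<le> \<delta> * v n" using v_low[OF elim(2)] \<delta> by (intro mult_left_mono) auto
      also have "\<dots> \<le> signal_energy \<kappa> \<phi> n (f n)"
        using elim vpos[of n] by (simp add: d_def field_simps)
      finally show ?case using elim(2) by (simp add: field_simps)
    qed
    moreover have "0 < \<delta> * ?v1" using \<delta> s t by simp
    ultimately show "\<exists>\<delta>>0. \<forall>\<^sub>F n in sequentially. \<delta> \<le> (real n)\<^sup>2 * signal_energy \<kappa> \<phi> n (f n)" by blast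
  next
    let ?v2 = "\<sigma>\<^sup>2 * sqrt (2 * t2)"
    have v2: "0 < ?v2" using s t by simp
    assume "\<exists>\<delta>>0. \<forall>\<^sub>F n in sequentially. \<delta> \<le> (real n)\<^sup>2 * signal_energy \<kappa> \<phi> n (f n)"
    then obtain \<delta> where \<delta>: "0 < \<delta>" "\<forall>\<^sub>F n in sequentially. \<delta> \<le> (real n)\<^sup>2 * signal_energy \<kappa> \<phi> n (f n)" by blast
    have "\<forall>\<^sub>F n in sequentially. \<delta> / ?v2 \<le> d n"
      using \<delta>(2) eventually_ge_at_top[of 1]
    proof eventually_elim
      case (elim n)
      have "\<delta> / ?v2 * v n \<le> \<delta> / ?v2 * (?v2 / (real n)\<^sup>2)"
        using v_up[OF elim(2)] \<delta> v2 by (intro mult_left_mono) auto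
      also have "\<dots> = \<delta> / (real n)\<^sup>2" using s t by simp
      also have "\<dots> \<le> signal_energy \<kappa> \<phi> n (f n)"
        using elim by (simp add: field_simps)
      finally show ?case using vpos[OF elim(2)] by (simp add: d_def le_divide_eq)
    qed
    moreover have "0 < \<delta> / ?v2" using \<delta> v2 by simp
    ultimately show "\<exists>\<delta>>0. \<forall>\<^sub>F n in sequentially. \<delta> \<le> d n" by blast
  qed
  finally show ?thesis .
qed

section \<open>Besov balls and low-frequency energy\<close>

lemma besov_ball_tail:
  assumes "g \<in> besov_ball \<phi> s P0" "m \<ge> 1"
  shows "real m powr (2 * s) * (\<Sum>\<^sub>\<infinity>j\<in>{m<..}. (l2_inner g (\<phi> j))\<^sup>2) \<le> P0"
proof -
  have eq: "{j. real m < real j} = {m<..}" by auto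
  have "\<forall>l\<in>{0<..}. ereal (l powr (2 * s) * (\<Sum>\<^sub>\<infinity>j\<in>{j. l < real j}. (l2_inner g (\<phi> j))\<^sup>2)) \<le> ereal P0"
    using assms(1) unfolding besov_ball_def SUP_le_iff mem_Collect_eq by (rule conjunct2)
  from bspec[OF this, of "real m"] assms(2) show ?thesis unfolding eq by simp
qed

lemma (in orthonormal_basis) partial_expansion_in_besov_ball:
  assumes "0 < s" "0 \<le> P0" and P: "real m powr (2 * s) * (\<Sum>j=1..m. (l2_inner f (\<phi> j))\<^sup>2) \<le> P0"
  shows "partial_expansion \<phi> m f \<in> besov_ball \<phi> s P0"
proof -
  let ?g = "partial_expansion \<phi> m f"
  have "l powr (2 * s) * (\<Sum>\<^sub>\<infinity>j\<in>{j. l < real j}. (l2_inner ?g (\<phi> j))\<^sup>2) \<le> P0" if l: "0 < l" for l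
  proof -
    have "(\<Sum>\<^sub>\<infinity>j\<in>{j. l < real j}. (l2_inner ?g (\<phi> j))\<^sup>2) = (\<Sum>\<^sub>\<infinity>j\<in>{j. l < real j} \<inter> {1..m}. (l2_inner f (\<phi> j))\<^sup>2)"
      using l by (intro infsum_cong_neutral) (auto simp: coeff_partial_expansion)
    also have "\<dots> = (\<Sum>j\<in>{j. l < real j} \<inter> {1..m}. (l2_inner f (\<phi> j))\<^sup>2)" by (intro infsum_finite) auto
    finally have eq: "(\<Sum>\<^sub>\<infinity>j\<in>{j. l < real j}. (l2_inner ?g (\<phi> j))\<^sup>2) = \<dots>" .
    show ?thesis
    proof (cases "l < real m")
      case True
      have "l powr (2 * s) * (\<Sum>j\<in>{j. l < real j} \<inter> {1..m}. (l2_inner f (\<phi> j))\<^sup>2)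
          \<le> real m powr (2 * s) * (\<Sum>j=1..m. (l2_inner f (\<phi> j))\<^sup>2)"
        using True l assms(1) by (intro mult_mono powr_mono2 sum_mono2 sum_nonneg) auto
      then show ?thesis using P eq by simp
    next
      case False
      then have "{j. l < real j} \<inter> {1..m} = {}" by auto
      then show ?thesis using eq assms(2) by simp
    qed
  qed
  then show ?thesis
    by (auto simp: besov_ball_def partial_expansion_L2 intro!: SUP_least)
qed

lemma powr_rate_squared: "(x * real n powr (- r))\<^sup>2 = x\<^sup>2 * real n powr (- 2 * r)"
  by (simp add: power_mult_distrib power2_eq_square powr_add[symmetric])

lemma norm_rate_inner:
  assumes "norm_rate r c C f" "0 < c" "n \<ge> 1"
  shows "c\<^sup>2 * real n powr (- 2 * r) \<le> l2_inner (f n) (f n)" "l2_inner (f n) (f n) \<le> C\<^sup>2 * real n powr (- 2 * r)"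
proof -
  have "(c * real n powr (- r))\<^sup>2 \<le> (l2_norm (f n))\<^sup>2" "(l2_norm (f n))\<^sup>2 \<le> (C * real n powr (- r))\<^sup>2"
    using assms by (auto simp: norm_rate_def l2_norm_nonneg intro!: power_mono)
  then show "c\<^sup>2 * real n powr (- 2 * r) \<le> l2_inner (f n) (f n)" "l2_inner (f n) (f n) \<le> C\<^sup>2 * real n powr (- 2 * r)"
    unfolding powr_rate_squared l2_norm_power2 by auto
qed

text \<open>This identity singles out the exponent \<open>s\<close>: a cut-off of order \<open>k\<^sub>n\<close>, raised to the power \<open>2s\<close>,
  exactly compensates for squared norms of order \<open>n\<^sup>-\<^sup>2\<^sup>r\<close>.\<close>
lemma smoothness_rate:
  assumes "r < 1 / 2" "s = r / (2 - 4 * r)"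
  shows "(real n powr (2 - 4 * r)) powr (2 * s) = real n powr (2 * r)"
  using assms by (simp add: powr_powr)

text \<open>Membership in the Besov ball bounds the energy of \<open>g\<^sub>n\<close> beyond \<open>L k\<^sub>n\<close> by a multiple of
  \<open>L\<^sup>-\<^sup>2\<^sup>s n\<^sup>-\<^sup>2\<^sup>r\<close>. For \<open>L\<close> large this is small enough for \<open>low_frequency_mass\<close>, and the weights
  up to \<open>L k\<^sub>n\<close> are at least a constant times \<open>\<kappa>\<^sub>n\<^sup>2\<close>.\<close>
lemma (in orthonormal_basis) signal_energy_ge_if_smooth_part:
  assumes r: "0 < r" "r < 1 / 2" and s: "s = r / (2 - 4 * r)" and \<sigma>: "0 < \<sigma>"
    and A: "A1 \<kappa>" "A2 \<sigma> \<kappa>" "A3 r \<kappa>" "A5 \<kappa>"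
    and c: "0 < c1" "c1 < C1" and "0 < P0" and g: "norm_rate r c1 C1 g"
    and besov: "\<And>n. n \<ge> 1 \<Longrightarrow> g n \<in> besov_ball \<phi> s P0"
    and f: "\<And>n. n \<ge> 1 \<Longrightarrow> f n \<in> L2_01" "\<And>n. n \<ge> 1 \<Longrightarrow> l2_inner (f n) (f n) \<le> C\<^sup>2 * real n powr (- 2 * r)"
    and C: "0 < C"
    and inner: "\<And>n. n \<ge> 1 \<Longrightarrow> l2_inner (g n) (f n) = l2_inner (g n) (g n)"
  shows "\<exists>\<delta>>0. \<forall>\<^sub>F n in sequentially. \<delta> \<le> (real n)\<^sup>2 * signal_energy \<kappa> \<phi> n (f n)"
proof -
  obtain b b1 b2 k1 k2 where b: "0 < b" "0 < b1" "0 < b2" "0 < k1" "0 < k2"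
    and ev: "\<forall>\<^sub>F n in sequentially. n \<ge> 1 \<and> (\<kappa> n 1)\<^sup>2 \<le> b * kappa_sq \<kappa> n
      \<and> b1 * real n powr (2 * r - 2) \<le> kappa_sq \<kappa> n \<and> kappa_sq \<kappa> n \<le> b2 * real n powr (2 * r - 2)
      \<and> k1 * real n powr (2 - 4 * r) \<le> real (k_index \<kappa> n) \<and> real (k_index \<kappa> n) \<le> k2 * real n powr (2 - 4 * r)"
    by (rule kappa_asymptotics[OF A \<sigma>])
  define t where "t = c1 ^ 4 / (16 * C\<^sup>2)"
  define F where "F = c1 ^ 4 / (2 * C1\<^sup>2)"
  \<comment> \<open>\<open>t\<close> and \<open>F\<close> are the constants of \<open>low_frequency_mass\<close>. The integer part of \<open>L k\<^sub>n\<close> is at least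
    \<open>L k\<^sub>n / 2\<close> since \<open>L \<ge> 2\<close>, so \<open>L\<close> has to satisfy \<open>P\<^sub>0 / t \<le> (L k\<^sub>1 / 2)\<^sup>2\<^sup>s\<close>.\<close>
  define L where "L = max 2 (2 / k1 * (P0 / t) powr (1 / (2 * s)))"
  have pos: "0 < t" "0 < F" "0 < s" "2 \<le> L" using c C r s by (auto simp: t_def F_def L_def)
  obtain K where K: "0 < K" "\<And>n. n \<ge> 1 \<Longrightarrow> K * kappa_sq \<kappa> n \<le> (\<kappa> n (nat \<lfloor>L * real (k_index \<kappa> n)\<rfloor>))\<^sup>2"
    using A(4) pos(4) unfolding A5_def by (metis add_le_imp_le_left less_le_trans one_less_numeral_iff semiring_norm(76))
  have L_rate: "P0 / t \<le> (L * k1 / 2) powr (2 * s)"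
  proof -
    have "(P0 / t) powr (1 / (2 * s)) \<le> L * k1 / 2"
      using b max.cobounded2[of "2 / k1 * (P0 / t) powr (1 / (2 * s))" 2] by (simp add: L_def field_simps max_def split: if_splits)
    then have "((P0 / t) powr (1 / (2 * s))) powr (2 * s) \<le> (L * k1 / 2) powr (2 * s)"
      using pos by (intro powr_mono2) auto
    then show ?thesis using pos \<open>0 < P0\<close> by (simp add: powr_powr)
  qed
  have "\<forall>\<^sub>F n in sequentially. K * b1 * F \<le> (real n)\<^sup>2 * signal_energy \<kappa> \<phi> n (f n)"
    using ev
  proof eventually_elim
    case (elim n)
    then have n: "n \<ge> 1" "0 < real n" by auto
    let ?k = "real (k_index \<kappa> n)"
    let ?u = "real n powr (- 2 * r)"
    define m where "m = nat \<lfloor>L * ?k\<rfloor>"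
    have k1: "1 \<le> ?k" using k_index_properties(1)[OF A(3) n(1)] by simp
    have Lk: "2 * ?k \<le> L * ?k" using pos by (intro mult_right_mono) auto
    have m_eq: "real m = of_int \<lfloor>L * ?k\<rfloor>" using Lk k1 by (simp add: m_def)
    have m_ge: "L / 2 * ?k \<le> real m" using Lk k1 unfolding m_eq by linarith
    have "1 \<le> L * ?k" using Lk k1 by linarith
    then have m1: "m \<ge> 1" by (simp add: m_def le_nat_iff le_floor_iff)
    have m_rate: "P0 / t * real n powr (2 * r) \<le> real m powr (2 * s)"
    proof -
      have "P0 / t * real n powr (2 * r) \<le> (L * k1 / 2) powr (2 * s) * (real n powr (2 - 4 * r)) powr (2 * s)"
        unfolding smoothness_rate[OF r(2) s] by (rule mult_right_mono[OF L_rate]) simp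
      also have "\<dots> = (L / 2 * (k1 * real n powr (2 - 4 * r))) powr (2 * s)"
        using pos b by (simp add: powr_mult[symmetric] mult_ac)
      also have "\<dots> \<le> (L / 2 * ?k) powr (2 * s)"
        using elim pos b by (intro powr_mono2 mult_left_mono) auto
      also have "\<dots> \<le> real m powr (2 * s)" using m_ge pos k1 by (intro powr_mono2) auto
      finally show ?thesis .
    qed
    let ?T = "\<Sum>\<^sub>\<infinity>j\<in>{m<..}. (l2_inner (g n) (\<phi> j))\<^sup>2"
    have T0: "0 \<le> ?T" by (intro infsum_nonneg) auto
    have "P0 / t * real n powr (2 * r) * ?T \<le> P0"
      using mult_right_mono[OF m_rate T0] besov_ball_tail[OF besov[OF n(1)] m1] by linarith
    then have "real n powr (2 * r) * ?T \<le> t" using pos \<open>0 < P0\<close> by (simp add: field_simps)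
    then have "?u * (real n powr (2 * r) * ?T) \<le> ?u * t" by (rule mult_left_mono) simp
    moreover have "?u * real n powr (2 * r) = 1" using n by (simp add: powr_add[symmetric])
    ultimately have tail: "?T \<le> t * ?u" by (simp add: mult.assoc[symmetric]) (simp add: mult.commute)
    have gL2: "g n \<in> L2_01" using g n by (simp add: norm_rate_def)
    have low: "F * ?u \<le> (\<Sum>j=1..m. (l2_inner (f n) (\<phi> j))\<^sup>2)"
      unfolding F_def
    proof (rule low_frequency_mass[where g = "g n" and C = C])
      show "c1\<^sup>2 * ?u \<le> l2_inner (g n) (f n)" "l2_inner (g n) (g n) \<le> C1\<^sup>2 * ?u"
        using norm_rate_inner[OF g c(1) n(1)] inner[OF n(1)] by auto
    qed (use f gL2 c C n tail in \<open>auto simp: t_def\<close>)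
    have "K * b1 * F = K * (b1 * (real n powr 2 * real n powr (2 * r - 2) * ?u)) * F"
      using n by (simp only: powr_add[symmetric]) simp
    also have "\<dots> = (real n)\<^sup>2 * (K * (b1 * real n powr (2 * r - 2)) * (F * ?u))"
      using n by (simp add: powr_numeral)
    also have "\<dots> \<le> (real n)\<^sup>2 * ((\<kappa> n m)\<^sup>2 * (\<Sum>j=1..m. (l2_inner (f n) (\<phi> j))\<^sup>2))"
    proof (intro mult_left_mono mult_mono)
      have "K * (b1 * real n powr (2 * r - 2)) \<le> K * kappa_sq \<kappa> n" using elim K by (intro mult_left_mono) auto
      also have "\<dots> \<le> (\<kappa> n m)\<^sup>2" unfolding m_def by (rule K(2)[OF n(1)])
      finally show "K * (b1 * real n powr (2 * r - 2)) \<le> (\<kappa> n m)\<^sup>2" .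
    qed (use low pos in auto)
    also have "(\<kappa> n m)\<^sup>2 * (\<Sum>j=1..m. (l2_inner (f n) (\<phi> j))\<^sup>2) \<le> (\<Sum>j=1..m. (\<kappa> n j)\<^sup>2 * (l2_inner (f n) (\<phi> j))\<^sup>2)"
      unfolding sum_distrib_left using A(1) n by (intro sum_mono mult_right_mono) (auto simp: A1_def)
    also have "\<dots> \<le> signal_energy \<kappa> \<phi> n (f n)"
      unfolding signal_energy_def
      by (intro finite_sum_le_infsum signal_energy_summable A(1) n f) auto
    finally show ?case by (simp add: mult_left_mono)
  qed
  moreover have "0 < K * b1 * F" using K b pos by simp
  ultimately show ?thesis by blast
qed

text \<open>The coordinates beyond \<open>L k\<^sub>n\<close> contribute at most a constant times \<open>L\<^sup>-\<^sup>l \<kappa>\<^sub>n\<^sup>2 \<parallel>f\<^sub>n\<parallel>\<^sup>2\<close> to the weighted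
  energy, and \<open>\<kappa>\<^sub>n\<^sup>2 \<parallel>f\<^sub>n\<parallel>\<^sup>2\<close> is of order \<open>n\<^sup>-\<^sup>2\<close>. For \<open>L\<close> large they account for at most half of it, and
  the other half comes from low frequencies, where all weights are at most a constant times
  \<open>\<kappa>\<^sub>n\<^sup>2\<close>.\<close>
lemma (in orthonormal_basis) low_frequency_mass_if_signal_energy_ge:
  assumes \<sigma>: "0 < \<sigma>"
    and A: "A1 \<kappa>" "A2 \<sigma> \<kappa>" "A3 r \<kappa>" "A5 \<kappa>" and A4: "A4 \<kappa>"
    and c: "0 < c" "0 < C" and f: "norm_rate r c C f"
    and \<delta>: "0 < \<delta>" "\<forall>\<^sub>F n in sequentially. \<delta> \<le> (real n)\<^sup>2 * signal_energy \<kappa> \<phi> n (f n)"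
  shows "\<exists>m a P. 0 < a \<and> 0 < P \<and> (\<forall>\<^sub>F n in sequentially.
      a * real n powr (- 2 * r) \<le> (\<Sum>j=1..m n. (l2_inner (f n) (\<phi> j))\<^sup>2) \<and> real (m n) \<le> P * real n powr (2 - 4 * r))"
proof -
  obtain b b1 b2 k1 k2 where b: "0 < b" "0 < b1" "0 < b2" "0 < k1" "0 < k2"
    and ev: "\<forall>\<^sub>F n in sequentially. n \<ge> 1 \<and> (\<kappa> n 1)\<^sup>2 \<le> b * kappa_sq \<kappa> n
      \<and> b1 * real n powr (2 * r - 2) \<le> kappa_sq \<kappa> n \<and> kappa_sq \<kappa> n \<le> b2 * real n powr (2 * r - 2)
      \<and> k1 * real n powr (2 - 4 * r) \<le> real (k_index \<kappa> n) \<and> real (k_index \<kappa> n) \<le> k2 * real n powr (2 - 4 * r)"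
    by (rule kappa_asymptotics[OF A \<sigma>])
  obtain D l where l: "1 < l" and D: "\<And>d n. 0 < d \<Longrightarrow> n \<ge> 1 \<Longrightarrow>
     (\<kappa> n (nat \<lfloor>(1 + d) * real (k_index \<kappa> n)\<rfloor>))\<^sup>2 < D * (1 + d) powr (- l) * kappa_sq \<kappa> n"
    using A4 unfolding A4_def by blast
  have "((\<lambda>L. D * L powr (- l) * b2 * C\<^sup>2) \<longlongrightarrow> D * 0 * b2 * C\<^sup>2) at_top"
    using l by (intro tendsto_intros tendsto_neg_powr filterlim_ident) auto
  then have "((\<lambda>L. D * L powr (- l) * b2 * C\<^sup>2) \<longlongrightarrow> 0) at_top" by simp
  from order_tendstoD(2)[OF this, of "\<delta> / 2"] \<delta>(1)
  have "\<forall>\<^sub>F L in at_top. D * L powr (- l) * b2 * C\<^sup>2 < \<delta> / 2 \<and> 1 < L"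
    by (intro eventually_conj eventually_gt_at_top) auto
  then obtain L where L: "D * L powr (- l) * b2 * C\<^sup>2 < \<delta> / 2" "1 < L"
    using eventually_happens[of _ "at_top :: real filter"] by fastforce
  define m where "m n = nat \<lfloor>L * real (k_index \<kappa> n)\<rfloor>" for n
  define a where "a = \<delta> / 2 / (b * b2)"
  have "\<forall>\<^sub>F n in sequentially.
      a * real n powr (- 2 * r) \<le> (\<Sum>j=1..m n. (l2_inner (f n) (\<phi> j))\<^sup>2) \<and> real (m n) \<le> L * k2 * real n powr (2 - 4 * r)"
    using ev \<delta>(2)
  proof eventually_elim
    case (elim n)
    then have n: "n \<ge> 1" "0 < real n" by auto
    let ?f = "\<lambda>j. (l2_inner (f n) (\<phi> j))\<^sup>2"
    let ?k = "real (k_index \<kappa> n)" and ?u = "real n powr (- 2 * r)" and ?w = "real n powr (2 * r - 2)"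
    have wu: "(real n)\<^sup>2 * (?w * ?u) = 1"
    proof -
      have "real n powr 2 * (?w * ?u) = 1" using n by (simp only: powr_add[symmetric]) simp
      then show ?thesis using n by (simp add: powr_numeral)
    qed
    have k1: "1 \<le> ?k" using k_index_properties(1)[OF A(3) n(1)] by simp
    have m1: "1 \<le> m n"
    proof -
      have "1 * 1 \<le> L * ?k" using L k1 by (intro mult_mono) auto
      then show ?thesis by (simp add: m_def le_nat_iff le_floor_iff)
    qed
    have fL2: "f n \<in> L2_01" using f n by (simp add: norm_rate_def)
    have km: "(\<kappa> n (m n))\<^sup>2 \<le> D * L powr (- l) * (b2 * ?w)"
    proof -
      have lt: "(\<kappa> n (m n))\<^sup>2 < D * L powr (- l) * kappa_sq \<kappa> n"
        using D[of "L - 1" n] L n by (simp add: m_def)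
      have K0: "0 < kappa_sq \<kappa> n" by (rule kappa_bounds(1)[OF A(1,3) n(1)])
      have "0 \<le> (\<kappa> n (m n))\<^sup>2" by simp
      then have "0 < D * L powr (- l) * kappa_sq \<kappa> n" using lt by linarith
      then have "0 < D * L powr (- l)" using K0 by (simp add: zero_less_mult_iff)
      then have "D * L powr (- l) * kappa_sq \<kappa> n \<le> D * L powr (- l) * (b2 * ?w)"
        using elim by (intro mult_left_mono) auto
      then show ?thesis using lt by linarith
    qed
    have sumf: "?f summable_on {1..}" by (rule has_sum_imp_summable[OF parseval[OF fL2]])
    have sumE: "(\<lambda>j. (\<kappa> n j)\<^sup>2 * ?f j) summable_on {1..}" by (rule signal_energy_summable[OF A(1) n(1) fL2])
    have split: "{1..} = {1..m n} \<union> {m n<..}" and disj: "{1..m n} \<inter> {m n<..} = {}" using m1 by auto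
    have sf: "?f summable_on {m n<..}" and sE: "(\<lambda>j. (\<kappa> n j)\<^sup>2 * ?f j) summable_on {m n<..}"
      by (rule summable_on_subset[OF sumf], force, rule summable_on_subset[OF sumE], force)
    have "signal_energy \<kappa> \<phi> n (f n) = (\<Sum>j=1..m n. (\<kappa> n j)\<^sup>2 * ?f j) + (\<Sum>\<^sub>\<infinity>j\<in>{m n<..}. (\<kappa> n j)\<^sup>2 * ?f j)"
      using infsum_Un_disjoint[OF _ sE disj] unfolding signal_energy_def split by simp
    also have "(\<Sum>j=1..m n. (\<kappa> n j)\<^sup>2 * ?f j) \<le> (\<kappa> n 1)\<^sup>2 * (\<Sum>j=1..m n. ?f j)"
      unfolding sum_distrib_left using A(1) n by (intro sum_mono mult_right_mono) (auto simp: A1_def)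
    also have "\<dots> \<le> b * (b2 * ?w) * (\<Sum>j=1..m n. ?f j)"
      using elim b by (intro mult_right_mono sum_nonneg) (meson mult_left_mono order_trans less_imp_le, auto)
    also have "(\<Sum>\<^sub>\<infinity>j\<in>{m n<..}. (\<kappa> n j)\<^sup>2 * ?f j) \<le> (\<Sum>\<^sub>\<infinity>j\<in>{m n<..}. (\<kappa> n (m n))\<^sup>2 * ?f j)"
      using A(1) n m1 by (intro infsum_mono sE summable_on_cmult_right sf mult_right_mono) (auto simp: A1_def)
    also have "\<dots> = (\<kappa> n (m n))\<^sup>2 * (\<Sum>\<^sub>\<infinity>j\<in>{m n<..}. ?f j)" by (rule infsum_cmult_right')
    also have "\<dots> \<le> D * L powr (- l) * (b2 * ?w) * (C\<^sup>2 * ?u)"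
    proof (rule mult_mono[OF km])
      have "(\<Sum>\<^sub>\<infinity>j\<in>{m n<..}. ?f j) \<le> infsum ?f {1..}" by (rule infsum_mono2[OF sf sumf]) auto
      also have "\<dots> \<le> C\<^sup>2 * ?u"
        using infsumI[OF parseval[OF fL2]] norm_rate_inner(2)[OF f c(1) n(1)] by simp
      finally show "(\<Sum>\<^sub>\<infinity>j\<in>{m n<..}. ?f j) \<le> C\<^sup>2 * ?u" .
      show "0 \<le> D * L powr (- l) * (b2 * ?w)" using km by (rule order_trans[rotated]) simp
    qed (auto intro: infsum_nonneg)
    also have "\<dots> = (D * L powr (- l) * b2 * C\<^sup>2) * (?w * ?u)" by simp
    also have "\<dots> \<le> \<delta> / 2 * (?w * ?u)" using L by (intro mult_right_mono) auto
    finally have E: "signal_energy \<kappa> \<phi> n (f n) \<le> b * (b2 * ?w) * (\<Sum>j=1..m n. ?f j) + \<delta> / 2 * (?w * ?u)" by simp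
    have "\<delta> * (?w * ?u) \<le> (real n)\<^sup>2 * signal_energy \<kappa> \<phi> n (f n) * (?w * ?u)"
      using elim by (intro mult_right_mono) auto
    also have "\<dots> = signal_energy \<kappa> \<phi> n (f n) * ((real n)\<^sup>2 * (?w * ?u))" by simp
    also have "\<dots> = signal_energy \<kappa> \<phi> n (f n)" unfolding wu by simp
    finally have "\<delta> / 2 * (?w * ?u) \<le> b * (b2 * ?w) * (\<Sum>j=1..m n. ?f j)" using E by simp
    then have "?w * (\<delta> / 2 * ?u) \<le> ?w * (b * b2 * (\<Sum>j=1..m n. ?f j))" by (simp add: mult_ac)
    moreover have "0 < ?w" using n by simp
    ultimately have "\<delta> / 2 * ?u \<le> b * b2 * (\<Sum>j=1..m n. ?f j)" by (rule mult_left_le_imp_le)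
    then have 1: "a * ?u \<le> (\<Sum>j=1..m n. ?f j)" using b by (simp add: a_def field_simps)
    have "real (m n) \<le> L * ?k" using L k1 by (simp add: m_def)
    also have "\<dots> \<le> L * (k2 * real n powr (2 - 4 * r))" using elim L by (intro mult_left_mono) auto
    finally show ?case using 1 by simp
  qed
  moreover have "0 < a" "0 < L * k2" using \<delta> b L by (auto simp: a_def)
  ultimately show ?thesis by blast
qed

text \<open>For the finitely many remaining \<open>n\<close> some cut-off retains at least half of the lower bound
  \<open>c\<^sup>2 n\<^sup>-\<^sup>2\<^sup>r\<close> on the energy, by Parseval's identity, and finitely many cut-offs can be absorbed into the constant.\<close>
lemma (in orthonormal_basis) uniform_low_frequency_mass:
  assumes r: "r < 1 / 2" and c: "0 < c" and f: "norm_rate r c C f" and a: "0 < a" "0 < P"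
    and ev: "\<forall>\<^sub>F n in sequentially. a * real n powr (- 2 * r) \<le> (\<Sum>j=1..m n. (l2_inner (f n) (\<phi> j))\<^sup>2)
      \<and> real (m n) \<le> P * real n powr (2 - 4 * r)"
  shows "\<exists>m a P. 0 < a \<and> 0 < P \<and> (\<forall>n\<ge>1.
      a * real n powr (- 2 * r) \<le> (\<Sum>j=1..m n. (l2_inner (f n) (\<phi> j))\<^sup>2) \<and> real (m n) \<le> P * real n powr (2 - 4 * r))"
proof -
  let ?S = "\<lambda>n k. \<Sum>j=1..k. (l2_inner (f n) (\<phi> j))\<^sup>2"
  obtain N where N: "\<And>n. n \<ge> N \<Longrightarrow> a * real n powr (- 2 * r) \<le> ?S n (m n) \<and> real (m n) \<le> P * real n powr (2 - 4 * r)"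
    using ev by (auto simp: eventually_sequentially)
  have "\<exists>k. c\<^sup>2 / 2 * real n powr (- 2 * r) \<le> ?S n k" if n: "n \<ge> 1" for n
  proof -
    have "f n \<in> L2_01" using f n by (simp add: norm_rate_def)
    then have "(\<lambda>k. ?S n k) \<longlonglongrightarrow> l2_inner (f n) (f n)" by (intro has_sum_from_1_LIMSEQ parseval)
    moreover have "c\<^sup>2 / 2 * real n powr (- 2 * r) < l2_inner (f n) (f n)"
    proof -
      have "0 < c\<^sup>2 * real n powr (- 2 * r)" using c n by simp
      then show ?thesis using norm_rate_inner(1)[OF f c n] by simp
    qed
    ultimately have "\<forall>\<^sub>F k in sequentially. c\<^sup>2 / 2 * real n powr (- 2 * r) < ?S n k" by (rule order_tendstoD)
    then show ?thesis using eventually_happens[of _ "sequentially"] by (force intro: less_imp_le)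
  qed
  then obtain k where k: "\<And>n. n \<ge> 1 \<Longrightarrow> c\<^sup>2 / 2 * real n powr (- 2 * r) \<le> ?S n (k n)" by metis
  define m' where "m' n = (if n < N then k n else m n)" for n
  define a' where "a' = min a (c\<^sup>2 / 2)"
  define P' where "P' = P + (\<Sum>i<N. real (k i))"
  have a': "0 < a'" "a' \<le> a" "a' \<le> c\<^sup>2 / 2" using a c by (auto simp: a'_def)
  have P': "0 < P'" using a by (auto simp: P'_def intro!: add_pos_nonneg sum_nonneg)
  have "a' * real n powr (- 2 * r) \<le> ?S n (m' n) \<and> real (m' n) \<le> P' * real n powr (2 - 4 * r)" if n: "n \<ge> 1" for n
  proof (cases "n < N")
    case True
    have "real (k n) \<le> (\<Sum>i<N. real (k i))" by (rule member_le_sum) (use True in auto)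
    also have "\<dots> \<le> P' * 1" using a by (simp add: P'_def)
    also have "\<dots> \<le> P' * real n powr (2 - 4 * r)" using P' n r by (intro mult_left_mono ge_one_powr_ge_zero) auto
    finally have "real (k n) \<le> P' * real n powr (2 - 4 * r)" .
    moreover have "a' * real n powr (- 2 * r) \<le> ?S n (k n)"
      by (rule order_trans[OF mult_right_mono[OF a'(3)] k[OF n]]) simp
    ultimately show ?thesis using True by (simp add: m'_def)
  next
    case False
    have "P * real n powr (2 - 4 * r) \<le> P' * real n powr (2 - 4 * r)"
      by (intro mult_right_mono) (auto simp: P'_def sum_nonneg)
    moreover have "a' * real n powr (- 2 * r) \<le> a * real n powr (- 2 * r)"
      using a' by (intro mult_right_mono) auto
    ultimately show ?thesis using N[of n] False by (auto simp: m'_def)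
  qed
  then show ?thesis using a' P' by blast
qed

theorem theorem4p5:
  fixes r s \<sigma> :: real
    and M :: "'w measure"
    and W :: "(real \<Rightarrow> real) \<Rightarrow> 'w \<Rightarrow> real"
    and \<phi> :: "nat \<Rightarrow> real \<Rightarrow> real"
    and \<kappa> :: "nat \<Rightarrow> nat \<Rightarrow> real"
  assumes "0 < r" and "r < 1 / 2" and "0 < \<sigma>"
    and "white_noise M W" and "l2_basis \<phi>"
    and "A1 \<kappa>" and "A2 \<sigma> \<kappa>" and "A3 r \<kappa>" and "A4 \<kappa>" and "A5 \<kappa>"
    and "s = r / (2 - 4 * r)"
  shows "(\<forall>f c C. 0 < c \<and> c < C \<and> norm_rate r c C f \<longrightarrow>
            (consistent M W \<sigma> \<phi> \<kappa> f \<longleftrightarrow>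
              (\<exists>P0>0. \<exists>c1 C1 f1. 0 < c1 \<and> c1 < C1 \<and> norm_rate r c1 C1 f1 \<and>
                 (\<forall>n\<ge>1. f1 n \<in> besov_ball \<phi> s P0 \<and>
                    l2_inner (f1 n) (\<lambda>t. f n t - f1 n t) = 0 \<and>
                    (l2_norm (f n))\<^sup>2 = (l2_norm (f1 n))\<^sup>2 + (l2_norm (\<lambda>t. f n t - f1 n t))\<^sup>2))))
       \<and> (\<forall>P0>0. \<forall>c1 C1 f1 f2. 0 < c1 \<and> c1 < C1 \<and> norm_rate r c1 C1 f1 \<and>
            norm_rate r c1 C1 f2 \<and>
            (\<forall>n\<ge>1. f1 n \<in> besov_ball \<phi> s P0 \<and> l2_inner (f2 n) (f1 n) = 0) \<longrightarrow>
            consistent M W \<sigma> \<phi> \<kappa> (\<lambda>n t. f1 n t + f2 n t))"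
proof (intro conjI allI impI)
  interpret orthonormal_basis \<phi> by unfold_locales (rule assms(5))
  note crit = consistent_iff_signal_energy[OF assms(4,5,3,2,6,7,8,10)]
  note smooth_part = signal_energy_ge_if_smooth_part[OF assms(1,2,11,3,6,7,8,10)]
  have s0: "0 < s" using assms(1,2,11) by simp
  fix f c C assume H: "0 < c \<and> c < C \<and> norm_rate r c C f"
  then have c: "0 < c" "0 < C" "c < C" and rate: "norm_rate r c C f" by auto
  have fL2: "f n \<in> L2_01" if "n \<ge> 1" for n using rate that by (simp add: norm_rate_def)
  show "consistent M W \<sigma> \<phi> \<kappa> f \<longleftrightarrow>
      (\<exists>P0>0. \<exists>c1 C1 f1. 0 < c1 \<and> c1 < C1 \<and> norm_rate r c1 C1 f1 \<and>
         (\<forall>n\<ge>1. f1 n \<in> besov_ball \<phi> s P0 \<and>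
            l2_inner (f1 n) (\<lambda>t. f n t - f1 n t) = 0 \<and>
            (l2_norm (f n))\<^sup>2 = (l2_norm (f1 n))\<^sup>2 + (l2_norm (\<lambda>t. f n t - f1 n t))\<^sup>2))"
  proof
    assume "consistent M W \<sigma> \<phi> \<kappa> f"
    then obtain \<delta> where \<delta>: "0 < \<delta>" "\<forall>\<^sub>F n in sequentially. \<delta> \<le> (real n)\<^sup>2 * signal_energy \<kappa> \<phi> n (f n)"
      using crit[where f = f, OF fL2] by blast
    from low_frequency_mass_if_signal_energy_ge[OF assms(3,6-8,10,9) c(1,2) rate \<delta>]
    obtain m0 a0 P0 where m0: "0 < a0" "0 < P0" "\<forall>\<^sub>F n in sequentially.
        a0 * real n powr (- 2 * r) \<le> (\<Sum>j=1..m0 n. (l2_inner (f n) (\<phi> j))\<^sup>2)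
        \<and> real (m0 n) \<le> P0 * real n powr (2 - 4 * r)"
      by (elim exE conjE) (rule that)
    from uniform_low_frequency_mass[OF assms(2) c(1) rate m0]
    obtain m a P where a: "0 < a" "0 < P" and m': "\<forall>n\<ge>1.
        a * real n powr (- 2 * r) \<le> (\<Sum>j=1..m n. (l2_inner (f n) (\<phi> j))\<^sup>2)
        \<and> real (m n) \<le> P * real n powr (2 - 4 * r)"
      by (elim exE conjE) (rule that)
    have m: "a * real n powr (- 2 * r) \<le> (\<Sum>j=1..m n. (l2_inner (f n) (\<phi> j))\<^sup>2)"
        "real (m n) \<le> P * real n powr (2 - 4 * r)" if "n \<ge> 1" for n
      using m' that by auto
    define f1 where "f1 n = partial_expansion \<phi> (m n) (f n)" for n
    define P0 where "P0 = P powr (2 * s) * C\<^sup>2"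
    define c1 where "c1 = min (sqrt a) (C / 2)"
    have c1: "0 < c1" "c1 < C" "c1 \<le> sqrt a" using a c by (auto simp: c1_def min_def)
    have P0: "0 < P0" using a c by (simp add: P0_def)
    have f1L2: "f1 n \<in> L2_01" for n unfolding f1_def by (rule partial_expansion_L2)
    have orth: "l2_inner (f1 n) (\<lambda>t. f n t - f1 n t) = 0" if "n \<ge> 1" for n
      unfolding f1_def by (rule partial_expansion_orthogonal[OF fL2[OF that]])
    have pyth: "(l2_norm (f n))\<^sup>2 = (l2_norm (f1 n))\<^sup>2 + (l2_norm (\<lambda>t. f n t - f1 n t))\<^sup>2" if "n \<ge> 1" for n
      unfolding l2_norm_power2 by (rule l2_pythagoras[OF fL2[OF that] f1L2 orth[OF that]])
    have up: "l2_norm (f1 n) \<le> l2_norm (f n)" if "n \<ge> 1" for n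
      by (rule power2_le_imp_le) (use pyth[OF that] l2_norm_nonneg in auto)
    have "norm_rate r c1 C f1"
      unfolding norm_rate_def
    proof (intro allI impI conjI f1L2)
      fix n :: nat assume n: "1 \<le> n"
      show "l2_norm (f1 n) \<le> C * real n powr (- r)"
        using up[OF n] rate n by (force simp: norm_rate_def)
      have "(sqrt a * real n powr (- r))\<^sup>2 \<le> (l2_norm (f1 n))\<^sup>2"
        unfolding powr_rate_squared f1_def norm_partial_expansion using m(1)[OF n] a by simp
      then have "sqrt a * real n powr (- r) \<le> l2_norm (f1 n)"
        by (rule power2_le_imp_le) (rule l2_norm_nonneg)
      moreover have "c1 * real n powr (- r) \<le> sqrt a * real n powr (- r)"
        using c1 by (intro mult_right_mono) auto
      ultimately show "c1 * real n powr (- r) \<le> l2_norm (f1 n)" by linarith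
    qed
    moreover have "f1 n \<in> besov_ball \<phi> s P0" if n: "n \<ge> 1" for n
      unfolding f1_def
    proof (rule partial_expansion_in_besov_ball)
      have "real (m n) powr (2 * s) \<le> (P * real n powr (2 - 4 * r)) powr (2 * s)"
        using m(2)[OF n] s0 by (intro powr_mono2) auto
      also have "\<dots> = P powr (2 * s) * real n powr (2 * r)"
        using a by (simp add: powr_mult smoothness_rate[OF assms(2,11)])
      finally have 1: "real (m n) powr (2 * s) \<le> P powr (2 * s) * real n powr (2 * r)" .
      have "(\<Sum>j=1..m n. (l2_inner (f n) (\<phi> j))\<^sup>2) = (l2_norm (f1 n))\<^sup>2"
        unfolding f1_def norm_partial_expansion ..
      also have "\<dots> \<le> (l2_norm (f n))\<^sup>2" using pyth[OF n] by simp
      also have "\<dots> \<le> C\<^sup>2 * real n powr (- 2 * r)"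
        unfolding l2_norm_power2 by (rule norm_rate_inner(2)[OF rate c(1) n])
      finally have "real (m n) powr (2 * s) * (\<Sum>j=1..m n. (l2_inner (f n) (\<phi> j))\<^sup>2)
          \<le> (P powr (2 * s) * real n powr (2 * r)) * (C\<^sup>2 * real n powr (- 2 * r))"
        using 1 by (intro mult_mono sum_nonneg) auto
      also have "\<dots> = P0 * (real n powr (2 * r) * real n powr (- 2 * r))" by (simp add: P0_def)
      also have "real n powr (2 * r) * real n powr (- 2 * r) = 1"
        using n by (simp add: powr_add[symmetric])
      finally show "real (m n) powr (2 * s) * (\<Sum>j=1..m n. (l2_inner (f n) (\<phi> j))\<^sup>2) \<le> P0" by simp
    qed (use s0 P0 in auto)
    ultimately show "\<exists>P0>0. \<exists>c1 C1 f1. 0 < c1 \<and> c1 < C1 \<and> norm_rate r c1 C1 f1 \<and>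
         (\<forall>n\<ge>1. f1 n \<in> besov_ball \<phi> s P0 \<and>
            l2_inner (f1 n) (\<lambda>t. f n t - f1 n t) = 0 \<and>
            (l2_norm (f n))\<^sup>2 = (l2_norm (f1 n))\<^sup>2 + (l2_norm (\<lambda>t. f n t - f1 n t))\<^sup>2)"
      using P0 c1(1,2) orth pyth by blast
  next
    assume "\<exists>P0>0. \<exists>c1 C1 f1. 0 < c1 \<and> c1 < C1 \<and> norm_rate r c1 C1 f1 \<and>
         (\<forall>n\<ge>1. f1 n \<in> besov_ball \<phi> s P0 \<and>
            l2_inner (f1 n) (\<lambda>t. f n t - f1 n t) = 0 \<and>
            (l2_norm (f n))\<^sup>2 = (l2_norm (f1 n))\<^sup>2 + (l2_norm (\<lambda>t. f n t - f1 n t))\<^sup>2)"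
    then obtain P0 c1 C1 f1 where P0: "0 < P0" and c1: "0 < c1" "c1 < C1" and rate1: "norm_rate r c1 C1 f1"
      and f1: "\<And>n. n \<ge> 1 \<Longrightarrow> f1 n \<in> besov_ball \<phi> s P0"
        "\<And>n. n \<ge> 1 \<Longrightarrow> l2_inner (f1 n) (\<lambda>t. f n t - f1 n t) = 0" by blast
    have f1L2: "f1 n \<in> L2_01" if "n \<ge> 1" for n using rate1 that by (simp add: norm_rate_def)
    have "\<exists>\<delta>>0. \<forall>\<^sub>F n in sequentially. \<delta> \<le> (real n)\<^sup>2 * signal_energy \<kappa> \<phi> n (f n)"
    proof (rule smooth_part[where g = f1 and f = f and C = C, OF c1 P0 rate1])
      fix n :: nat assume n: "1 \<le> n"
      show "l2_inner (f1 n) (f n) = l2_inner (f1 n) (f1 n)"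
        using f1(2)[OF n] l2_inner_diff[OF fL2[OF n] f1L2[OF n] f1L2[OF n]]
        by (simp add: l2_inner_commute[of "f1 n" "f n"] l2_inner_commute[of "f1 n" "\<lambda>t. f n t - f1 n t"])
    qed (fact f1(1) fL2 norm_rate_inner(2)[OF rate c(1)] c(2))+
    then show "consistent M W \<sigma> \<phi> \<kappa> f" using crit[where f = f, OF fL2] by blast
  qed
next
  interpret orthonormal_basis \<phi> by unfold_locales (rule assms(5))
  note crit = consistent_iff_signal_energy[OF assms(4,5,3,2,6,7,8,10)]
  note smooth_part = signal_energy_ge_if_smooth_part[OF assms(1,2,11,3,6,7,8,10)]
  fix P0 c1 C1 :: real and f1 f2 assume P0: "0 < P0"
    and H: "0 < c1 \<and> c1 < C1 \<and> norm_rate r c1 C1 f1 \<and> norm_rate r c1 C1 f2 \<and>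
            (\<forall>n\<ge>1. f1 n \<in> besov_ball \<phi> s P0 \<and> l2_inner (f2 n) (f1 n) = 0)"
  let ?f = "\<lambda>n t. f1 n t + f2 n t"
  have c1: "0 < c1" "c1 < C1" and rate1: "norm_rate r c1 C1 f1" and rate2: "norm_rate r c1 C1 f2" using H by auto
  have L: "f1 n \<in> L2_01" "f2 n \<in> L2_01" "?f n \<in> L2_01" if "n \<ge> 1" for n
    using rate1 rate2 that by (auto simp: norm_rate_def intro: L2_01_add)
  have orth: "l2_inner (f2 n) (f1 n) = 0" if "n \<ge> 1" for n using H that by blast
  have i1: "l2_inner (f1 n) (?f n) = l2_inner (f1 n) (f1 n)" if n: "n \<ge> 1" for n
    using l2_inner_add[OF L(1,2,1)[OF n]] orth[OF n] by (simp add: l2_inner_commute[of "f1 n" "?f n"])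
  have "\<exists>\<delta>>0. \<forall>\<^sub>F n in sequentially. \<delta> \<le> (real n)\<^sup>2 * signal_energy \<kappa> \<phi> n (?f n)"
  proof (rule smooth_part[where g = f1 and f = ?f and C = "2 * C1", OF c1 P0 rate1])
    fix n :: nat assume n: "1 \<le> n"
    show "f1 n \<in> besov_ball \<phi> s P0" using H n by blast
    have "l2_inner (?f n) (?f n) = l2_inner (f1 n) (f1 n) + l2_inner (f2 n) (f2 n)"
      using l2_inner_add[OF L(1,2,3)[OF n]] l2_inner_add[OF L(1,2,2)[OF n]] orth[OF n] i1[OF n]
      by (simp add: l2_inner_commute[of "f1 n" "f2 n"] l2_inner_commute[of "f2 n" "?f n"])
    also have "\<dots> \<le> C1\<^sup>2 * real n powr (- 2 * r) + C1\<^sup>2 * real n powr (- 2 * r)"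
      by (intro add_mono norm_rate_inner(2)[OF rate1 c1(1) n] norm_rate_inner(2)[OF rate2 c1(1) n])
    also have "\<dots> \<le> (2 * C1)\<^sup>2 * real n powr (- 2 * r)" by (simp add: power_mult_distrib)
    finally show "l2_inner (?f n) (?f n) \<le> (2 * C1)\<^sup>2 * real n powr (- 2 * r)" .
  qed (use c1 L(3) i1 in simp_all)
  then show "consistent M W \<sigma> \<phi> \<kappa> (\<lambda>n t. f1 n t + f2 n t)" using crit[where f = ?f, OF L(3)] by blast
qed

end
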